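(* Let $n \geq 2$ be a natural number, and let $k, k'$ be integers with $1 \leq k < n$ and $0 \leq k' < n$. Then the sets $\mathcal{S}_k(n)$ and $\mathcal{S}^*_{k'}(n)$ have only upper accumulation points (i.e., no real number is a lower accumulation point of either set). On the level of sets, $$\mathrm{acc}(\mathcal{S}_k(n)) \subseteq \mathcal{S}_{k+1}(n) \subseteq \mathcal{S}^*_{k+1}(n) = \mathcal{S}^*_0(n-k-1),$$ and on the level of multisets, $$\mathrm{den}(\mathcal{S}_{k,\mathrm{mult}}(n)) = \mathcal{S}_{k+1}(n) \quad\text{and}\quad \mathrm{den}(\mathcal{S}^*_{k',\mathrm{mult}}(n)) = \mathcal{S}^*_{k'+1}(n) = \mathcal{S}^*_{k'}(n-1).$$ Moreover, when $k=1$, also $\mathcal{S}(n-1) \subseteq \mathrm{acc}(\mathcal{S}(n))$, which implies that $$\mathcal{S}(n-1) \subseteq \mathrm{acc}(\mathcal{S}(n)) \subseteq \mathcal{S}_2(n) \subseteq \mathcal{S}^*_2(n) = \mathcal{S}^*(n-1).$$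
   Context: Let $\pi : \mathbb{R}^n \to (\mathbb{R}/\mathbb{Z})^n$ be the quotient map. "Subgroup" of $(\mathbb{R}/\mathbb{Z})^n$ always means closed subgroup. A $k$-dimensional subtorus is a closed connected subgroup of dimension $k$, i.e. $\pi(W)$ with $W\subseteq \mathbb{R}^n$ a $k$-dimensional linear subspace spanned by integer vectors. Every subgroup is the direct product of a subtorus (its identity component) and a finite subgroup; its dimension is the dimension of that subtorus. For a closed subset $X \subseteq (\mathbb{R}/\mathbb{Z})^n$, $D(X)$ is the $L^\infty$-distance from $X$ to $(1/2,\ldots,1/2)$: $D(X)=\inf_{x\in X}\max_{i}\|x_i-1/2\|_{\mathbb{R}/\mathbb{Z}}$, where $\|y\|_{\mathbb{R}/\mathbb{Z}}$ is the distance from $y$ to the nearest integer. $X$ is proper if it is not contained in the union of the coordinate hyperplanes $\{x_i=0\}$, $1\le i\le n$ (equivalently $D(X)<1/2$). For $1\le k\le n$, $\mathcal{S}_k(n)$ is the set of values $D(T)$ as $T$ ranges over $k$-dimensional proper subtori of $(\mathbb{R}/\mathbb{Z})^n$. For $0\le k\le n$, $\mathcal{S}^*_k(n)$ is the set of values $D(\Delta)$ as $\Delta$ ranges over $k$-dimensional proper subgroups of $(\mathbb{R}/\mathbb{Z})^n$. Convention: $\mathcal{S}^*_0(0)=\{0\}$. Write $\mathcal{S}(n)=\mathcal{S}_1(n)$ and $\mathcal{S}^*(n)=\mathcal{S}^*_1(n)$. The multisets $\mathcal{S}_{k,\mathrm{mult}}(n)$ and $\mathcal{S}^*_{k,\mathrm{mult}}(n)$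 are obtained by recording each value with multiplicity equal to the number of $k$-dimensional proper subtori (respectively, proper subgroups) attaining it. For $\mathcal{S}\subseteq\mathbb{R}$, a real $x$ is an upper accumulation point if $\mathcal{S}\cap(x,x+\varepsilon)\ne\emptyset$ for all $\varepsilon>0$, and a lower accumulation point if $\mathcal{S}\cap(x-\varepsilon,x)\neq\emptyset$ for all $\varepsilon>0$. $\mathrm{acc}(\mathcal{S})$ is the set of all accumulation points of $\mathcal{S}$. For a multiset $\mathcal{S}$, $\mathrm{den}(\mathcal{S})$ is the set of density points: the accumulation points of $\mathcal{S}$ together with the elements of $\mathcal{S}$ of infinite multiplicity. *)

theory Defs
  imports
    "HOL-Analysis.Analysis"
    "HOL-Algebra.Group"
    "HOL-Library.Function_Algebras"
    "HOL-Library.Extended_Nat"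
begin

section \<open>The circle group\<close>

quotient_type circle = real / "\<lambda>x y :: real. x - y \<in> \<int>"
proof (rule equivpI)
  show "reflp (\<lambda>x y :: real. x - y \<in> \<int>)"
    by (simp add: reflp_def)
  show "symp (\<lambda>x y :: real. x - y \<in> \<int>)"
    unfolding symp_def by (metis Ints_minus minus_diff_eq)
  show "transp (\<lambda>x y :: real. x - y \<in> \<int>)"
    unfolding transp_def by (metis Ints_add diff_add_cancel add_diff_eq)
qed

lift_definition to_circle :: "real \<Rightarrow> circle" is "\<lambda>x. x" .

instantiation circle :: ab_group_add
begin

lift_definition zero_circle :: circle is 0 .

lift_definition plus_circle :: "circle \<Rightarrow> circle \<Rightarrow> circle" is "(+)"
  by (metis Ints_add add_diff_add)

lift_definition uminus_circle :: "circle \<Rightarrow> circle" is uminus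
  by (metis Ints_minus minus_diff_minus)

lift_definition minus_circle :: "circle \<Rightarrow> circle \<Rightarrow> circle" is "(-)"
proof -
  fix a b c d :: real
  assume "a - b \<in> \<int>" "c - d \<in> \<int>"
  then have "(a - b) - (c - d) \<in> \<int>" by (rule Ints_diff)
  then show "a - c - (b - d) \<in> \<int>" by (simp add: algebra_simps)
qed

instance
  by standard (transfer; simp)+

end

lemma infdist_Ints_shift:
  fixes x m :: real
  assumes "m \<in> \<int>"
  shows "infdist (x + m) \<int> \<le> infdist x \<int>"
proof -
  have ne: "(\<int> :: real set) \<noteq> {}" by auto
  have "infdist (x + m) \<int> \<le> dist x a" if "a \<in> \<int>" for a
    using infdist_le[of "a + m" \<int> "x + m"] that assms by (simp add: dist_real_def)
  then show ?thesis
    unfolding infdist_notempty[OF ne, of x] by (intro cINF_greatest ne)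
qed

text \<open>The distance to the nearest integer.\<close>

lift_definition circle_norm :: "circle \<Rightarrow> real" is "\<lambda>x. infdist x \<int>"
proof -
  fix x y :: real
  assume "x - y \<in> \<int>"
  then have "y - x \<in> \<int>" by (metis Ints_minus minus_diff_eq)
  show "infdist x \<int> = infdist y \<int>"
    using infdist_Ints_shift[OF \<open>x - y \<in> \<int>\<close>, of y] infdist_Ints_shift[OF \<open>y - x \<in> \<int>\<close>, of x]
    by simp
qed

lemma circle_norm_to_circle: "circle_norm (to_circle x) = infdist x \<int>"
  by transfer simp

lemma to_circle_diff: "to_circle x - to_circle y = to_circle (x - y)"
  by transfer simp

lemma to_circle_0: "to_circle 0 = 0"
  by transfer simp

lemma to_circle_eq_iff: "to_circle x = to_circle y \<longleftrightarrow> x - y \<in> \<int>"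
  by transfer simp

lemma to_circle_cases: obtains x where "c = to_circle x"
  by transfer (metis Ints_0 diff_self)

lemma circle_norm_less:
  assumes "infdist x \<int> < e"
  obtains m where "m \<in> \<int>" "\<bar>x - m\<bar> < e"
proof -
  have ne: "(\<int> :: real set) \<noteq> {}" by auto
  have "bdd_below (dist x ` \<int>)" by (rule bdd_belowI[of _ 0]) auto
  then show ?thesis
    using assms that unfolding infdist_notempty[OF ne]
    by (auto simp: cINF_less_iff[OF ne] dist_real_def)
qed

text \<open>The topology is the quotient topology; it is induced by the metric given by
  \<open>circle_norm\<close>.\<close>

instantiation circle :: metric_space
begin

definition open_circle :: "circle set \<Rightarrow> bool"
  where "open_circle U \<longleftrightarrow> open (to_circle -` U)"

definition dist_circle :: "circle \<Rightarrow> circle \<Rightarrow> real"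
  where "dist_circle x y = circle_norm (x - y)"

definition uniformity_circle :: "(circle \<times> circle) filter"
  where "uniformity_circle = (INF e\<in>{0 <..}. principal {(x, y). dist x y < e})"

instance
proof
  show "uniformity = (INF e\<in>{0 <..}. principal {(x :: circle, y). dist x y < e})"
    by (rule uniformity_circle_def)
  have ev: "eventually P uniformity \<longleftrightarrow> (\<exists>e>0. \<forall>x y. dist x y < e \<longrightarrow> P (x, y))"
    for P :: "circle \<times> circle \<Rightarrow> bool"
    unfolding uniformity_circle_def
    by (subst eventually_INF_base)
       (auto simp: eventually_principal subset_eq intro: bexI[of _ "min _ _"])
  have dist: "dist (to_circle x) (to_circle y) = infdist (x - y) \<int>" for x y
    by (simp add: dist_circle_def to_circle_diff circle_norm_to_circle)
  show "open U \<longleftrightarrow> (\<forall>x\<in>U. \<forall>\<^sub>F (x', y) in uniformity. x' = x \<longrightarrow> y \<in> U)"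
    for U :: "circle set"
  proof -
    have "open U \<longleftrightarrow> (\<forall>x\<in>U. \<exists>e>0. \<forall>y. dist x y < e \<longrightarrow> y \<in> U)"
    proof
      assume "open U"
      show "\<forall>x\<in>U. \<exists>e>0. \<forall>y. dist x y < e \<longrightarrow> y \<in> U"
      proof
        fix c assume "c \<in> U"
        obtain x where x: "c = to_circle x" by (rule to_circle_cases)
        from \<open>open U\<close> have "open (to_circle -` U)" by (simp add: open_circle_def)
        moreover have "x \<in> to_circle -` U" using \<open>c \<in> U\<close> x by simp
        ultimately obtain e where e: "e > 0" "\<And>y. dist y x < e \<Longrightarrow> to_circle y \<in> U"
          unfolding open_dist by auto
        have "d \<in> U" if d: "dist c d < e" for d
        proof -
          obtain y where y: "d = to_circle y" by (rule to_circle_cases)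
          from d have "infdist (x - y) \<int> < e" by (simp add: x y dist)
          then obtain m where m: "m \<in> \<int>" "\<bar>x - y - m\<bar> < e" by (rule circle_norm_less)
          have "to_circle (y + m) \<in> U" using e(2)[of "y + m"] m by (simp add: dist_real_def)
          moreover have "to_circle (y + m) = d" using m by (simp add: y to_circle_eq_iff)
          ultimately show ?thesis by simp
        qed
        then show "\<exists>e>0. \<forall>y. dist c y < e \<longrightarrow> y \<in> U" using e(1) by blast
      qed
    next
      assume *: "\<forall>x\<in>U. \<exists>e>0. \<forall>y. dist x y < e \<longrightarrow> y \<in> U"
      show "open U"
        unfolding open_circle_def open_dist
      proof
        fix x assume "x \<in> to_circle -` U"
        with * obtain e where e: "e > 0" "\<And>y. dist (to_circle x) y < e \<Longrightarrow> y \<in> U" by blast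
        have "y \<in> to_circle -` U" if "dist y x < e" for y
        proof -
          have "infdist (x - y) \<int> \<le> dist (x - y) 0" by (rule infdist_le) simp
          also have "\<dots> < e" using that by (simp add: dist_real_def)
          finally show ?thesis using e(2)[of "to_circle y"] by (simp add: dist)
        qed
        then show "\<exists>e>0. \<forall>y. dist y x < e \<longrightarrow> y \<in> to_circle -` U" using e(1) by blast
      qed
    qed
    then show ?thesis by (auto simp: ev)
  qed
  show "dist c d = 0 \<longleftrightarrow> c = d" for c d :: circle
  proof -
    obtain x where x: "c = to_circle x" by (rule to_circle_cases)
    obtain y where y: "d = to_circle y" by (rule to_circle_cases)
    have "infdist (x - y) \<int> = 0 \<longleftrightarrow> x - y \<in> \<int>"
      by (metis closed_Ints in_closed_iff_infdist_zero Ints_0 empty_iff)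
    then show ?thesis by (simp add: x y dist to_circle_eq_iff)
  qed
  show "dist c d \<le> dist c b + dist d b" for c d b :: circle
  proof (rule field_le_epsilon)
    fix e :: real assume "e > 0"
    obtain x where x: "c = to_circle x" by (rule to_circle_cases)
    obtain y where y: "d = to_circle y" by (rule to_circle_cases)
    obtain z where z: "b = to_circle z" by (rule to_circle_cases)
    have "infdist (x - z) \<int> < infdist (x - z) \<int> + e / 2" using \<open>e > 0\<close> by simp
    then obtain m where m: "m \<in> \<int>" "\<bar>x - z - m\<bar> < infdist (x - z) \<int> + e / 2"
      by (rule circle_norm_less)
    have "infdist (y - z) \<int> < infdist (y - z) \<int> + e / 2" using \<open>e > 0\<close> by simp
    then obtain k where k: "k \<in> \<int>" "\<bar>y - z - k\<bar> < infdist (y - z) \<int> + e / 2"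
      by (rule circle_norm_less)
    have "infdist (x - y) \<int> \<le> dist (x - y) (m - k)" using m k by (intro infdist_le Ints_diff)
    also have "\<dots> \<le> \<bar>x - z - m\<bar> + \<bar>y - z - k\<bar>" by (simp add: dist_real_def)
    also have "\<dots> \<le> infdist (x - z) \<int> + infdist (y - z) \<int> + e" using m k by simp
    finally show "dist c d \<le> dist c b + dist d b + e" by (simp add: x y z dist)
  qed
qed

end

section \<open>The torus, its subtori and its closed subgroups\<close>

text \<open>Since several dimensions occur in one statement, an \<open>n\<close>-dimensional vector is a function on
  \<open>nat\<close> that vanishes from index \<open>n\<close> on. The product topology on functions then induces the
  usual topology on \<open>\<real>\<^sup>n\<close> and on the torus.\<close>

definition vecs :: "nat \<Rightarrow> (nat \<Rightarrow> 'a::zero) set"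
  where "vecs n = {x. \<forall>i\<ge>n. x i = 0}"

definition torus :: "nat \<Rightarrow> (nat \<Rightarrow> circle) monoid"
  where "torus n = \<lparr>carrier = vecs n, mult = (+), one = 0\<rparr>"

lemma comm_group_torus: "comm_group (torus n)"
proof (rule comm_groupI)
  fix x assume "x \<in> carrier (torus n)"
  then show "\<exists>y\<in>carrier (torus n). y \<otimes>\<^bsub>torus n\<^esub> x = \<one>\<^bsub>torus n\<^esub>"
    by (intro bexI[of _ "- x"]) (auto simp: torus_def vecs_def)
qed (auto simp: torus_def vecs_def algebra_simps)

definition torus_proj :: "(nat \<Rightarrow> real) \<Rightarrow> nat \<Rightarrow> circle"
  where "torus_proj x = (\<lambda>i. to_circle (x i))"

definition rscale :: "real \<Rightarrow> (nat \<Rightarrow> real) \<Rightarrow> nat \<Rightarrow> real"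
  where "rscale c x = (\<lambda>i. c * x i)"

global_interpretation rvec: vector_space rscale
  by standard (auto simp: rscale_def fun_eq_iff algebra_simps)

definition int_vecs :: "nat \<Rightarrow> (nat \<Rightarrow> real) set"
  where "int_vecs n = {x \<in> vecs n. \<forall>i. x i \<in> \<int>}"

definition subtori :: "nat \<Rightarrow> nat \<Rightarrow> (nat \<Rightarrow> circle) set set"
  where "subtori k n =
    {torus_proj ` W | W. rvec.dim W = k \<and> (\<exists>B \<subseteq> int_vecs n. W = rvec.span B)}"

text \<open>The dimension of a closed subgroup is that of its identity component.\<close>

definition closed_subgroups :: "nat \<Rightarrow> nat \<Rightarrow> (nat \<Rightarrow> circle) set set"
  where "closed_subgroups k n =
    {H. subgroup H (torus n) \<and> closed H \<and> connected_component_set H 0 \<in> subtori k n}"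

definition proper_in_torus :: "nat \<Rightarrow> (nat \<Rightarrow> circle) set \<Rightarrow> bool"
  where "proper_in_torus n X \<longleftrightarrow> \<not> X \<subseteq> (\<Union>i<n. {x. x i = 0})"

section \<open>Spectra\<close>

text \<open>Inserting \<open>0\<close> makes the maximum over no coordinates \<open>0\<close> and is harmless for \<open>n > 0\<close>,
  because \<open>circle_norm\<close> is nonnegative.\<close>

definition dist_half :: "nat \<Rightarrow> (nat \<Rightarrow> circle) set \<Rightarrow> real"
  where "dist_half n X =
    (INF x\<in>X. Max (insert 0 ((\<lambda>i. circle_norm (x i - to_circle (1/2))) ` {..<n})))"

definition proper_subtori :: "nat \<Rightarrow> nat \<Rightarrow> (nat \<Rightarrow> circle) set set"
  where "proper_subtori k n = {T \<in> subtori k n. proper_in_torus n T}"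

definition proper_subgroups :: "nat \<Rightarrow> nat \<Rightarrow> (nat \<Rightarrow> circle) set set"
  where "proper_subgroups k n = {H \<in> closed_subgroups k n. proper_in_torus n H}"

definition subtorus_spectrum :: "nat \<Rightarrow> nat \<Rightarrow> real set"
  where "subtorus_spectrum k n = dist_half n ` proper_subtori k n"

definition subgroup_spectrum :: "nat \<Rightarrow> nat \<Rightarrow> real set"
  where "subgroup_spectrum k n = dist_half n ` proper_subgroups k n"

lemma subgroup_spectrum_0_0: "subgroup_spectrum 0 0 = {0}"
proof -
  have carrier: "carrier (torus 0) = {0}" and one: "\<one>\<^bsub>torus 0\<^esub> = 0"
    by (auto simp: torus_def vecs_def fun_eq_iff)
  have triv: "H = {0}" if "subgroup H (torus 0)" for H
    using subgroup.subset[OF that] subgroup.one_closed[OF that] by (auto simp: carrier one)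
  have sub: "subgroup {0} (torus 0)"
    using group.triv_subgroup[OF comm_group.axioms(2)[OF comm_group_torus[of 0]]]
    by (simp add: one)
  have "{0} = torus_proj ` rvec.span {}"
    by (auto simp: torus_proj_def to_circle_0 fun_eq_iff)
  moreover have "rvec.dim (rvec.span {}) = 0"
    using rvec.dim_eq_card_independent[OF rvec.independent_empty] by (metis card.empty rvec.dim_span)
  ultimately have "{0} \<in> subtori 0 0" unfolding subtori_def by blast
  then have "{0} \<in> closed_subgroups 0 0"
    by (simp add: closed_subgroups_def sub connected_component_eq_self)
  then have "closed_subgroups 0 0 = {{0}}"
    using triv by (auto simp: closed_subgroups_def)
  then have "proper_subgroups 0 0 = {{0}}"
    by (auto simp: proper_subgroups_def proper_in_torus_def)
  then show ?thesis by (simp add: subgroup_spectrum_def dist_half_def)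
qed

text \<open>A multiset of reals with possibly infinite multiplicities is its multiplicity function.\<close>

definition ecard :: "'a set \<Rightarrow> enat"
  where "ecard A = (if finite A then enat (card A) else \<infinity>)"

definition subtorus_spectrum_mult :: "nat \<Rightarrow> nat \<Rightarrow> real \<Rightarrow> enat"
  where "subtorus_spectrum_mult k n d = ecard {T \<in> proper_subtori k n. dist_half n T = d}"

definition subgroup_spectrum_mult :: "nat \<Rightarrow> nat \<Rightarrow> real \<Rightarrow> enat"
  where "subgroup_spectrum_mult k n d = ecard {H \<in> proper_subgroups k n. dist_half n H = d}"

definition lower_acc_point :: "real set \<Rightarrow> real \<Rightarrow> bool"
  where "lower_acc_point S x \<longleftrightarrow> (\<forall>\<epsilon>>0. S \<inter> {x - \<epsilon><..<x} \<noteq> {})"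

definition acc_points :: "real set \<Rightarrow> real set"
  where "acc_points S = {x. x islimpt S}"

definition density_points :: "(real \<Rightarrow> enat) \<Rightarrow> real set"
  where "density_points M = acc_points {x. M x \<noteq> 0} \<union> {x. M x = \<infinity>}"

end

theory Submission
  imports Defs
begin

text \<open>
  Why the theorem holds. A closed subgroup \<open>H\<close> of the torus is determined by the lattice \<open>chars n H\<close> of
  integer vectors whose characters are trivial on it (\<open>closed_subgroup_duality\<close>). This follows from
  a uniform statement, \<open>uniform_density_torus\<close>: whether a subgroup comes within distance \<open>e\<close> of a
  point is controlled by its trivial characters of frequency at most \<open>R\<close>, with \<open>R\<close> depending only on
  \<open>n\<close> and \<open>e\<close>. The proof averages a nonnegative trigonometric kernel, concentrated near \<open>0\<close>, over
  the subgroup.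

  Accumulation. Given infinitely many subgroups of dimension \<open>k\<close>, let \<open>H\<close> be a minimal closed subgroup
  containing infinitely many of them. Each character nontrivial on \<open>H\<close> is nontrivial on all but
  finitely many of the subgroups contained in \<open>H\<close>, so by uniform density these become dense in \<open>H\<close>;
  and \<open>H\<close> has dimension greater than \<open>k\<close> (\<open>closed_subgroups_accumulate\<close>). Hence their values
  tend to \<open>D(H)\<close>, and they do so from above because the groups lie inside \<open>H\<close>. This excludes lower
  accumulation points and shows that density points are values of groups of larger dimension. If
  the given groups are subtori, so is \<open>H\<close>.

  Descent. The minimum defining \<open>D(H)\<close> is attained at a torsion point (\<open>rational_optimum\<close>): an
  additive map from the reals to themselves that fixes \<open>1\<close>, is close to the identity and takes rational
  values preserves the linear conditions defining \<open>H\<close>. Through a torsion point of a group of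
  dimension \<open>k + 1\<close> pass infinitely many of its subgroups of dimension \<open>k\<close>, all of the same value;
  for \<open>k \<ge> 1\<close> these can be taken to be subtori if the group is a subtorus. So values in
  dimension \<open>k + 1\<close> have infinite multiplicity in dimension \<open>k\<close>, which is the other half of the
  description of the density points, and the spectra decrease as the dimension grows.

  Change of ambient dimension. Multiplying a group by a circle raises both dimensions by one and
  keeps the value. Conversely, if \<open>H\<close> has positive dimension and \<open>n \<ge> 2\<close>, some optimal point of \<open>H\<close>
  has two coordinates at the maximal distance from \<open>1/2\<close> (\<open>optimum_two_tight\<close>). These coordinates are equal
  or opposite, which is a linear relation cutting the dimension by at most one and making one of
  the two coordinates redundant (\<open>subgroup_spectrum_drop_coordinate\<close>).

  Finally, a line with direction \<open>u\<close> in \<open>n - 1\<close> coordinates is approximated by lines with directions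
  \<open>(u, N)\<close>. If \<open>N\<close> is a multiple of a common denominator of all optimal times, the new coordinate
  vanishes at these times, which makes the approximation strict
  (\<open>subtorus_spectrum_subset_acc_points\<close>).
\<close>

section \<open>Coordinates on the torus\<close>

lemma infdist_Ints_le: "m \<in> \<int> \<Longrightarrow> infdist x \<int> \<le> \<bar>x - m\<bar>" for x :: real
  using infdist_le[of m \<int> x] by (simp add: dist_real_def)

lemma infdist_Ints_eq_abs:
  fixes x :: real
  assumes "\<bar>x\<bar> \<le> 1/2"
  shows "infdist x \<int> = \<bar>x\<bar>"
proof (rule antisym)
  show "infdist x \<int> \<le> \<bar>x\<bar>" using infdist_Ints_le[of 0 x] by simp
  have "\<bar>x\<bar> \<le> dist x a" if "a \<in> \<int>" for a
  proof (cases "a = 0")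
    case False
    with that have "1 \<le> \<bar>a\<bar>" using Ints_nonzero_abs_ge1 by blast
    with assms show ?thesis by (simp add: dist_real_def abs_if split: if_splits)
  qed (simp add: dist_real_def)
  moreover have ne: "(\<int> :: real set) \<noteq> {}" by auto
  ultimately show "\<bar>x\<bar> \<le> infdist x \<int>"
    unfolding infdist_notempty[OF ne] by (intro cINF_greatest ne) auto
qed

lemma infdist_Ints_diff: "m \<in> \<int> \<Longrightarrow> infdist (x - m) \<int> = infdist x \<int>" for x :: real
  using infdist_Ints_shift[of m "x - m"] infdist_Ints_shift[of "-m" x] by simp

lemma circle_norm_dist: "circle_norm c = dist c 0"
  by (simp add: dist_circle_def)

lemma circle_norm_nonneg [simp]: "0 \<le> circle_norm c"
  by (simp add: circle_norm_dist)

lemma circle_norm_0 [simp]: "circle_norm 0 = 0"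
  by (simp add: circle_norm_dist)

lemma circle_norm_minus_commute: "circle_norm (a - b) = circle_norm (b - a)"
  by (metis dist_circle_def dist_commute)

lemma circle_norm_uminus [simp]: "circle_norm (- a) = circle_norm a"
  using circle_norm_minus_commute[of 0 a] by simp

lemma circle_norm_triangle: "circle_norm (a + b) \<le> circle_norm a + circle_norm b"
proof -
  have "dist (a + b) 0 \<le> dist (a + b) b + dist b 0" by (rule dist_triangle)
  then show ?thesis by (simp add: dist_circle_def)
qed

lemma circle_norm_triangle_diff: "circle_norm (a - c) \<le> circle_norm (a - b) + circle_norm (b - c)"
  using circle_norm_triangle[of "a - b" "b - c"] by simp

lemma circle_norm_le_abs: "circle_norm (to_circle x) \<le> \<bar>x\<bar>"
  using infdist_Ints_le[of 0 x] by (simp add: circle_norm_to_circle)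

abbreviation half_gap :: "circle \<Rightarrow> real"
  where "half_gap c \<equiv> circle_norm (c - to_circle (1/2))"

lemma half_gap_frac:
  "half_gap (to_circle y) = \<bar>frac y - 1/2\<bar>"
proof -
  have "infdist (y - 1/2) \<int> = infdist (y - 1/2 - of_int \<lfloor>y\<rfloor>) \<int>"
    by (rule infdist_Ints_diff[symmetric]) simp
  also have "y - 1/2 - of_int \<lfloor>y\<rfloor> = frac y - 1/2" by (simp add: frac_def)
  also have "infdist (frac y - 1/2) \<int> = \<bar>frac y - 1/2\<bar>"
    using frac_ge_0[of y] frac_lt_1[of y] by (intro infdist_Ints_eq_abs) (auto simp: abs_if)
  finally show ?thesis by (simp add: to_circle_diff circle_norm_to_circle)
qed

lemma half_gap_le: "half_gap c \<le> 1/2"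
proof -
  obtain y where "c = to_circle y" by (rule to_circle_cases)
  then show ?thesis
    using frac_ge_0[of y] frac_lt_1[of y] by (simp only: half_gap_frac)
qed

lemma half_gap_eq_iff: "half_gap c = 1/2 \<longleftrightarrow> c = 0"
proof -
  obtain y where y: "c = to_circle y" by (rule to_circle_cases)
  have "\<bar>frac y - 1/2\<bar> = 1/2 \<longleftrightarrow> frac y = 0"
    using frac_ge_0[of y] frac_lt_1[of y] by linarith
  also have "\<dots> \<longleftrightarrow> to_circle y = 0"
    by (simp add: frac_eq_0_iff to_circle_0[symmetric] to_circle_eq_iff)
  finally show ?thesis by (simp only: y half_gap_frac)
qed

text \<open>Reflection at \<open>1/2\<close> is the only symmetry of the distance to \<open>1/2\<close>. This turns a tie between two
  coordinates of a point into a linear relation.\<close>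

lemma half_gap_tie:
  assumes "half_gap (to_circle a) = half_gap (to_circle b)"
  shows "a - b \<in> \<int> \<or> a + b \<in> \<int>"
proof -
  from assms have "\<bar>frac a - 1/2\<bar> = \<bar>frac b - 1/2\<bar>" by (simp only: half_gap_frac)
  then have "frac a = frac b \<or> frac a + frac b = 1" by (auto simp: abs_if split: if_splits)
  then show ?thesis
  proof
    assume "frac a = frac b"
    then have "a - b = of_int (\<lfloor>a\<rfloor> - \<lfloor>b\<rfloor>)" by (simp add: frac_def)
    then show ?thesis by (metis Ints_of_int)
  next
    assume "frac a + frac b = 1"
    then have "a + b = of_int (\<lfloor>a\<rfloor> + \<lfloor>b\<rfloor> + 1)" by (simp add: frac_def)
    then show ?thesis by (metis Ints_of_int)
  qed
qed

lemma half_gap_opposite: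
  "half_gap (- c) = half_gap c"
proof -
  have "- to_circle (1/2) = to_circle (1/2)"
    by (metis Ints_1 diff_0 diff_minus_eq_add field_sum_of_halves to_circle_0 to_circle_diff
        to_circle_eq_iff)
  then have "- c - to_circle (1/2) = - (c - to_circle (1/2))"
    by (metis diff_minus_eq_add minus_diff_eq add.commute uminus_add_conv_diff)
  then show ?thesis by (metis circle_norm_uminus)
qed

lemma to_circle_add: "to_circle x + to_circle y = to_circle (x + y)"
  by transfer simp

lemma to_circle_minus: "- to_circle x = to_circle (- x)"
  by transfer simp

lemma torus_proj_add: "torus_proj (x + y) = torus_proj x + torus_proj y"
  by (simp add: torus_proj_def fun_eq_iff to_circle_add)

lemma torus_proj_minus: "torus_proj (- x) = - torus_proj x"
  by (simp add: torus_proj_def fun_eq_iff to_circle_minus)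

lemma torus_proj_diff: "torus_proj (x - y) = torus_proj x - torus_proj y"
  by (simp add: torus_proj_def fun_eq_iff to_circle_diff)

lemma torus_proj_0 [simp]: "torus_proj 0 = 0"
  by (simp add: torus_proj_def fun_eq_iff to_circle_0)

lemma vecs_0 [simp]: "0 \<in> vecs n"
  by (simp add: vecs_def)

lemma vecs_add: "x \<in> vecs n \<Longrightarrow> y \<in> vecs n \<Longrightarrow> x + y \<in> vecs n" for x :: "nat \<Rightarrow> 'a::monoid_add"
  by (simp add: vecs_def)

lemma vecs_minus: "x \<in> vecs n \<Longrightarrow> - x \<in> vecs n" for x :: "nat \<Rightarrow> 'a::group_add"
  by (simp add: vecs_def)

lemma vecs_diff: "x \<in> vecs n \<Longrightarrow> y \<in> vecs n \<Longrightarrow> x - y \<in> vecs n" for x :: "nat \<Rightarrow> 'a::group_add"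
  by (simp add: vecs_def)

lemma vecs_rscale: "x \<in> vecs n \<Longrightarrow> rscale c x \<in> vecs n"
  by (simp add: vecs_def rscale_def)

lemma subspace_vecs: "rvec.subspace (vecs n)"
  by (simp add: rvec.subspace_def vecs_add vecs_rscale)

lemma int_vecs_add: "x \<in> int_vecs n \<Longrightarrow> y \<in> int_vecs n \<Longrightarrow> x + y \<in> int_vecs n"
  by (simp add: int_vecs_def vecs_add)

lemma int_vecs_diff: "x \<in> int_vecs n \<Longrightarrow> y \<in> int_vecs n \<Longrightarrow> x - y \<in> int_vecs n"
  by (simp add: int_vecs_def vecs_diff)

lemma int_vecs_rscale: "x \<in> int_vecs n \<Longrightarrow> c \<in> \<int> \<Longrightarrow> rscale c x \<in> int_vecs n"
  by (simp add: int_vecs_def vecs_rscale) (simp add: rscale_def)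

lemma int_vecs_subset_vecs: "int_vecs n \<subseteq> vecs n"
  by (auto simp: int_vecs_def)

lemma torus_proj_in_vecs: "x \<in> vecs n \<Longrightarrow> torus_proj x \<in> vecs n"
  by (simp add: vecs_def torus_proj_def to_circle_0)

lemma torus_proj_eq_iff:
  "x \<in> vecs n \<Longrightarrow> y \<in> vecs n \<Longrightarrow> torus_proj x = torus_proj y \<longleftrightarrow> x - y \<in> int_vecs n"
  by (simp add: torus_proj_def fun_eq_iff to_circle_eq_iff int_vecs_def vecs_diff)

lemma torus_proj_int_vecs: "z \<in> int_vecs n \<Longrightarrow> torus_proj z = 0"
  using torus_proj_eq_iff[of z n 0] by (simp add: int_vecs_def)

lemma torus_proj_cases:
  assumes "h \<in> vecs n"
  obtains x where "x \<in> vecs n" "h = torus_proj x" "\<And>i. 0 \<le> x i" "\<And>i. x i \<le> 1"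
proof -
  have "\<forall>i. \<exists>t. h i = to_circle t" by (meson to_circle_cases)
  then obtain y where y: "\<And>i. h i = to_circle (y i)" by metis
  define x where "x = (\<lambda>i. if i < n then frac (y i) else 0)"
  have "h i = to_circle (x i)" for i
  proof (cases "i < n")
    case True
    then show ?thesis by (simp add: y x_def to_circle_eq_iff frac_def)
  next
    case False
    then show ?thesis using assms by (simp add: x_def vecs_def to_circle_0)
  qed
  then show ?thesis
    using that[of x] frac_lt_1 less_imp_le
    by (force simp: x_def vecs_def torus_proj_def fun_eq_iff)
qed

lemma subgroup_torus_iff:
  "subgroup H (torus n) \<longleftrightarrow> H \<subseteq> vecs n \<and> 0 \<in> H \<and> (\<forall>x\<in>H. \<forall>y\<in>H. x + y \<in> H) \<and> (\<forall>x\<in>H. - x \<in> H)"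
proof -
  interpret comm_group "torus n" by (rule comm_group_torus)
  have inv: "inv\<^bsub>torus n\<^esub> x = - x" if "x \<in> vecs n" for x
    using that by (intro inv_equality) (auto simp: torus_def vecs_minus)
  show ?thesis
  proof
    assume H: "subgroup H (torus n)"
    then have "H \<subseteq> vecs n" using subgroup.subset by (fastforce simp: torus_def)
    moreover have "\<forall>x\<in>H. - x \<in> H"
      using subgroup.m_inv_closed[OF H] inv \<open>H \<subseteq> vecs n\<close> by (metis subsetD)
    ultimately show "H \<subseteq> vecs n \<and> 0 \<in> H \<and> (\<forall>x\<in>H. \<forall>y\<in>H. x + y \<in> H) \<and> (\<forall>x\<in>H. - x \<in> H)"
      using subgroup.one_closed[OF H] subgroup.m_closed[OF H] by (auto simp: torus_def)
  next
    assume H: "H \<subseteq> vecs n \<and> 0 \<in> H \<and> (\<forall>x\<in>H. \<forall>y\<in>H. x + y \<in> H) \<and> (\<forall>x\<in>H. - x \<in> H)"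
    have "inv\<^bsub>torus n\<^esub> x \<in> H" if "x \<in> H" for x using H that inv by auto
    then show "subgroup H (torus n)"
      using H by (intro subgroup.intro) (auto simp: torus_def)
  qed
qed

lemma isCont_to_circle: "isCont to_circle x"
  unfolding continuous_at_eps_delta
proof (intro allI impI)
  fix e :: real assume "e > 0"
  then show "\<exists>d>0. \<forall>x'. dist x' x < d \<longrightarrow> dist (to_circle x') (to_circle x) < e"
    using circle_norm_le_abs
    by (intro exI[of _ e]) (auto simp: dist_circle_def to_circle_diff dist_real_def intro: le_less_trans)
qed

lemma continuous_on_torus_proj [continuous_intros]: "continuous_on A torus_proj"
proof -
  have "continuous_on A (\<lambda>x. to_circle (x i))" for i
    by (rule continuous_on_compose2[of UNIV to_circle])
       (auto simp: continuous_on_eq_continuous_at isCont_to_circle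
             intro: continuous_on_product_then_coordinatewise[OF continuous_on_id])
  then show ?thesis
    unfolding torus_proj_def by (intro continuous_on_coordinatewise_then_product)
qed

lemma compact_box: "compact {x :: nat \<Rightarrow> real. \<forall>i. 0 \<le> x i \<and> x i \<le> (if i < n then 1 else 0)}"
proof -
  have "compactin (product_topology (\<lambda>i. euclidean) UNIV)
      (PiE UNIV (\<lambda>i :: nat. {0 :: real..if i < n then 1 else 0}))"
    unfolding compactin_PiE by (simp add: compactin_euclidean_iff)
  then have "compact (PiE UNIV (\<lambda>i :: nat. {0 :: real..if i < n then 1 else 0}))"
    by (simp add: euclidean_product_topology compactin_euclidean_iff)
  moreover have "PiE UNIV (\<lambda>i :: nat. {0 :: real..if i < n then 1 else 0}) =
      {x :: nat \<Rightarrow> real. \<forall>i. 0 \<le> x i \<and> x i \<le> (if i < n then 1 else 0)}"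
    unfolding PiE_UNIV_domain by (auto simp: Pi_def)
  ultimately show ?thesis by (rule back_subst)
qed

lemma continuous_on_coord: "continuous_on A (\<lambda>x :: nat \<Rightarrow> circle. x i)"
  by (rule continuous_on_product_then_coordinatewise[OF continuous_on_id])

lemma continuous_on_circle_norm_coord [continuous_intros]:
  "continuous_on A (\<lambda>x :: nat \<Rightarrow> circle. circle_norm (x i - c))"
  by (subst dist_circle_def[symmetric]) (intro continuous_on_dist continuous_on_coord continuous_on_const)

text \<open>On the torus these are the balls of the metric given by the maximum of the coordinate
  distances.\<close>

definition nbhd :: "nat \<Rightarrow> real \<Rightarrow> (nat \<Rightarrow> circle) \<Rightarrow> (nat \<Rightarrow> circle) set"
  where "nbhd n e h = {x. \<forall>i<n. circle_norm (x i - h i) < e}"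

lemma open_nbhd: "open (nbhd n e h)"
proof -
  have "nbhd n e h = (\<Inter>i<n. {x. circle_norm (x i - h i) < e})"
    by (auto simp: nbhd_def)
  moreover have "open {x :: nat \<Rightarrow> circle. circle_norm (x i - h i) < e}" for i
    by (intro open_Collect_less continuous_intros)
  ultimately show ?thesis by auto
qed

lemma nbhd_self: "e > 0 \<Longrightarrow> h \<in> nbhd n e h"
  by (simp add: nbhd_def)

lemma nbhd_shift: "x \<in> nbhd n e h \<longleftrightarrow> x - h \<in> nbhd n e 0"
  by (simp add: nbhd_def)

lemma nbhd_0_lift:
  assumes "x \<in> vecs n" "x \<in> nbhd n e 0"
  obtains y where "y \<in> vecs n" "torus_proj y = x" "\<And>i. i < n \<Longrightarrow> \<bar>y i\<bar> < e"
proof -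
  have "\<exists>y. to_circle y = x i \<and> (if i < n then \<bar>y\<bar> < e else y = 0)" for i
  proof (cases "i < n")
    case True
    obtain t where t: "x i = to_circle t" by (rule to_circle_cases)
    have "infdist t \<int> < e"
      using assms(2) True by (auto simp: nbhd_def t circle_norm_to_circle[symmetric])
    then obtain m where m: "m \<in> \<int>" "\<bar>t - m\<bar> < e" by (rule circle_norm_less)
    then have "to_circle (t - m) = x i" by (simp add: t to_circle_eq_iff)
    with m True show ?thesis by auto
  next
    case False
    then show ?thesis using assms(1) by (auto simp: vecs_def to_circle_0)
  qed
  then obtain y where y: "\<And>i. to_circle (y i) = x i \<and> (if i < n then \<bar>y i\<bar> < e else y i = 0)"
    by metis
  have "y i = 0" if "n \<le> i" for i using y[of i] that by simp
  moreover have "\<bar>y i\<bar> < e" if "i < n" for i using y[of i] that by simp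
  ultimately show ?thesis
    using that[of y] y by (simp add: vecs_def torus_proj_def fun_eq_iff)
qed

lemma nbhd_proj: "(\<And>i. i < n \<Longrightarrow> \<bar>x i - y i\<bar> < e) \<Longrightarrow> torus_proj x \<in> nbhd n e (torus_proj y)"
  by (auto simp: nbhd_def torus_proj_def to_circle_diff intro: le_less_trans[OF circle_norm_le_abs])

section \<open>The distance to the centre of the torus\<close>

definition center_dist :: "nat \<Rightarrow> (nat \<Rightarrow> circle) \<Rightarrow> real"
  where "center_dist n x = Max (insert 0 ((\<lambda>i. half_gap (x i)) ` {..<n}))"

lemma dist_half_eq: "dist_half n X = (INF x\<in>X. center_dist n x)"
  by (simp add: dist_half_def center_dist_def)

lemma center_dist_le_iff:
  "center_dist n x \<le> c \<longleftrightarrow> 0 \<le> c \<and> (\<forall>i<n. half_gap (x i) \<le> c)"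
  unfolding center_dist_def by (subst Max_le_iff) auto

lemma center_dist_less_iff:
  "center_dist n x < c \<longleftrightarrow> 0 < c \<and> (\<forall>i<n. half_gap (x i) < c)"
  unfolding center_dist_def by (subst Max_less_iff) auto

lemma center_dist_nonneg [simp]: "0 \<le> center_dist n x"
  using center_dist_le_iff[of n x "center_dist n x"] by simp

lemma center_dist_coord: "i < n \<Longrightarrow> half_gap (x i) \<le> center_dist n x"
  using center_dist_le_iff[of n x "center_dist n x"] by simp

lemma center_dist_attained:
  assumes "n > 0"
  obtains i where "i < n" "half_gap (x i) = center_dist n x"
proof -
  have "center_dist n x \<in> insert 0 ((\<lambda>i. half_gap (x i)) ` {..<n})"
    unfolding center_dist_def by (rule Max_in) auto
  then show ?thesis
  proof
    assume "center_dist n x = 0"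
    then show ?thesis using center_dist_coord[OF assms, of x] that[OF assms] by (simp add: antisym)
  qed (use that in auto)
qed

lemma center_dist_cong: "(\<And>i. i < n \<Longrightarrow> x i = y i) \<Longrightarrow> center_dist n x = center_dist n y"
  unfolding center_dist_def by (metis (mono_tags, lifting) image_cong lessThan_iff)

lemma center_dist_Suc:
  "center_dist (Suc n) x = max (center_dist n x) (half_gap (x n))"
proof -
  have "insert 0 ((\<lambda>i. half_gap (x i)) ` {..<Suc n}) =
      insert (half_gap (x n))
        (insert 0 ((\<lambda>i. half_gap (x i)) ` {..<n}))"
    by (auto simp: lessThan_Suc)
  then show ?thesis
    unfolding center_dist_def by (simp only:) (subst Max_insert, auto simp: max.commute)
qed

lemma continuous_on_center_dist [continuous_intros]: "continuous_on A (center_dist n)"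
proof (induction n)
  case 0
  have "center_dist 0 = (\<lambda>x. 0)" by (simp add: center_dist_def fun_eq_iff)
  then show ?case by simp
next
  case (Suc n)
  have "center_dist (Suc n) = (\<lambda>x. max (center_dist n x) (half_gap (x n)))"
    by (simp add: fun_eq_iff center_dist_Suc)
  then show ?case using Suc by (simp only:) (intro continuous_intros)
qed

lemma center_dist_nbhd:
  assumes "h \<in> nbhd n e x" "e > 0"
  shows "center_dist n h \<le> center_dist n x + e"
proof -
  have "half_gap (h i) \<le> center_dist n x + e" if "i < n" for i
    using circle_norm_triangle_diff[of "h i" "to_circle (1/2)" "x i"]
      center_dist_coord[OF that, of x] assms that by (force simp: nbhd_def)
  then show ?thesis using assms by (simp add: center_dist_le_iff add_nonneg_nonneg)
qed

lemma dist_half_le: "x \<in> X \<Longrightarrow> dist_half n X \<le> center_dist n x"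
  unfolding dist_half_eq by (rule cINF_lower[OF bdd_belowI[of _ 0]]) auto

lemma dist_half_greatest: "X \<noteq> {} \<Longrightarrow> (\<And>x. x \<in> X \<Longrightarrow> c \<le> center_dist n x) \<Longrightarrow> c \<le> dist_half n X"
  unfolding dist_half_eq by (rule cINF_greatest) auto

lemma dist_half_nonneg: "X \<noteq> {} \<Longrightarrow> 0 \<le> dist_half n X"
  by (rule dist_half_greatest) auto

lemma dist_half_antimono: "X \<noteq> {} \<Longrightarrow> X \<subseteq> Y \<Longrightarrow> dist_half n Y \<le> dist_half n X"
  by (rule dist_half_greatest) (auto intro: dist_half_le)

lemma dist_half_attained:
  assumes "compact H" "H \<noteq> {}"
  obtains x where "x \<in> H" "center_dist n x = dist_half n H"
proof -
  obtain x where "x \<in> H" "\<forall>y\<in>H. center_dist n x \<le> center_dist n y"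
    using continuous_attains_inf[OF assms continuous_on_center_dist] by blast
  then show ?thesis
    using that[of x] dist_half_le[of x H n] dist_half_greatest[OF assms(2), of "center_dist n x" n]
    by (meson antisym)
qed

lemma proper_iff_dist_half:
  assumes "compact H" "H \<noteq> {}"
  shows "proper_in_torus n H \<longleftrightarrow> dist_half n H < 1/2"
proof
  assume "proper_in_torus n H"
  then obtain x where x: "x \<in> H" "\<And>i. i < n \<Longrightarrow> x i \<noteq> 0"
    by (auto simp: proper_in_torus_def)
  have "half_gap (x i) < 1/2" if "i < n" for i
    using half_gap_le[of "x i"] half_gap_eq_iff[of "x i"] x(2)[OF that]
    by linarith
  then have "center_dist n x < 1/2" unfolding center_dist_less_iff by simp
  then show "dist_half n H < 1/2" using dist_half_le[OF x(1), of n] by simp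
next
  assume *: "dist_half n H < 1/2"
  obtain x where x: "x \<in> H" "center_dist n x = dist_half n H"
    using dist_half_attained[OF assms] .
  have "x i \<noteq> 0" if "i < n" for i
    using * x that center_dist_less_iff[of n x "1/2"] half_gap_eq_iff[of "x i"] by auto
  with x(1) show "proper_in_torus n H" unfolding proper_in_torus_def by blast
qed

section \<open>Averaging characters over a group\<close>

definition dot :: "nat \<Rightarrow> (nat \<Rightarrow> real) \<Rightarrow> (nat \<Rightarrow> real) \<Rightarrow> real"
  where "dot n m x = (\<Sum>i<n. m i * x i)"

lemma dot_add_right: "dot n m (x + y) = dot n m x + dot n m y"
  by (simp add: dot_def distrib_left sum.distrib)

lemma dot_diff_right: "dot n m (x - y) = dot n m x - dot n m y"
  by (simp add: dot_def right_diff_distrib sum_subtractf)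

lemma dot_minus_right: "dot n m (- x) = - dot n m x"
  by (simp add: dot_def sum_negf)

lemma dot_rscale_right: "dot n m (rscale c x) = c * dot n m x"
  by (simp add: dot_def rscale_def sum_distrib_left mult_ac)

lemma dot_0_right [simp]: "dot n m 0 = 0"
  by (simp add: dot_def)

lemma dot_commute: "dot n m x = dot n x m"
  by (simp add: dot_def mult.commute)

lemma dot_int: "m \<in> int_vecs n \<Longrightarrow> z \<in> int_vecs n \<Longrightarrow> dot n m z \<in> \<int>"
  by (auto simp: dot_def int_vecs_def intro!: Ints_sum)

lemma cesaro_mean_power:
  fixes z :: complex
  assumes "norm z = 1"
  shows "(\<lambda>A. (\<Sum>a<Suc A. z ^ a) / of_nat (Suc A)) \<longlonglongrightarrow> (if z = 1 then 1 else 0)"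
proof (cases "z = 1")
  case True
  have *: "(\<Sum>a<Suc A. z ^ a) / of_nat (Suc A) = 1" for A
    unfolding True by (simp only: power_one sum_constant card_lessThan mult_1_right) (simp del: of_nat_Suc)
  show ?thesis unfolding if_P[OF True] * by (rule tendsto_const)
next
  case False
  have "norm ((\<Sum>a<Suc A. z ^ a) / of_nat (Suc A)) \<le> 2 / norm (z - 1) / real (Suc A)" for A
  proof -
    have "(\<Sum>a<Suc A. z ^ a) = (z ^ Suc A - 1) / (z - 1)"
      using False by (rule geometric_sum)
    moreover have "norm (z ^ Suc A - 1) \<le> 2"
      using norm_triangle_ineq4[of "z ^ Suc A" 1] assms by (simp add: norm_power norm_mult)
    ultimately show ?thesis
      by (simp only: norm_divide norm_of_nat) (intro divide_right_mono, auto)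
  qed
  moreover have "(\<lambda>A. 2 / norm (z - 1) / real (Suc A)) \<longlonglongrightarrow> 0"
    using tendsto_mult[OF tendsto_const[of "2 / norm (z - 1)"] LIMSEQ_inverse_real_of_nat]
    by (simp add: divide_inverse)
  ultimately show ?thesis
    unfolding if_not_P[OF False] by (rule Lim_null_comparison[OF always_eventually[OF allI]])
qed

text \<open>The sum on the left is the mean of the trigonometric polynomial over the group. Cesaro means
  along an element on which some character is nontrivial remove that character and keep the bound;
  after finitely many steps only the characters trivial on the group are left.\<close>

lemma mean_le_of_bounded:
  fixes c :: "'i \<Rightarrow> complex" and \<psi> :: "'i \<Rightarrow> 'g :: monoid_add \<Rightarrow> complex"
  assumes "finite I" and "G \<noteq> {}"
    and add: "\<And>g h. g \<in> G \<Longrightarrow> h \<in> G \<Longrightarrow> g + h \<in> G"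
    and hom: "\<And>j g h. \<psi> j (g + h) = \<psi> j g * \<psi> j h"
    and unit: "\<And>j g. norm (\<psi> j g) = 1"
    and bound: "\<And>g. g \<in> G \<Longrightarrow> Re (\<Sum>j\<in>I. c j * \<psi> j g) \<le> b"
  shows "Re (\<Sum>j\<in>{j\<in>I. \<forall>g\<in>G. \<psi> j g = 1}. c j) \<le> b"
  using \<open>finite I\<close> bound
proof (induction I rule: finite_psubset_induct)
  case (psubset I)
  show ?case
  proof (cases "\<forall>j\<in>I. \<forall>g\<in>G. \<psi> j g = 1")
    case True
    obtain g where "g \<in> G" using \<open>G \<noteq> {}\<close> by blast
    have "{j\<in>I. \<forall>g\<in>G. \<psi> j g = 1} = I" using True by blast
    moreover have "(\<Sum>j\<in>I. c j * \<psi> j g) = (\<Sum>j\<in>I. c j)"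
      using True \<open>g \<in> G\<close> by (intro sum.cong) auto
    ultimately show ?thesis using psubset.prems[OF \<open>g \<in> G\<close>] by simp
  next
    case False
    then obtain j0 g0 where j0: "j0 \<in> I" "g0 \<in> G" "\<psi> j0 g0 \<noteq> 1" by blast
    define J where "J = {j\<in>I. \<psi> j g0 = 1}"
    have "J \<subset> I" using j0 by (auto simp: J_def)
    have iter: "((\<lambda>h. h + g0) ^^ a) g \<in> G" "\<psi> j (((\<lambda>h. h + g0) ^^ a) g) = \<psi> j g * \<psi> j g0 ^ a"
      if "g \<in> G" for a g j
      by (induction a) (use that j0 add in \<open>auto simp: hom mult_ac\<close>)
    have "Re (\<Sum>j\<in>J. c j * \<psi> j g) \<le> b" if g: "g \<in> G" for g
    proof -
      define F where "F A = (\<Sum>j\<in>I. c j * \<psi> j g * ((\<Sum>a<Suc A. \<psi> j g0 ^ a) / of_nat (Suc A)))" for A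
      have "F \<longlonglongrightarrow> (\<Sum>j\<in>I. c j * \<psi> j g * (if \<psi> j g0 = 1 then 1 else 0))"
        unfolding F_def by (intro tendsto_sum tendsto_mult tendsto_const cesaro_mean_power unit)
      also have "(\<Sum>j\<in>I. c j * \<psi> j g * (if \<psi> j g0 = 1 then 1 else 0)) = (\<Sum>j\<in>J. c j * \<psi> j g)"
        using psubset.hyps by (simp add: J_def sum.inter_filter if_distrib cong: if_cong)
      finally have lim: "(\<lambda>A. Re (F A)) \<longlonglongrightarrow> Re (\<Sum>j\<in>J. c j * \<psi> j g)"
        by (rule tendsto_Re)
      have "Re (F A) \<le> b" for A
      proof -
        have "F A = (\<Sum>j\<in>I. \<Sum>a<Suc A. c j * \<psi> j g * \<psi> j g0 ^ a) / of_nat (Suc A)"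
          unfolding F_def sum_divide_distrib
          by (intro sum.cong refl)
             (simp only: sum_distrib_left sum_divide_distrib times_divide_eq_right)
        also have "(\<Sum>j\<in>I. \<Sum>a<Suc A. c j * \<psi> j g * \<psi> j g0 ^ a) =
            (\<Sum>a<Suc A. \<Sum>j\<in>I. c j * \<psi> j (((\<lambda>h. h + g0) ^^ a) g))"
          by (subst sum.swap) (simp only: iter[OF g] mult.assoc)
        finally have "Re (F A) = (\<Sum>a<Suc A. Re (\<Sum>j\<in>I. c j * \<psi> j (((\<lambda>h. h + g0) ^^ a) g))) / real (Suc A)"
          by (metis Re_divide_of_nat Re_sum)
        also have "\<dots> \<le> (\<Sum>a<Suc A. b) / real (Suc A)"
          by (intro divide_right_mono sum_mono psubset.prems iter g) simp
        also have "\<dots> = b" by (simp del: of_nat_Suc)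
        finally show ?thesis .
      qed
      then show ?thesis using lim by (meson LIMSEQ_le_const2)
    qed
    then have "Re (\<Sum>j\<in>{j\<in>J. \<forall>g\<in>G. \<psi> j g = 1}. c j) \<le> b"
      by (rule psubset.IH[OF \<open>J \<subset> I\<close>])
    moreover have "{j\<in>J. \<forall>g\<in>G. \<psi> j g = 1} = {j\<in>I. \<forall>g\<in>G. \<psi> j g = 1}"
      using j0 by (auto simp: J_def)
    ultimately show ?thesis by simp
  qed
qed

lemma cos_power_expansion:
  "complex_of_real (cos (pi * y) ^ (2 * M)) =
    (\<Sum>j\<le>2 * M. of_real (real ((2 * M) choose j) / 4 ^ M) * cis (2 * pi * ((real j - real M) * y)))"
proof -
  have "complex_of_real (2 * cos (pi * y)) = cis (pi * y) + cis (- (pi * y))"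
    by (simp add: complex_eq_iff)
  then have "complex_of_real ((2 * cos (pi * y)) ^ (2 * M)) = (cis (pi * y) + cis (- (pi * y))) ^ (2 * M)"
    by (simp only: of_real_power)
  also have "\<dots> = (\<Sum>j\<le>2 * M. of_nat ((2 * M) choose j) * cis (pi * y) ^ j * cis (- (pi * y)) ^ (2 * M - j))"
    by (rule binomial_ring)
  also have "\<dots> = (\<Sum>j\<le>2 * M. of_nat ((2 * M) choose j) * cis (2 * pi * ((real j - real M) * y)))"
  proof (rule sum.cong)
    fix j assume "j \<in> {..2 * M}"
    then have "real j * (pi * y) + real (2 * M - j) * (- (pi * y)) = 2 * pi * ((real j - real M) * y)"
      by (simp add: of_nat_diff algebra_simps)
    then have "cis (pi * y) ^ j * cis (- (pi * y)) ^ (2 * M - j) = cis (2 * pi * ((real j - real M) * y))"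
      by (simp only: Complex.DeMoivre cis_mult)
    then show "of_nat ((2 * M) choose j) * cis (pi * y) ^ j * cis (- (pi * y)) ^ (2 * M - j) =
        of_nat ((2 * M) choose j) * cis (2 * pi * ((real j - real M) * y))" by (simp add: mult.assoc)
  qed simp
  finally have *: "complex_of_real ((2 * cos (pi * y)) ^ (2 * M)) =
    (\<Sum>j\<le>2 * M. of_nat ((2 * M) choose j) * cis (2 * pi * ((real j - real M) * y)))" .
  have "cos (pi * y) ^ (2 * M) = (2 * cos (pi * y)) ^ (2 * M) / 4 ^ M"
    by (simp add: power_mult_distrib power_mult)
  then have "complex_of_real (cos (pi * y) ^ (2 * M)) = complex_of_real ((2 * cos (pi * y)) ^ (2 * M)) / 4 ^ M"
    by (metis of_real_divide of_real_numeral of_real_power)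
  then show ?thesis unfolding * by (simp add: sum_divide_distrib)
qed

lemma cis_2pi_Ints: "cis (2 * pi * t) = 1 \<longleftrightarrow> t \<in> \<int>"
proof
  assume "cis (2 * pi * t) = 1"
  then have "cos (2 * pi * t) = 1" by (simp add: complex_eq_iff)
  then obtain k :: int where "2 * pi * t = of_int k * 2 * pi" unfolding cos_one_2pi_int by blast
  then have "t = of_int k" by simp
  then show "t \<in> \<int>" by simp
next
  assume "t \<in> \<int>" then show "cis (2 * pi * t) = 1" by (rule cis_multiple_2pi)
qed

lemma abs_cos_pi_le:
  assumes "e \<le> infdist t \<int>" "0 \<le> e"
  shows "\<bar>cos (pi * t)\<bar> \<le> cos (pi * e)"
proof -
  define r where "r = t - of_int (round t)"
  have r: "\<bar>r\<bar> \<le> 1/2" using of_int_round_abs_le[of t] by (simp add: r_def abs_minus_commute)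
  have "e \<le> \<bar>r\<bar>" using assms infdist_Ints_le[of "of_int (round t)" t] by (simp add: r_def)
  have s: "sin (of_int (round t) * pi) = 0" by (simp add: sin_times_pi_eq_0)
  then have c: "\<bar>cos (of_int (round t) * pi)\<bar> = 1"
    using sin_cos_squared_add[of "of_int (round t) * pi"] by (auto simp: power2_eq_1_iff)
  have "cos (pi * t) = cos (pi * r + of_int (round t) * pi)"
    by (simp add: r_def algebra_simps)
  also have "\<bar>\<dots>\<bar> = \<bar>cos (pi * r)\<bar>"
    by (simp only: cos_add s) (simp add: abs_mult c)
  also have "cos (pi * r) = cos (pi * \<bar>r\<bar>)" by (simp add: abs_if)
  also have "\<bar>cos (pi * \<bar>r\<bar>)\<bar> = cos (pi * \<bar>r\<bar>)"
    using r by (intro abs_of_nonneg cos_ge_zero) (auto intro: mult_left_mono order_trans[of _ 0])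
  also have "\<dots> \<le> cos (pi * e)"
    using r \<open>e \<le> \<bar>r\<bar>\<close> assms(2) by (intro cos_monotone_0_pi_le) (auto intro: mult_left_mono)
  finally show ?thesis .
qed

text \<open>The kernel \<open>\<Prod>i<n. cos (\<pi> y\<^sub>i) ^ (2 * M)\<close> has nonnegative Fourier coefficients, a constant
  coefficient of only polynomial decay in \<open>M\<close>, and is exponentially small away from the lattice.
  Hence its mean over a group cannot be small on a translate of the group by a point which all
  trivial characters of bounded frequency annihilate. The bound on the frequencies depends only on
  \<open>n\<close> and the precision.\<close>

lemma uniform_density:
  fixes e :: real
  assumes "e > 0"
  shows "\<exists>R::nat. \<forall>G x. G \<noteq> {} \<longrightarrow> (\<forall>g\<in>G. \<forall>h\<in>G. g + h \<in> G) \<longrightarrow>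
    (\<forall>m\<in>int_vecs n. (\<forall>i. \<bar>m i\<bar> \<le> R) \<longrightarrow> (\<forall>g\<in>G. dot n m g \<in> \<int>) \<longrightarrow> dot n m x \<in> \<int>) \<longrightarrow>
    (\<exists>g\<in>G. \<forall>i<n. infdist (g i - x i) \<int> < e)"
proof -
  \<comment> \<open>On distances from the integers, which are at most \<open>1/2\<close>, the function \<open>cos (pi * t)\<close> decreases.\<close>
  define e' where "e' = min e (1/2)"
  define q where "q = cos (pi * e') ^ 2"
  have e': "0 < e'" "e' \<le> 1/2" "e' \<le> e" using assms by (auto simp: e'_def)
  have "0 \<le> cos (pi * e')" using e' by (intro cos_ge_zero) (auto intro: order_trans[of _ 0])
  moreover have "cos (pi * e') < cos 0" using e' by (intro cos_monotone_0_pi) auto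
  ultimately have q: "0 \<le> q" "q < 1" by (auto simp: q_def power_less_one_iff abs_square_less_1)
  have "(\<lambda>M. real M ^ n * q ^ M) \<longlonglongrightarrow> 0"
  proof (cases "n = 0")
    case True
    then show ?thesis using q by (simp add: LIMSEQ_power_zero)
  next
    case False
    then have "0 < n" by simp
    define r where "r = root n q"
    have r: "r ^ n = q" "0 \<le> r" using q \<open>0 < n\<close> by (simp_all add: r_def)
    have "r < 1" using q \<open>0 < n\<close> by (simp add: r_def)
    then have "(\<lambda>M. (real M * r ^ M) ^ n) \<longlonglongrightarrow> 0 ^ n"
      using r by (intro tendsto_power powser_times_n_limit_0) auto
    moreover have "(real M * r ^ M) ^ n = real M ^ n * q ^ M" for M
      by (simp add: power_mult_distrib r(1)[symmetric] power_mult[symmetric] mult.commute)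
    ultimately show ?thesis using \<open>0 < n\<close> by (simp add: zero_power)
  qed
  then have "\<forall>\<^sub>F M in sequentially. real M ^ n * q ^ M < (1/2) ^ n"
    by (rule order_tendstoD) simp
  then have "\<forall>\<^sub>F M in sequentially. real M ^ n * q ^ M < (1/2) ^ n \<and> M > 0"
    using eventually_gt_at_top by (rule eventually_conj)
  then obtain M where M: "real M ^ n * q ^ M < (1/2) ^ n" "M > 0"
    by (metis (mono_tags, lifting) eventually_sequentially order_refl)
  have "q ^ M < (1 / (2 * real M)) ^ n"
    using M by (simp add: power_divide power_mult_distrib field_simps)
  \<comment> \<open>The frequency \<open>\<mu> J\<close> and the coefficient \<open>a J\<close> of the \<open>J\<close>-th term of the expanded kernel.\<close>
  define P where "P = PiE {..<n} (\<lambda>_. {..2 * M})"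
  define \<mu> where "\<mu> = (\<lambda>(J :: nat \<Rightarrow> nat) i. if i < n then real (J i) - real M else 0)"
  define a where "a = (\<lambda>J. \<Prod>i<n. real ((2 * M) choose (J i)) / 4 ^ M)"
  have "finite P" by (simp add: P_def finite_PiE)
  have a_nonneg: "0 \<le> a J" for J by (auto simp: a_def intro: prod_nonneg)
  have expand: "complex_of_real (\<Prod>i<n. cos (pi * y i) ^ (2 * M)) =
      (\<Sum>J\<in>P. of_real (a J) * cis (2 * pi * dot n (\<mu> J) y))" for y
  proof -
    have cis_sum: "(\<Prod>i<n'. cis (f i)) = cis (\<Sum>i<n'. f i)" for f :: "nat \<Rightarrow> real" and n' :: nat
      by (induction n') (simp_all add: cis_mult)
    have "complex_of_real (\<Prod>i<n. cos (pi * y i) ^ (2 * M)) =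
        (\<Prod>i<n. \<Sum>j\<le>2 * M. of_real (real ((2 * M) choose j) / 4 ^ M) *
          cis (2 * pi * ((real j - real M) * y i)))"
      by (simp only: of_real_prod cos_power_expansion)
    also have "\<dots> = (\<Sum>J\<in>P. \<Prod>i<n. of_real (real ((2 * M) choose (J i)) / 4 ^ M) *
          cis (2 * pi * ((real (J i) - real M) * y i)))"
      unfolding P_def by (rule prod_sum_PiE) auto
    also have "\<dots> = (\<Sum>J\<in>P. of_real (a J) * cis (2 * pi * dot n (\<mu> J) y))"
      by (intro sum.cong refl)
         (simp only: prod.distrib cis_sum a_def of_real_prod,
          simp add: dot_def \<mu>_def sum_distrib_left)
    finally show ?thesis .
  qed
  have \<mu>: "\<mu> J \<in> int_vecs n" "\<bar>\<mu> J i\<bar> \<le> real M" if "J \<in> P" for J i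
  proof -
    show "\<mu> J \<in> int_vecs n" by (auto simp: \<mu>_def int_vecs_def vecs_def)
    show "\<bar>\<mu> J i\<bar> \<le> real M" using that by (force simp: \<mu>_def P_def PiE_def Pi_def)
  qed
  \<comment> \<open>The index of the constant term.\<close>
  define J0 where "J0 = (\<lambda>i\<in>{..<n}. M)"
  have J0: "J0 \<in> P" "dot n (\<mu> J0) y = 0" for y
    by (auto simp: J0_def P_def dot_def \<mu>_def)
  have "q ^ M < a J0"
  proof -
    have "1 / (2 * real M) \<le> real ((2 * M) choose M) / 4 ^ M"
      using central_binomial_lower_bound[OF M(2)] M(2) by (simp add: field_simps)
    then have "(1 / (2 * real M)) ^ n \<le> (real ((2 * M) choose M) / 4 ^ M) ^ n"
      by (intro power_mono) auto
    also have "\<dots> = a J0" by (simp add: a_def J0_def)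
    finally show ?thesis using \<open>q ^ M < _\<close> by simp
  qed
  have "\<exists>g\<in>G. \<forall>i<n. infdist (g i - x i) \<int> < e"
    if G: "G \<noteq> {}" "\<forall>g\<in>G. \<forall>h\<in>G. g + h \<in> G"
      and x: "\<forall>m\<in>int_vecs n. (\<forall>i. \<bar>m i\<bar> \<le> real M) \<longrightarrow> (\<forall>g\<in>G. dot n m g \<in> \<int>) \<longrightarrow> dot n m x \<in> \<int>"
    for G x
  proof (rule ccontr)
    assume contra: "\<not> (\<exists>g\<in>G. \<forall>i<n. infdist (g i - x i) \<int> < e)"
    define \<psi> where "\<psi> = (\<lambda>J g. cis (2 * pi * dot n (\<mu> J) g))"
    define c where "c = (\<lambda>J. of_real (a J) * cis (- (2 * pi * dot n (\<mu> J) x)))"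
    have "Re (\<Sum>J\<in>P. c J * \<psi> J g) \<le> q ^ M" if "g \<in> G" for g
    proof -
      have "(\<Sum>J\<in>P. c J * \<psi> J g) = (\<Sum>J\<in>P. of_real (a J) * cis (2 * pi * dot n (\<mu> J) (g - x)))"
        by (intro sum.cong refl)
           (simp add: c_def \<psi>_def mult.assoc cis_mult dot_diff_right algebra_simps)
      also have "\<dots> = complex_of_real (\<Prod>i<n. cos (pi * (g - x) i) ^ (2 * M))"
        by (rule expand[symmetric])
      finally have "Re (\<Sum>J\<in>P. c J * \<psi> J g) = (\<Prod>i<n. cos (pi * (g - x) i) ^ (2 * M))"
        by (simp only: Re_complex_of_real)
      also have "\<dots> \<le> q ^ M"
      proof -
        obtain i where i: "i < n" "e \<le> infdist (g i - x i) \<int>"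
          using contra \<open>g \<in> G\<close> by (meson linorder_not_le)
        have "(cos (pi * (g i - x i)))\<^sup>2 \<le> q"
          unfolding q_def using abs_cos_pi_le[of e' "g i - x i"] i e'
          by (intro power2_le_iff_abs_le[THEN iffD2]) auto
        then have "cos (pi * (g i - x i)) ^ (2 * M) \<le> q ^ M"
          unfolding power_mult by (intro power_mono) auto
        moreover have "(\<Prod>k\<in>{..<n} - {i}. cos (pi * (g - x) k) ^ (2 * M)) \<le> 1"
          by (intro prod_le_1) (auto simp: power_mult intro!: power_le_one abs_square_le_1[THEN iffD2])
        moreover have "(\<Prod>k<n. cos (pi * (g - x) k) ^ (2 * M)) =
            cos (pi * (g i - x i)) ^ (2 * M) * (\<Prod>k\<in>{..<n} - {i}. cos (pi * (g - x) k) ^ (2 * M))"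
          using i(1) by (subst prod.remove[of _ i]) auto
        ultimately show ?thesis
          using mult_mono[of "cos (pi * (g i - x i)) ^ (2 * M)" "q ^ M"
            "\<Prod>k\<in>{..<n} - {i}. cos (pi * (g - x) k) ^ (2 * M)" 1]
          by (simp add: prod_nonneg q(1))
      qed
      finally show ?thesis .
    qed
    then have le: "Re (\<Sum>J\<in>{J\<in>P. \<forall>g\<in>G. \<psi> J g = 1}. c J) \<le> q ^ M"
      using G by (intro mean_le_of_bounded[OF \<open>finite P\<close>])
        (auto simp: \<psi>_def dot_add_right distrib_left cis_mult)
    have "c J = of_real (a J)" if "J \<in> P" "\<forall>g\<in>G. \<psi> J g = 1" for J
    proof -
      have "dot n (\<mu> J) x \<in> \<int>"
        using x \<mu>[OF that(1)] that(2) by (simp add: \<psi>_def cis_2pi_Ints)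
      then have "cis (2 * pi * (- dot n (\<mu> J) x)) = 1" by (simp only: cis_2pi_Ints Ints_minus)
      then show ?thesis by (simp add: c_def)
    qed
    then have "(\<Sum>J\<in>{J\<in>P. \<forall>g\<in>G. \<psi> J g = 1}. c J) = of_real (\<Sum>J\<in>{J\<in>P. \<forall>g\<in>G. \<psi> J g = 1}. a J)"
      by simp
    moreover have "a J0 \<le> (\<Sum>J\<in>{J\<in>P. \<forall>g\<in>G. \<psi> J g = 1}. a J)"
      using J0 \<open>finite P\<close> a_nonneg by (intro member_le_sum) (auto simp: \<psi>_def)
    ultimately show False using le \<open>q ^ M < a J0\<close> by simp
  qed
  then show ?thesis by blast
qed

section \<open>The reals as a rational vector space\<close>

definition qscale :: "rat \<Rightarrow> real \<Rightarrow> real"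
  where "qscale q x = of_rat q * x"

interpretation qvec: vector_space qscale
  by standard (simp_all add: qscale_def algebra_simps of_rat_add of_rat_mult)

text \<open>Coordinates with respect to a rational basis of the reals that contains \<open>1\<close>, restricted to the
  finitely many basis elements that occur in \<open>S\<close>.\<close>

lemma rational_coordinates:
  fixes S :: "real set"
  assumes "finite S"
  shows "\<exists>U r. finite U \<and> 1 \<in> U \<and> (\<forall>x y b. r (x + y) b = r x b + r y b) \<and> (\<forall>x b. r x b \<in> \<rat>) \<and>
    (\<forall>b. r 1 b = (if b = 1 then 1 else 0)) \<and> (\<forall>s\<in>S. s = (\<Sum>b\<in>U. r s b * b))"
proof -
  have "qvec.independent {1}" by simp
  then obtain B where B: "{1} \<subseteq> B" "qvec.independent B" "UNIV \<subseteq> qvec.span B"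
    using qvec.maximal_independent_subset_extend[of "{1}" UNIV] by auto
  then have span: "x \<in> qvec.span B" for x by blast
  define r where "r = (\<lambda>x b. real_of_rat (qvec.representation B x b))"
  define U where "U = insert 1 (\<Union>s\<in>S. {b. qvec.representation B s b \<noteq> 0})"
  have fin: "finite U"
    unfolding U_def using assms by (intro finite.insertI finite_UN_I qvec.finite_representation)
  have add: "r (x + y) b = r x b + r y b" for x y b
    using B(2) span by (simp add: r_def qvec.representation_add of_rat_add)
  have one: "r 1 b = (if b = 1 then 1 else 0)" for b
    using B(1,2) by (simp add: r_def qvec.representation_basis)
  have expand: "s = (\<Sum>b\<in>U. r s b * b)" if "s \<in> S" for s
  proof -
    have "s = (\<Sum>b | qvec.representation B s b \<noteq> 0. qscale (qvec.representation B s b) b)"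
      using qvec.sum_nonzero_representation_eq[OF B(2) span] by simp
    also have "\<dots> = (\<Sum>b\<in>U. r s b * b)"
      using fin that by (intro sum.mono_neutral_cong_left) (auto simp: U_def r_def qscale_def)
    finally show ?thesis .
  qed
  have "1 \<in> U" by (simp add: U_def)
  moreover have "r x b \<in> \<rat>" for x b by (simp add: r_def)
  ultimately show ?thesis
    using fin add one expand by (intro exI[of _ U] exI[of _ r]) blast
qed

lemma additive_Ints_mult:
  fixes f :: "real \<Rightarrow> real"
  assumes add: "\<And>x y. f (x + y) = f x + f y" and "k \<in> \<int>"
  shows "f (k * x) = k * f x"
proof -
  have "f 0 = 0" using add[of 0 0] by simp
  then have minus: "f (- x) = - f x" for x using add[of x "- x"] by simp
  have nat: "f (real j * x) = real j * f x" for j x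
    by (induction j) (simp_all add: \<open>f 0 = 0\<close> distrib_right add)
  obtain z where k: "k = of_int z" using \<open>k \<in> \<int>\<close> Ints_cases by blast
  show ?thesis
  proof (cases "0 \<le> z")
    case True
    then show ?thesis using nat[of "nat z"] by (simp add: k)
  next
    case False
    then have "k = - real (nat (- z))" by (simp add: k)
    then show ?thesis using nat[of "nat (- z)"] minus by simp
  qed
qed

lemma dot_additive_image:
  assumes add: "\<And>x y. f (x + y) = f x + f y" and "m \<in> int_vecs n"
  shows "dot n m (\<lambda>i. f (x i)) = f (dot n m x)"
proof -
  have "f 0 = 0" using add[of 0 0] by simp
  have "f (\<Sum>i<k. m i * x i) = (\<Sum>i<k. m i * f (x i))" for k
    using additive_Ints_mult[of f] add \<open>m \<in> int_vecs n\<close>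
    by (induction k) (simp_all add: \<open>f 0 = 0\<close> int_vecs_def)
  then show ?thesis by (simp add: dot_def)
qed

lemma common_denominator:
  fixes n :: nat and x :: "nat \<Rightarrow> real"
  assumes "\<And>i. i < n \<Longrightarrow> x i \<in> \<rat>"
  obtains N :: nat where "N > 0" "\<And>i. i < n \<Longrightarrow> real N * x i \<in> \<int>"
proof -
  have "\<exists>N::nat. N > 0 \<and> (\<forall>i<n. real N * x i \<in> \<int>)"
    using assms
  proof (induction n)
    case (Suc n)
    then obtain N :: nat where N: "N > 0" "\<forall>i<n. real N * x i \<in> \<int>" by auto
    have "x n \<in> \<rat>" using Suc.prems by simp
    then obtain p q :: int where pq: "q > 0" "x n = of_int p / of_int q" by (rule Rats_cases')
    have "real (N * nat q) * x i \<in> \<int>" if "i < Suc n" for i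
    proof (cases "i = n")
      case True
      have "real (N * nat q) * x i = of_int (int N * p)" using pq by (simp add: True)
      then show ?thesis by (metis Ints_of_int)
    next
      case False
      then have "real N * x i \<in> \<int>" using N that by simp
      then have "real (nat q) * (real N * x i) \<in> \<int>"
        using Ints_mult[of "real (nat q)" "real N * x i"] by simp
      then show ?thesis by (simp add: mult_ac)
    qed
    then show ?case using N(1) pq(1) by (intro exI[of _ "N * nat q"]) auto
  qed (auto intro: exI[of _ 1])
  then show ?thesis using that by blast
qed

section \<open>Rational subspaces\<close>

definition unit_vec :: "nat \<Rightarrow> nat \<Rightarrow> real"
  where "unit_vec i = (\<lambda>j. if j = i then 1 else 0)"

lemma unit_vec_int: "i < n \<Longrightarrow> unit_vec i \<in> int_vecs n"
  by (auto simp: unit_vec_def int_vecs_def vecs_def)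

lemma sum_fun_apply: "(\<Sum>i\<in>A. f i) x = (\<Sum>i\<in>A. f i x)" for f :: "'a \<Rightarrow> 'b \<Rightarrow> 'c :: comm_monoid_add"
  by (induction A rule: infinite_finite_induct) simp_all

lemma vecs_subset_span: "vecs n \<subseteq> rvec.span (unit_vec ` {..<n})"
proof
  fix x :: "nat \<Rightarrow> real" assume x: "x \<in> vecs n"
  have "x = (\<Sum>i<n. rscale (x i) (unit_vec i))"
  proof
    fix j show "x j = (\<Sum>i<n. rscale (x i) (unit_vec i)) j"
      using x by (simp add: sum_fun_apply rscale_def unit_vec_def vecs_def if_distrib cong: if_cong)
  qed
  then show "x \<in> rvec.span (unit_vec ` {..<n})"
    by (metis (mono_tags, lifting) rvec.span_sum rvec.span_scale rvec.span_base imageI)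
qed

lemma finite_independent_vecs: "rvec.independent B \<Longrightarrow> B \<subseteq> vecs n \<Longrightarrow> finite B"
  using rvec.independent_span_bound[of "unit_vec ` {..<n}" B] vecs_subset_span by blast

lemma span_subset_vecs: "B \<subseteq> vecs n \<Longrightarrow> rvec.span B \<subseteq> vecs n"
  by (rule rvec.span_minimal[OF _ subspace_vecs])

lemma dim_mono_vecs:
  assumes "V \<subseteq> W" "W \<subseteq> vecs n"
  shows "rvec.dim V \<le> rvec.dim W"
    and "rvec.subspace V \<Longrightarrow> rvec.dim V = rvec.dim W \<Longrightarrow> V = W"
proof -
  obtain B where B: "B \<subseteq> V" "rvec.independent B" "V \<subseteq> rvec.span B" "card B = rvec.dim V"
    using rvec.basis_exists .
  obtain C where C: "B \<subseteq> C" "C \<subseteq> W" "rvec.independent C" "W \<subseteq> rvec.span C"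
    using rvec.maximal_independent_subset_extend[of B W] B assms by (metis subset_trans)
  have "card C = rvec.dim W" using C by (intro rvec.basis_card_eq_dim) auto
  moreover have "finite C" using finite_independent_vecs C assms by (metis subset_trans)
  ultimately show "rvec.dim V \<le> rvec.dim W" using C B card_mono by metis
  assume "rvec.subspace V" "rvec.dim V = rvec.dim W"
  then have "B = C" using B C \<open>card C = _\<close> \<open>finite C\<close> by (metis card_subset_eq)
  then have "W \<subseteq> V" using C B \<open>rvec.subspace V\<close> rvec.span_minimal by (metis subset_trans)
  then show "V = W" using assms by blast
qed

lemma dim_pos_nonzero:
  assumes "rvec.dim W = Suc k"
  obtains w where "w \<in> W" "w \<noteq> 0"
proof -
  have "\<not> W \<subseteq> rvec.span {}"
    using rvec.dim_le_card[of W "{}"] assms by auto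
  then show ?thesis using that by auto
qed

definition rational_subspace :: "nat \<Rightarrow> (nat \<Rightarrow> real) set \<Rightarrow> bool"
  where "rational_subspace n W \<longleftrightarrow> (\<exists>B\<subseteq>int_vecs n. W = rvec.span B)"

lemma subtori_eq: "subtori k n = {torus_proj ` W | W. rvec.dim W = k \<and> rational_subspace n W}"
  by (simp add: subtori_def rational_subspace_def)

lemma rational_subspaceD:
  assumes "rational_subspace n W"
  shows "rvec.subspace W" "W \<subseteq> vecs n"
  using assms span_subset_vecs int_vecs_subset_vecs
  unfolding rational_subspace_def by (auto simp: rvec.subspace_span) (meson in_mono subset_trans)

lemma rational_subspace_basis:
  assumes "rational_subspace n W"
  obtains B where "B \<subseteq> int_vecs n" "rvec.independent B" "W = rvec.span B" "finite B" "card B = rvec.dim W"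
proof -
  obtain A where A: "A \<subseteq> int_vecs n" "W = rvec.span A"
    using assms by (auto simp: rational_subspace_def)
  obtain B where B: "B \<subseteq> A" "rvec.independent B" "A \<subseteq> rvec.span B"
    using rvec.maximal_independent_subset .
  have "rvec.span A = rvec.span B"
    using B by (metis rvec.span_minimal rvec.span_mono rvec.subspace_span subset_antisym)
  moreover have "finite B" using finite_independent_vecs B A int_vecs_subset_vecs by (metis subset_trans)
  moreover have "card B = rvec.dim W"
    using rvec.dim_span_eq_card_independent[OF B(2)] calculation(1) A(2) by simp
  ultimately show ?thesis using that[of B] A B by blast
qed

definition orth :: "nat \<Rightarrow> (nat \<Rightarrow> real) set \<Rightarrow> (nat \<Rightarrow> real) set"
  where "orth n M = {w \<in> vecs n. \<forall>m\<in>M. dot n m w = 0}"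

lemma subspace_orth: "rvec.subspace (orth n M)"
  by (auto simp: rvec.subspace_def orth_def vecs_add vecs_rscale dot_add_right dot_rscale_right)

lemma orth_subset_vecs: "orth n M \<subseteq> vecs n"
  by (auto simp: orth_def)

text \<open>Expanding the coordinates of a real solution \<open>w\<close> of an integral linear system in a rational
  basis of the reals splits \<open>w\<close> into a real combination of rational solutions.\<close>

lemma rational_subspace_orth:
  assumes "M \<subseteq> int_vecs n"
  shows "rational_subspace n (orth n M)"
proof -
  have "orth n M \<subseteq> rvec.span (int_vecs n \<inter> orth n M)"
  proof
    fix w assume w: "w \<in> orth n M"
    obtain U :: "real set" and r :: "real \<Rightarrow> real \<Rightarrow> real" where U: "finite U"
      and r_add: "\<And>x y b. r (x + y) b = r x b + r y b" and r_rat: "\<And>x b. r x b \<in> \<rat>"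
      and expand: "\<forall>s\<in>w ` {..<n}. s = (\<Sum>b\<in>U. r s b * b)"
      using rational_coordinates[of "w ` {..<n}"] by auto
    define v where "v = (\<lambda>b i. r (w i) b)"
    have r0: "r 0 b = 0" for b using r_add[of 0 0 b] by simp
    have v_in: "v b \<in> vecs n" for b using w by (auto simp: v_def orth_def vecs_def r0)
    have v_orth: "dot n m (v b) = 0" if "m \<in> M" for m b
    proof -
      have "dot n m (v b) = r (dot n m w) b"
        unfolding v_def using that assms by (intro dot_additive_image r_add) auto
      then show ?thesis using w that by (simp add: orth_def r0)
    qed
    have v_span: "v b \<in> rvec.span (int_vecs n \<inter> orth n M)" for b
    proof -
      obtain N :: nat where N: "N > 0" "\<And>i. i < n \<Longrightarrow> real N * v b i \<in> \<int>"
        using common_denominator[of n "v b"] r_rat by (auto simp: v_def)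
      have "real N * v b i \<in> \<int>" for i
        using N(2)[of i] v_in[of b] by (cases "i < n") (auto simp: vecs_def)
      then have "rscale (real N) (v b) \<in> int_vecs n \<inter> orth n M"
        using v_in v_orth by (auto simp: int_vecs_def orth_def vecs_rscale dot_rscale_right)
          (simp add: rscale_def)
      then have "rscale (1 / real N) (rscale (real N) (v b)) \<in> rvec.span (int_vecs n \<inter> orth n M)"
        by (intro rvec.span_scale rvec.span_base)
      then show ?thesis using N(1) by (simp add: rscale_def)
    qed
    have "w = (\<Sum>b\<in>U. rscale b (v b))"
    proof
      fix i
      show "w i = (\<Sum>b\<in>U. rscale b (v b)) i"
      proof (cases "i < n")
        case True
        then have "w i = (\<Sum>b\<in>U. r (w i) b * b)" using expand by simp
        then show ?thesis by (simp add: sum_fun_apply rscale_def v_def mult.commute)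
      next
        case False
        then show ?thesis using w v_in by (simp add: sum_fun_apply orth_def vecs_def rscale_def)
      qed
    qed
    then show "w \<in> rvec.span (int_vecs n \<inter> orth n M)"
      by (metis (no_types, lifting) rvec.span_sum rvec.span_scale v_span)
  qed
  moreover have "rvec.span (int_vecs n \<inter> orth n M) \<subseteq> orth n M"
    by (intro rvec.span_minimal subspace_orth) auto
  ultimately show ?thesis
    unfolding rational_subspace_def by (intro exI[of _ "int_vecs n \<inter> orth n M"]) auto
qed

lemma orth_finite_subset:
  assumes "M \<subseteq> int_vecs n"
  obtains M0 where "finite M0" "M0 \<subseteq> M" "orth n M0 = orth n M"
proof -
  obtain B where B: "B \<subseteq> M" "rvec.independent B" "M \<subseteq> rvec.span B"
    using rvec.maximal_independent_subset .
  have "finite B" using finite_independent_vecs B assms int_vecs_subset_vecs by (metis subset_trans)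
  have "dot n m w = 0" if "w \<in> orth n B" "m \<in> M" for w m
  proof -
    have "rvec.subspace {x. dot n w x = 0}"
      by (simp add: rvec.subspace_def dot_add_right dot_rscale_right)
    then have "rvec.span B \<subseteq> {x. dot n w x = 0}"
      using that(1) by (intro rvec.span_minimal) (auto simp: orth_def dot_commute)
    then show ?thesis using that(2) B(3) dot_commute by auto
  qed
  then have "orth n B = orth n M" using B(1) by (auto simp: orth_def)
  then show ?thesis using that \<open>finite B\<close> B(1) by blast
qed

section \<open>Duality for closed subgroups\<close>

text \<open>The characters of the torus are given by integer vectors; they are evaluated on real lifts, and
  a character is trivial at a point if its value on a lift is an integer.\<close>

definition annihilator :: "nat \<Rightarrow> (nat \<Rightarrow> real) set \<Rightarrow> (nat \<Rightarrow> circle) set"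
  where "annihilator n M = torus_proj ` {x \<in> vecs n. \<forall>m\<in>M. dot n m x \<in> \<int>}"

definition chars :: "nat \<Rightarrow> (nat \<Rightarrow> circle) set \<Rightarrow> (nat \<Rightarrow> real) set"
  where "chars n H = {m \<in> int_vecs n. \<forall>x\<in>vecs n. torus_proj x \<in> H \<longrightarrow> dot n m x \<in> \<int>}"

lemma chars_int: "chars n H \<subseteq> int_vecs n"
  by (auto simp: chars_def)

lemma torus_proj_in_annihilator_iff:
  assumes "M \<subseteq> int_vecs n" "x \<in> vecs n"
  shows "torus_proj x \<in> annihilator n M \<longleftrightarrow> (\<forall>m\<in>M. dot n m x \<in> \<int>)"
proof
  assume "torus_proj x \<in> annihilator n M"
  then obtain y where y: "torus_proj x = torus_proj y" "y \<in> vecs n" "\<forall>m\<in>M. dot n m y \<in> \<int>"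
    by (auto simp: annihilator_def)
  then have z: "x - y \<in> int_vecs n" using torus_proj_eq_iff assms(2) by blast
  show "\<forall>m\<in>M. dot n m x \<in> \<int>"
  proof
    fix m assume "m \<in> M"
    then have "dot n m y + dot n m (x - y) \<in> \<int>"
      using y(3) dot_int[OF _ z, of m] assms(1) by (intro Ints_add) auto
    then show "dot n m x \<in> \<int>" by (simp add: dot_diff_right)
  qed
qed (use assms in \<open>auto simp: annihilator_def\<close>)

lemma annihilator_subset_vecs: "annihilator n M \<subseteq> vecs n"
  by (auto simp: annihilator_def torus_proj_in_vecs)

lemma annihilator_Un: 
  assumes "M \<subseteq> int_vecs n" "M' \<subseteq> int_vecs n"
  shows "annihilator n (M \<union> M') = annihilator n M \<inter> annihilator n M'"
proof (rule Set.set_eqI)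
  fix h
  show "h \<in> annihilator n (M \<union> M') \<longleftrightarrow> h \<in> annihilator n M \<inter> annihilator n M'"
  proof (cases "h \<in> vecs n")
    case True
    then obtain x where "x \<in> vecs n" "h = torus_proj x" by (rule torus_proj_cases)
    then show ?thesis using assms by (auto simp: torus_proj_in_annihilator_iff)
  qed (use annihilator_subset_vecs in blast)
qed

lemma subgroup_annihilator: "subgroup (annihilator n M) (torus n)"
  unfolding subgroup_torus_iff
proof (intro conjI ballI annihilator_subset_vecs)
  show "0 \<in> annihilator n M"
    unfolding annihilator_def by (rule image_eqI[of _ _ 0]) auto
next
  fix g h assume "g \<in> annihilator n M" "h \<in> annihilator n M"
  then obtain x y where "x \<in> vecs n" "\<forall>m\<in>M. dot n m x \<in> \<int>" "g = torus_proj x"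
    "y \<in> vecs n" "\<forall>m\<in>M. dot n m y \<in> \<int>" "h = torus_proj y" by (auto simp: annihilator_def)
  then show "g + h \<in> annihilator n M"
    unfolding annihilator_def
    by (intro image_eqI[of _ _ "x + y"]) (auto simp: torus_proj_add vecs_add dot_add_right)
next
  fix g assume "g \<in> annihilator n M"
  then obtain x where "x \<in> vecs n" "\<forall>m\<in>M. dot n m x \<in> \<int>" "g = torus_proj x"
    by (auto simp: annihilator_def)
  then show "- g \<in> annihilator n M"
    unfolding annihilator_def
    by (intro image_eqI[of _ _ "- x"]) (auto simp: torus_proj_minus vecs_minus dot_minus_right)
qed

lemma continuous_on_dot [continuous_intros]: "continuous_on A (dot n m)"
  unfolding dot_def
  by (intro continuous_on_sum continuous_on_mult continuous_on_const
      continuous_on_product_then_coordinatewise[OF continuous_on_id])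

text \<open>Closedness is checked on a compact fundamental domain.\<close>

lemma compact_annihilator:
  assumes "M \<subseteq> int_vecs n"
  shows "compact (annihilator n M)"
proof -
  define Q where "Q = {x :: nat \<Rightarrow> real. \<forall>i. 0 \<le> x i \<and> x i \<le> (if i < n then 1 else 0)}"
  have Q_vecs: "Q \<subseteq> vecs n"
  proof
    fix x assume "x \<in> Q"
    then have "x i = 0" if "n \<le> i" for i
      using that unfolding Q_def by (auto dest!: spec[of _ i])
    then show "x \<in> vecs n" by (simp add: vecs_def)
  qed
  have "annihilator n M = torus_proj ` (Q \<inter> (\<Inter>m\<in>M. dot n m -` \<int>))"
  proof (intro equalityI subsetI)
    fix h assume h: "h \<in> annihilator n M"
    then have "h \<in> vecs n" using annihilator_subset_vecs by blast
    then obtain x where x: "x \<in> vecs n" "h = torus_proj x" "\<And>i. 0 \<le> x i" "\<And>i. x i \<le> 1"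
      using torus_proj_cases[of h n] by auto
    then have "\<forall>m\<in>M. dot n m x \<in> \<int>" using h torus_proj_in_annihilator_iff assms by blast
    moreover have "x \<in> Q" using x by (auto simp: Q_def vecs_def)
    ultimately show "h \<in> torus_proj ` (Q \<inter> (\<Inter>m\<in>M. dot n m -` \<int>))" using x(2) by auto
  next
    fix h assume "h \<in> torus_proj ` (Q \<inter> (\<Inter>m\<in>M. dot n m -` \<int>))"
    then show "h \<in> annihilator n M" using Q_vecs by (auto simp: annihilator_def)
  qed
  moreover have "closed (dot n m -` \<int>)" for m
    by (intro closed_vimage closed_Ints continuous_on_dot)
  then have "compact (Q \<inter> (\<Inter>m\<in>M. dot n m -` \<int>))"
    unfolding Q_def by (intro compact_Int_closed compact_box closed_INT) auto
  ultimately show ?thesis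
    by (simp only:) (intro compact_continuous_image continuous_on_torus_proj)
qed

lemma annihilator_empty: "annihilator n {} = vecs n"
proof (intro equalityI annihilator_subset_vecs subsetI)
  fix h :: "nat \<Rightarrow> circle" assume "h \<in> vecs n"
  then obtain x where "x \<in> vecs n" "h = torus_proj x" by (rule torus_proj_cases)
  then show "h \<in> annihilator n {}" by (simp add: annihilator_def)
qed

lemma closed_subset_approx:
  assumes "closed H" "H \<subseteq> vecs n" "x \<in> vecs n" and approx: "\<And>e. e > 0 \<Longrightarrow> \<exists>h\<in>H. h \<in> nbhd n e x"
  shows "x \<in> H"
proof -
  define f where "f = (\<lambda>h. \<Sum>i<n. circle_norm (h i - x i))"
  have "compact (H \<inter> vecs n)"
    using compact_annihilator[of "{}" n] assms(1) by (simp add: annihilator_empty closed_Int_compact)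
  then have "compact H" using assms(2) by (simp add: inf.absorb1)
  moreover have "H \<noteq> {}" using approx[of 1] by auto
  moreover have "continuous_on H f" unfolding f_def by (intro continuous_intros)
  ultimately obtain h0 where h0: "h0 \<in> H" "\<And>h. h \<in> H \<Longrightarrow> f h0 \<le> f h"
    using continuous_attains_inf[of H f] by blast
  have "0 \<le> f h0" by (simp add: f_def sum_nonneg)
  moreover have "\<not> 0 < f h0"
  proof
    assume "0 < f h0"
    then have "0 < f h0 / (real n + 1)" by simp
    then obtain h where h: "h \<in> H" "h \<in> nbhd n (f h0 / (real n + 1)) x" using approx by blast
    have "f h = (\<Sum>i<n. circle_norm (h i - x i))" by (simp add: f_def)
    also have "\<dots> \<le> (\<Sum>i<n. f h0 / (real n + 1))"
      using h(2) by (intro sum_mono) (simp add: nbhd_def less_imp_le)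
    also have "\<dots> < f h0" using \<open>0 < f h0\<close> by (simp add: field_simps)
    finally show False using h0(2)[OF h(1)] by simp
  qed
  ultimately have "f h0 = 0" by simp
  then have "\<forall>i<n. circle_norm (h0 i - x i) = 0"
    unfolding f_def by (subst (asm) sum_nonneg_eq_0_iff) auto
  then have "h0 i = x i" for i
    using h0(1) assms(2,3) by (cases "i < n") (auto simp: circle_norm_dist vecs_def)
  then have "h0 = x" by auto
  then show ?thesis using h0(1) by simp
qed

lemma uniform_density_torus:
  assumes "e > 0"
  obtains R :: nat where "\<And>K x. subgroup K (torus n) \<Longrightarrow> x \<in> vecs n \<Longrightarrow>
    (\<And>m. m \<in> chars n K \<Longrightarrow> (\<And>i. \<bar>m i\<bar> \<le> real R) \<Longrightarrow> dot n m x \<in> \<int>) \<Longrightarrow>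
    \<exists>h\<in>K. h \<in> nbhd n e (torus_proj x)"
proof -
  obtain R :: nat where R: "\<And>G x. G \<noteq> {} \<Longrightarrow> (\<forall>g\<in>G. \<forall>h\<in>G. g + h \<in> G) \<Longrightarrow>
    (\<forall>m\<in>int_vecs n. (\<forall>i. \<bar>m i\<bar> \<le> real R) \<longrightarrow> (\<forall>g\<in>G. dot n m g \<in> \<int>) \<longrightarrow> dot n m x \<in> \<int>) \<Longrightarrow>
    (\<exists>g\<in>G. \<forall>i<n. infdist (g i - x i) \<int> < e)"
    using uniform_density[OF assms, of n] by blast
  have "\<exists>h\<in>K. h \<in> nbhd n e (torus_proj x)"
    if K: "subgroup K (torus n)" and x: "x \<in> vecs n"
      and m: "\<And>m. m \<in> chars n K \<Longrightarrow> (\<And>i. \<bar>m i\<bar> \<le> real R) \<Longrightarrow> dot n m x \<in> \<int>" for K x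
  proof -
    define G where "G = {y \<in> vecs n. torus_proj y \<in> K}"
    have "0 \<in> G" using K by (auto simp: G_def subgroup_torus_iff)
    have "\<exists>g\<in>G. \<forall>i<n. infdist (g i - x i) \<int> < e"
    proof (rule R)
      show "G \<noteq> {}" using \<open>0 \<in> G\<close> by blast
      show "\<forall>g\<in>G. \<forall>h\<in>G. g + h \<in> G"
        using K by (auto simp: G_def subgroup_torus_iff torus_proj_add vecs_add)
      show "\<forall>m\<in>int_vecs n. (\<forall>i. \<bar>m i\<bar> \<le> real R) \<longrightarrow> (\<forall>g\<in>G. dot n m g \<in> \<int>) \<longrightarrow> dot n m x \<in> \<int>"
        using m by (auto simp: chars_def G_def)
    qed
    then obtain g where g: "g \<in> G" "\<forall>i<n. infdist (g i - x i) \<int> < e" by blast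
    then have "torus_proj g \<in> nbhd n e (torus_proj x)"
      by (simp add: nbhd_def torus_proj_def to_circle_diff circle_norm_to_circle)
    then show ?thesis using g(1) by (auto simp: G_def)
  qed
  then show ?thesis using that[of R] by blast
qed

text \<open>By uniform density, a point annihilated by all characters that are trivial on \<open>H\<close> is a limit of
  points of \<open>H\<close>.\<close>

lemma closed_subgroup_duality:
  assumes "closed H" "subgroup H (torus n)"
  shows "H = annihilator n (chars n H)"
proof (intro equalityI subsetI)
  fix h assume "h \<in> H"
  moreover from this have "h \<in> vecs n" using assms(2) by (auto simp: subgroup_torus_iff)
  then obtain x where "x \<in> vecs n" "h = torus_proj x" by (rule torus_proj_cases)
  ultimately show "h \<in> annihilator n (chars n H)"
    using chars_int by (auto simp: torus_proj_in_annihilator_iff) (auto simp: chars_def)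
next
  fix h assume "h \<in> annihilator n (chars n H)"
  then obtain x where x: "x \<in> vecs n" "h = torus_proj x" "\<forall>m\<in>chars n H. dot n m x \<in> \<int>"
    by (auto simp: annihilator_def)
  show "h \<in> H"
  proof (rule closed_subset_approx[OF assms(1)])
    show "H \<subseteq> vecs n" using assms(2) by (simp add: subgroup_torus_iff)
    show "h \<in> vecs n" using x by (simp add: torus_proj_in_vecs)
    fix e :: real assume "e > 0"
    show "\<exists>g\<in>H. g \<in> nbhd n e h"
      by (rule uniform_density_torus[OF \<open>e > 0\<close>, of n]) (use x assms(2) in blast)
  qed
qed

section \<open>Identity components\<close>

lemma torus_proj_orth_subset: "torus_proj ` orth n M \<subseteq> annihilator n M"
  by (auto simp: orth_def annihilator_def)

text \<open>Near \<open>0\<close> the integrality conditions are linear equations: finitely many elements of \<open>M\<close> determine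
  the orthogonal space, and an integer of absolute value less than \<open>1\<close> is \<open>0\<close>.\<close>

lemma annihilator_near_0:
  assumes "M \<subseteq> int_vecs n"
  obtains e where "e > 0" "\<And>y. y \<in> vecs n \<Longrightarrow> torus_proj y \<in> annihilator n M \<Longrightarrow>
    (\<And>i. i < n \<Longrightarrow> \<bar>y i\<bar> < e) \<Longrightarrow> y \<in> orth n M"
proof -
  obtain M0 where M0: "finite M0" "M0 \<subseteq> M" "orth n M0 = orth n M"
    using orth_finite_subset[OF assms] .
  define C where "C = 1 + (\<Sum>m\<in>M0. \<Sum>i<n. \<bar>m i\<bar>)"
  have "1 \<le> C" by (simp add: C_def sum_nonneg)
  show ?thesis
  proof (rule that[of "1 / C"])
    show "1 / C > 0" using \<open>1 \<le> C\<close> by simp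
    fix y assume y: "y \<in> vecs n" "torus_proj y \<in> annihilator n M" "\<And>i. i < n \<Longrightarrow> \<bar>y i\<bar> < 1 / C"
    have "dot n m y = 0" if "m \<in> M0" for m
    proof -
      have int: "dot n m y \<in> \<int>" using y(1,2) that M0(2) assms torus_proj_in_annihilator_iff by blast
      have "\<bar>dot n m y\<bar> \<le> (\<Sum>i<n. \<bar>m i\<bar> * \<bar>y i\<bar>)"
        unfolding dot_def by (rule order_trans[OF sum_abs]) (simp add: abs_mult)
      also have "\<dots> \<le> (\<Sum>i<n. \<bar>m i\<bar> * (1 / C))"
        using y(3) by (intro sum_mono mult_left_mono) (auto intro: less_imp_le)
      also have "\<dots> = (\<Sum>i<n. \<bar>m i\<bar>) / C" by (simp add: sum_divide_distrib)
      also have "(\<Sum>i<n. \<bar>m i\<bar>) \<le> (\<Sum>m\<in>M0. \<Sum>i<n. \<bar>m i\<bar>)"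
        using that M0(1) by (intro member_le_sum) (auto simp: sum_nonneg)
      then have "(\<Sum>i<n. \<bar>m i\<bar>) / C < 1" using \<open>1 \<le> C\<close> by (simp add: C_def)
      finally show ?thesis using int Ints_nonzero_abs_less1 by blast
    qed
    then have "y \<in> orth n M0" using y(1) by (simp add: orth_def)
    then show "y \<in> orth n M" by (simp add: M0(3))
  qed
qed

lemma annihilator_nbhd_0:
  assumes "M \<subseteq> int_vecs n"
  obtains e where "e > 0" "\<And>h. h \<in> annihilator n M \<Longrightarrow> h \<in> nbhd n e 0 \<Longrightarrow> h \<in> torus_proj ` orth n M"
proof -
  obtain e where e: "e > 0" "\<And>y. y \<in> vecs n \<Longrightarrow> torus_proj y \<in> annihilator n M \<Longrightarrow>
    (\<And>i. i < n \<Longrightarrow> \<bar>y i\<bar> < e) \<Longrightarrow> y \<in> orth n M"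
    by (rule annihilator_near_0[OF assms]) (rule that, assumption, blast)
  have "h \<in> torus_proj ` orth n M" if h: "h \<in> annihilator n M" "h \<in> nbhd n e 0" for h
  proof -
    have "h \<in> vecs n" using h annihilator_subset_vecs by blast
    then obtain y where "y \<in> vecs n" "torus_proj y = h" "\<And>i. i < n \<Longrightarrow> \<bar>y i\<bar> < e"
      using nbhd_0_lift[OF _ h(2)] by blast
    then show ?thesis using e(2)[of y] h(1) by auto
  qed
  then show ?thesis using that e(1) by blast
qed

lemma continuous_on_torus_line: "continuous_on A (\<lambda>t. torus_proj (rscale t w))"
proof (rule continuous_on_compose2[OF continuous_on_torus_proj[of UNIV]])
  show "continuous_on A (\<lambda>t. rscale t w)"
    unfolding rscale_def
    by (intro continuous_on_coordinatewise_then_product continuous_on_mult_right continuous_on_id)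
qed simp

lemma connected_torus_proj_subspace:
  assumes "rvec.subspace W"
  shows "connected (torus_proj ` W)"
proof -
  define L where "L = (\<lambda>w. (\<lambda>t. torus_proj (rscale t w)) ` {0..1})"
  have "connected (L w)" for w
    unfolding L_def by (intro connected_continuous_image connected_Icc continuous_on_torus_line)
  moreover have "0 \<in> L w" for w
    unfolding L_def by (rule image_eqI[of _ _ 0]) (auto simp: rscale_def torus_proj_def to_circle_0 fun_eq_iff)
  ultimately have "connected (\<Union>w\<in>W. L w)"
    by (intro connected_Union) (blast, blast)
  moreover have "(\<Union>w\<in>W. L w) = torus_proj ` W"
  proof (intro equalityI subsetI)
    fix h assume "h \<in> torus_proj ` W"
    then obtain w where "w \<in> W" "h = torus_proj w" by blast
    then have "h \<in> L w" unfolding L_def by (intro image_eqI[of _ _ 1]) (auto simp: rscale_def)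
    then show "h \<in> (\<Union>w\<in>W. L w)" using \<open>w \<in> W\<close> by blast
  qed (use assms in \<open>auto simp: L_def rvec.subspace_def\<close>)
  ultimately show ?thesis by simp
qed

lemma torus_proj_subspace_closed:
  assumes "rvec.subspace W" "g \<in> torus_proj ` W" "h \<in> torus_proj ` W"
  shows "g + h \<in> torus_proj ` W" "g - h \<in> torus_proj ` W" "- h \<in> torus_proj ` W"
  using assms rvec.subspace_add rvec.subspace_diff rvec.subspace_neg
  by (auto simp: torus_proj_add[symmetric] torus_proj_diff[symmetric] torus_proj_minus[symmetric]
      intro!: imageI)

text \<open>The projected orthogonal space is a neighbourhood of \<open>0\<close> in the annihilator, hence open and closed
  in it.\<close>

lemma component_annihilator:
  assumes "M \<subseteq> int_vecs n"
  shows "connected_component_set (annihilator n M) 0 = torus_proj ` orth n M"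
proof
  have "0 \<in> torus_proj ` orth n M"
    by (rule image_eqI[of _ _ 0]) (auto simp: orth_def)
  then show "torus_proj ` orth n M \<subseteq> connected_component_set (annihilator n M) 0"
    by (intro connected_component_maximal connected_torus_proj_subspace subspace_orth
        torus_proj_orth_subset)
next
  define H where "H = annihilator n M"
  define T where "T = torus_proj ` orth n M"
  define C where "C = connected_component_set H 0"
  obtain e where e: "e > 0" "\<And>h. h \<in> H \<Longrightarrow> h \<in> nbhd n e 0 \<Longrightarrow> h \<in> T"
    using annihilator_nbhd_0[OF assms] unfolding H_def T_def by blast
  have sub: "subgroup H (torus n)" unfolding H_def by (rule subgroup_annihilator)
  have diff: "g - h \<in> H" if "g \<in> H" "h \<in> H" for g h
    using sub that unfolding subgroup_torus_iff by (metis diff_conv_add_uminus)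
  have "T \<subseteq> H" unfolding T_def H_def by (rule torus_proj_orth_subset)
  have near: "g - h \<in> T" if "g \<in> H" "h \<in> H" "g \<in> nbhd n e h" for g h
    using e(2)[OF diff[OF that(1,2)]] that(3) nbhd_shift by blast
  have T_add: "g + h \<in> T" "g - h \<in> T" if "g \<in> T" "h \<in> T" for g h
    using torus_proj_subspace_closed[OF subspace_orth] that unfolding T_def by blast+
  define U where "U = (\<Union>h\<in>T. nbhd n e h)"
  define V where "V = (\<Union>h\<in>H - T. nbhd n e h)"
  have "open U" "open V" unfolding U_def V_def by (auto intro: open_nbhd)
  have UH: "g \<in> T" if g: "g \<in> U" "g \<in> H" for g
  proof -
    obtain h where h: "h \<in> T" "g \<in> nbhd n e h" using g(1) by (auto simp: U_def)
    then have "(g - h) + h \<in> T" using T_add near g(2) \<open>T \<subseteq> H\<close> by blast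
    then show ?thesis by simp
  qed
  have VH: "g \<notin> T" if g: "g \<in> V" "g \<in> H" for g
  proof
    assume "g \<in> T"
    obtain h where h: "h \<in> H" "h \<notin> T" "g \<in> nbhd n e h" using g(1) by (auto simp: V_def)
    then have "g - (g - h) \<in> T" using T_add near g(2) \<open>g \<in> T\<close> by blast
    then show False using h by simp
  qed
  have "C \<subseteq> H" unfolding C_def by (rule connected_component_subset)
  have cover: "C \<subseteq> U \<union> V"
    using \<open>C \<subseteq> H\<close> nbhd_self[OF e(1)] unfolding U_def V_def by blast
  have "connected C" unfolding C_def by (rule connected_connected_component)
  have "0 \<in> T" unfolding T_def by (rule image_eqI[of _ _ 0]) (auto simp: orth_def)
  then have "0 \<in> U \<inter> C"
    using nbhd_self[OF e(1)] \<open>T \<subseteq> H\<close> by (auto simp: U_def C_def connected_component_refl)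
  moreover have "U \<inter> V \<inter> C = {}" using UH VH \<open>C \<subseteq> H\<close> by blast
  ultimately have "V \<inter> C = {}"
    using connectedD[OF \<open>connected C\<close> \<open>open U\<close> \<open>open V\<close> _ cover] by blast
  then show "C \<subseteq> T" using cover UH \<open>C \<subseteq> H\<close> by blast
qed

lemma countable_int_vecs: "countable (int_vecs n)"
proof -
  have "int_vecs n \<subseteq> (\<lambda>f i. if i < n then f i else 0) ` (PiE {..<n} (\<lambda>_. \<int>))"
  proof
    fix x assume x: "x \<in> int_vecs n"
    then have "x = (\<lambda>i. if i < n then (restrict x {..<n}) i else 0)"
      by (auto simp: int_vecs_def vecs_def fun_eq_iff)
    moreover have "restrict x {..<n} \<in> PiE {..<n} (\<lambda>_. \<int>)" using x by (auto simp: int_vecs_def)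
    ultimately show "x \<in> (\<lambda>f i. if i < n then f i else 0) ` (PiE {..<n} (\<lambda>_. \<int>))" by blast
  qed
  moreover have "countable (PiE {..<n} (\<lambda>_. \<int> :: real set))"
    by (intro countable_PiE countable_int) auto
  ultimately show ?thesis by (rule countable_subset[OF _ countable_image])
qed

text \<open>Lifting the hypothesis, countably many translates of \<open>W'\<close> cover \<open>W\<close>. A line in \<open>W\<close> is uncountable,
  so two of its points lie in the same translate, and their difference spans the line.\<close>

lemma subspace_subset_of_proj_subset:
  assumes W: "rvec.subspace W" "W \<subseteq> vecs n" and W': "rvec.subspace W'" "W' \<subseteq> vecs n"
    and F: "countable F" "F \<subseteq> vecs n"
    and sub: "\<And>w. w \<in> W \<Longrightarrow> \<exists>v\<in>W'. \<exists>f\<in>F. torus_proj w = torus_proj v + f"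
  shows "W \<subseteq> W'"
proof
  fix w assume w: "w \<in> W"
  have "\<forall>f\<in>F. \<exists>y. y \<in> vecs n \<and> torus_proj y = f"
    using F(2) torus_proj_cases by (metis subsetD)
  then obtain l where l: "\<And>f. f \<in> F \<Longrightarrow> l f \<in> vecs n \<and> torus_proj (l f) = f" by metis
  have "\<exists>p. p \<in> F \<times> int_vecs n \<and> rscale t w - l (fst p) - snd p \<in> W'" for t
  proof -
    have tw: "rscale t w \<in> W" using w W by (simp add: rvec.subspace_def)
    then obtain v f where vf: "v \<in> W'" "f \<in> F" "torus_proj (rscale t w) = torus_proj v + f"
      using sub by blast
    then have "torus_proj (rscale t w) = torus_proj (v + l f)" using l by (simp add: torus_proj_add)
    moreover have "v + l f \<in> vecs n" using vf l W' by (auto intro: vecs_add)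
    ultimately have "rscale t w - (v + l f) \<in> int_vecs n"
      using torus_proj_eq_iff tw W(2) by blast
    then show ?thesis using vf by (intro exI[of _ "(f, rscale t w - (v + l f))"]) auto
  qed
  then obtain p where p: "\<And>t. p t \<in> F \<times> int_vecs n"
    "\<And>t. rscale t w - l (fst (p t)) - snd (p t) \<in> W'" by metis
  have "range p \<subseteq> F \<times> int_vecs n" using p(1) by blast
  then have "countable (range p)"
    using F(1) countable_int_vecs countable_subset countable_SIGMA by meson
  then have "\<not> inj p"
    using uncountable_UNIV_real countable_image_inj_on by blast
  then obtain s t where st: "s \<noteq> t" "p s = p t" by (auto simp: inj_def)
  then have "(rscale s w - l (fst (p s)) - snd (p s)) - (rscale t w - l (fst (p t)) - snd (p t)) \<in> W'"
    using p(2) rvec.subspace_diff[OF W'(1)] by blast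
  then have "rscale (s - t) w \<in> W'" using st by (simp add: rvec.scale_left_diff_distrib)
  then have "rscale (1 / (s - t)) (rscale (s - t) w) \<in> W'" using W' rvec.subspace_scale by blast
  moreover have "rscale (1 / (s - t)) (rscale (s - t) w) = w" using st(1) by (simp add: rscale_def)
  ultimately show "w \<in> W'" by simp
qed

lemma torus_proj_subspace_inj:
  assumes "rvec.subspace W" "W \<subseteq> vecs n" "rvec.subspace W'" "W' \<subseteq> vecs n"
    and "torus_proj ` W \<subseteq> torus_proj ` W'"
  shows "W \<subseteq> W'"
proof (rule subspace_subset_of_proj_subset[OF assms(1-4)])
  show "countable {0 :: nat \<Rightarrow> circle}" "{0 :: nat \<Rightarrow> circle} \<subseteq> vecs n" by simp_all
  fix w assume "w \<in> W"
  then obtain v where "v \<in> W'" "torus_proj w = torus_proj v" using assms(5) by blast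
  then show "\<exists>v\<in>W'. \<exists>f\<in>{0}. torus_proj w = torus_proj v + f" by auto
qed

text \<open>From left to right this is duality, where the orthogonal space is the given subspace because
  a subspace is determined by its projection; from right to left it is the description of the
  identity component of an annihilator.\<close>

theorem closed_subgroups_iff:
  "H \<in> closed_subgroups k n \<longleftrightarrow>
    (\<exists>M\<subseteq>int_vecs n. H = annihilator n M \<and> rvec.dim (orth n M) = k)"
proof
  assume H: "H \<in> closed_subgroups k n"
  define M where "M = chars n H"
  have M: "M \<subseteq> int_vecs n" by (simp add: M_def chars_int)
  have HM: "H = annihilator n M"
    using H closed_subgroup_duality by (simp add: M_def closed_subgroups_def)
  obtain W where W: "torus_proj ` W = connected_component_set H 0" "rvec.dim W = k" "rational_subspace n W"
    using H by (auto simp: closed_subgroups_def subtori_eq)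
  then have eq: "torus_proj ` W = torus_proj ` orth n M"
    using component_annihilator[OF M] HM by simp
  have "W = orth n M"
    using torus_proj_subspace_inj rational_subspaceD[OF W(3)] subspace_orth orth_subset_vecs eq
    by (metis order_refl subset_antisym)
  then show "\<exists>M\<subseteq>int_vecs n. H = annihilator n M \<and> rvec.dim (orth n M) = k"
    using M HM W(2) by blast
next
  assume "\<exists>M\<subseteq>int_vecs n. H = annihilator n M \<and> rvec.dim (orth n M) = k"
  then obtain M where M: "M \<subseteq> int_vecs n" "H = annihilator n M" "rvec.dim (orth n M) = k" by blast
  have "connected_component_set H 0 \<in> subtori k n"
    unfolding subtori_eq M(2) component_annihilator[OF M(1)]
    using M(3) rational_subspace_orth[OF M(1)] by blast
  moreover have "closed H" unfolding M(2) by (intro compact_imp_closed compact_annihilator M(1))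
  moreover have "subgroup H (torus n)" unfolding M(2) by (rule subgroup_annihilator)
  ultimately show "H \<in> closed_subgroups k n" by (simp add: closed_subgroups_def)
qed

lemma compact_torus_sum:
  fixes A B :: "(nat \<Rightarrow> circle) set"
  assumes "compact A" "compact B"
  shows "compact {a + b | a b. a \<in> A \<and> b \<in> B}"
proof -
  have c: "continuous_on UNIV (\<lambda>p :: circle \<times> circle. fst p + snd p)"
    unfolding continuous_on_iff
  proof (intro ballI allI impI)
    fix p :: "circle \<times> circle" and e :: real assume "e > 0"
    have "dist (fst q + snd q) (fst p + snd p) < e" if "dist q p < e / 2" for q
    proof -
      have "dist (fst q + snd q) (fst p + snd p) \<le> dist (fst q) (fst p) + dist (snd q) (snd p)"
        using circle_norm_triangle[of "fst q - fst p" "snd q - snd p"]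
        by (simp add: dist_circle_def algebra_simps)
      then show ?thesis using that dist_fst_le[of q p] dist_snd_le[of q p] by simp
    qed
    then show "\<exists>d>0. \<forall>q\<in>UNIV. dist q p < d \<longrightarrow> dist (fst q + snd q) (fst p + snd p) < e"
      using \<open>e > 0\<close> by (intro exI[of _ "e / 2"]) auto
  qed
  have "continuous_on UNIV (\<lambda>p :: (nat \<Rightarrow> circle) \<times> (nat \<Rightarrow> circle). fst p i + snd p i)" for i
  proof -
    have "continuous_on UNIV (\<lambda>p :: (nat \<Rightarrow> circle) \<times> (nat \<Rightarrow> circle). (fst p i, snd p i))"
      by (intro continuous_on_Pair
          continuous_on_compose2[OF continuous_on_coord[of UNIV i] continuous_on_fst]
          continuous_on_compose2[OF continuous_on_coord[of UNIV i] continuous_on_snd]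
          continuous_on_id subset_UNIV)
    from continuous_on_compose2[OF c this] show ?thesis by simp
  qed
  then have "continuous_on UNIV (\<lambda>p :: (nat \<Rightarrow> circle) \<times> (nat \<Rightarrow> circle). fst p + snd p)"
    by (intro continuous_on_coordinatewise_then_product) simp
  then have "compact ((\<lambda>p. fst p + snd p) ` (A \<times> B))"
    using assms by (intro compact_continuous_image compact_Times) (auto intro: continuous_on_subset)
  moreover have "(\<lambda>p. fst p + snd p) ` (A \<times> B) = {a + b | a b. a \<in> A \<and> b \<in> B}"
    by (auto simp: image_def)
  ultimately show ?thesis by simp
qed

text \<open>Coefficients of integer vectors only matter modulo \<open>1\<close>, so the projection is a sum of circles.\<close>

lemma compact_torus_proj_rational:
  assumes "rational_subspace n W"
  shows "compact (torus_proj ` W)"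
proof -
  obtain B where B: "B \<subseteq> int_vecs n" "W = rvec.span B" "finite B"
    using rational_subspace_basis[OF assms] by metis
  have "compact (torus_proj ` rvec.span B)"
    using B(3,1)
  proof (induction B rule: finite_induct)
    case empty
    then show ?case by simp
  next
    case (insert b B)
    define S where "S = (\<lambda>t. torus_proj (rscale t b)) ` {0..1}"
    have "compact S"
      unfolding S_def
      by (intro compact_continuous_image compact_Icc continuous_on_torus_line)
    have "torus_proj ` rvec.span (insert b B) = {g + h | g h. g \<in> S \<and> h \<in> torus_proj ` rvec.span B}"
    proof (intro equalityI subsetI)
      fix x assume "x \<in> torus_proj ` rvec.span (insert b B)"
      then obtain y k where y: "x = torus_proj y" "y - rscale k b \<in> rvec.span B"
        by (auto simp: rvec.span_insert)
      have "torus_proj (rscale k b) = torus_proj (rscale (frac k) b)"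
      proof -
        have "rscale (of_int \<lfloor>k\<rfloor>) b \<in> int_vecs n"
          using insert.prems by (intro int_vecs_rscale) auto
        moreover have "rscale k b = rscale (frac k) b + rscale (of_int \<lfloor>k\<rfloor>) b"
          by (simp add: rvec.scale_left_distrib[symmetric] frac_def)
        ultimately show ?thesis by (simp add: torus_proj_add torus_proj_int_vecs)
      qed
      then have "x = torus_proj (rscale (frac k) b) + torus_proj (y - rscale k b)"
        by (simp add: y torus_proj_diff)
      moreover have "torus_proj (rscale (frac k) b) \<in> S"
        using frac_lt_1[of k] by (auto simp: S_def)
      ultimately show "x \<in> {g + h | g h. g \<in> S \<and> h \<in> torus_proj ` rvec.span B}" using y by blast
    next
      fix x assume "x \<in> {g + h | g h. g \<in> S \<and> h \<in> torus_proj ` rvec.span B}"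
      then obtain t v where "x = torus_proj (rscale t b) + torus_proj v" "v \<in> rvec.span B"
        by (auto simp: S_def)
      moreover from this have "rscale t b + v \<in> rvec.span (insert b B)"
        using rvec.span_mono[of B "insert b B"] by (blast intro: rvec.span_add rvec.span_scale rvec.span_base)
      ultimately show "x \<in> torus_proj ` rvec.span (insert b B)"
        by (auto simp: torus_proj_add[symmetric])
    qed
    moreover have "compact {g + h | g h. g \<in> S \<and> h \<in> torus_proj ` rvec.span B}"
      using insert \<open>compact S\<close> by (intro compact_torus_sum) auto
    ultimately show ?case by simp
  qed
  then show ?thesis by (simp add: B(2))
qed

text \<open>Finitely many translates of a subtorus do not enlarge its identity component, again by
  countability.\<close>

lemma subtorus_plus_finite:
  assumes W: "rational_subspace n W"
    and F: "finite F" "F \<subseteq> vecs n" "0 \<in> F" "\<And>f g. f \<in> F \<Longrightarrow> g \<in> F \<Longrightarrow> f + g \<in> F" "\<And>f. f \<in> F \<Longrightarrow> - f \<in> F"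
  shows "{t + f | t f. t \<in> torus_proj ` W \<and> f \<in> F} \<in> closed_subgroups (rvec.dim W) n"
    and "orth n (chars n {t + f | t f. t \<in> torus_proj ` W \<and> f \<in> F}) = W"
proof -
  define H where "H = {t + f | t f. t \<in> torus_proj ` W \<and> f \<in> F}"
  note subW = rational_subspaceD[OF W]
  have "compact H"
    unfolding H_def by (intro compact_torus_sum compact_torus_proj_rational[OF W] finite_imp_compact F)
  then have "closed H" by (rule compact_imp_closed)
  have "subgroup H (torus n)"
    unfolding subgroup_torus_iff
  proof (intro conjI ballI)
    show "H \<subseteq> vecs n"
      using F(2) subW(2) by (auto simp: H_def intro!: vecs_add torus_proj_in_vecs)
    have "0 \<in> torus_proj ` W"
      using rvec.subspace_0[OF subW(1)] by (intro image_eqI[of _ _ 0]) auto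
    then show "0 \<in> H" using F(3) unfolding H_def by (metis (mono_tags, lifting) add_0 mem_Collect_eq)
  next
    fix g h assume "g \<in> H" "h \<in> H"
    then obtain t f t' f' where tf: "g = t + f" "h = t' + f'" "t \<in> torus_proj ` W" "f \<in> F"
      "t' \<in> torus_proj ` W" "f' \<in> F" by (auto simp: H_def)
    have "g + h = (t + t') + (f + f')" by (simp add: tf)
    then show "g + h \<in> H"
      unfolding H_def using tf F(4) torus_proj_subspace_closed(1)[OF subW(1)] by blast
  next
    fix g assume "g \<in> H"
    then obtain t f where tf: "g = t + f" "t \<in> torus_proj ` W" "f \<in> F" by (auto simp: H_def)
    have "- g = - t + - f" by (simp add: tf)
    then show "- g \<in> H"
      unfolding H_def using tf F(5) torus_proj_subspace_closed(3)[OF subW(1)] by blast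
  qed
  define M where "M = chars n H"
  have M: "M \<subseteq> int_vecs n" by (simp add: M_def chars_int)
  have HM: "H = annihilator n M"
    using closed_subgroup_duality \<open>closed H\<close> \<open>subgroup H (torus n)\<close> by (simp add: M_def)
  have WH: "torus_proj ` W \<subseteq> H"
    using F(3) unfolding H_def by (metis (mono_tags, lifting) add.right_neutral mem_Collect_eq subsetI)
  have "torus_proj ` W \<subseteq> connected_component_set H 0"
    using rvec.subspace_0[OF subW(1)]
    by (intro connected_component_maximal connected_torus_proj_subspace subW WH)
       (auto intro: image_eqI[of _ _ 0])
  then have "torus_proj ` W \<subseteq> torus_proj ` orth n M"
    by (simp add: component_annihilator[OF M] HM)
  then have "W \<subseteq> orth n M"
    by (rule torus_proj_subspace_inj[OF subW subspace_orth orth_subset_vecs])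
  moreover have "orth n M \<subseteq> W"
  proof (rule subspace_subset_of_proj_subset[OF subspace_orth orth_subset_vecs subW])
    show "countable F" "F \<subseteq> vecs n" using F by (auto intro: countable_finite)
    fix w assume "w \<in> orth n M"
    then have "torus_proj w \<in> H" using torus_proj_orth_subset HM by blast
    then show "\<exists>v\<in>W. \<exists>f\<in>F. torus_proj w = torus_proj v + f" by (auto simp: H_def)
  qed
  ultimately have W_eq: "W = orth n M" by blast
  then have "H \<in> closed_subgroups (rvec.dim W) n" using closed_subgroups_iff HM M by blast
  then show "{t + f | t f. t \<in> torus_proj ` W \<and> f \<in> F} \<in> closed_subgroups (rvec.dim W) n"
    unfolding H_def .
  show "orth n (chars n {t + f | t f. t \<in> torus_proj ` W \<and> f \<in> F}) = W"
    using W_eq unfolding M_def H_def by (rule sym)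
qed

lemma subtorus_closed_subgroup:
  assumes "rational_subspace n W"
  shows "torus_proj ` W \<in> closed_subgroups (rvec.dim W) n"
proof -
  have eq: "{t + f | t f. t \<in> torus_proj ` W \<and> f \<in> {0}} = torus_proj ` W" by auto
  have "{t + f | t f. t \<in> torus_proj ` W \<and> f \<in> {0}} \<in> closed_subgroups (rvec.dim W) n"
    by (rule subtorus_plus_finite(1)[OF assms]) simp_all
  then show ?thesis by (rule back_subst[OF _ eq])
qed

lemma subtori_subset_closed_subgroups: "subtori k n \<subseteq> closed_subgroups k n"
  using subtorus_closed_subgroup by (auto simp: subtori_eq)

section \<open>Accumulation of closed subgroups\<close>

text \<open>The Lie algebra of a closed subgroup: its projection is the identity component.\<close>

definition tangent :: "nat \<Rightarrow> (nat \<Rightarrow> circle) set \<Rightarrow> (nat \<Rightarrow> real) set"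
  where "tangent n H = orth n (chars n H)"

lemma tangent_annihilator:
  assumes "M \<subseteq> int_vecs n"
  shows "tangent n (annihilator n M) = orth n M"
proof -
  define H where "H = annihilator n M"
  have "H = annihilator n (chars n H)"
    unfolding H_def
    by (intro closed_subgroup_duality compact_imp_closed compact_annihilator assms subgroup_annihilator)
  then have "torus_proj ` orth n (chars n H) = torus_proj ` orth n M"
    using component_annihilator[OF assms] component_annihilator[OF chars_int, of n H] by (simp add: H_def)
  then have "orth n (chars n H) = orth n M"
    using torus_proj_subspace_inj[OF subspace_orth orth_subset_vecs subspace_orth orth_subset_vecs]
    by (metis order_refl subset_antisym)
  then show ?thesis by (simp add: tangent_def H_def)
qed

lemma tangent_mono: "K \<subseteq> H \<Longrightarrow> tangent n K \<subseteq> tangent n H"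
  by (auto simp: tangent_def orth_def chars_def)

lemma subspace_tangent: "rvec.subspace (tangent n H)"
  by (simp add: tangent_def subspace_orth)

lemma tangent_subset_vecs: "tangent n H \<subseteq> vecs n"
  by (simp add: tangent_def orth_subset_vecs)

lemma rational_tangent: "rational_subspace n (tangent n H)"
  by (simp add: tangent_def rational_subspace_orth chars_int)

lemma closed_subgroupsD:
  assumes "H \<in> closed_subgroups k n"
  shows "rvec.dim (tangent n H) = k" "H = annihilator n (chars n H)" "subgroup H (torus n)"
    "compact H" "torus_proj ` tangent n H \<subseteq> H" "H \<subseteq> vecs n" "0 \<in> H"
    "connected_component_set H 0 = torus_proj ` tangent n H"
proof -
  obtain M where M: "M \<subseteq> int_vecs n" "H = annihilator n M" "rvec.dim (orth n M) = k"
    using assms closed_subgroups_iff by blast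
  have t: "tangent n H = orth n M" unfolding M(2) by (rule tangent_annihilator[OF M(1)])
  show "rvec.dim (tangent n H) = k" unfolding t by (rule M(3))
  show c: "compact H" unfolding M(2) by (rule compact_annihilator[OF M(1)])
  show s: "subgroup H (torus n)" unfolding M(2) by (rule subgroup_annihilator)
  show "H \<subseteq> vecs n" unfolding M(2) by (rule annihilator_subset_vecs)
  show "0 \<in> H" using s unfolding subgroup_torus_iff by blast
  show "H = annihilator n (chars n H)" by (rule closed_subgroup_duality[OF compact_imp_closed[OF c] s])
  show "torus_proj ` tangent n H \<subseteq> H" unfolding t unfolding M(2) by (rule torus_proj_orth_subset)
  show "connected_component_set H 0 = torus_proj ` tangent n H"
    unfolding t unfolding M(2) by (rule component_annihilator[OF M(1)])
qed

lemma closed_subgroupsI: "M \<subseteq> int_vecs n \<Longrightarrow> rvec.dim (orth n M) = k \<Longrightarrow> annihilator n M \<in> closed_subgroups k n"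
  using closed_subgroups_iff by blast

lemma finite_bounded_int_vecs: "finite {m \<in> int_vecs n. \<forall>i. \<bar>m i\<bar> \<le> real R}"
proof -
  define Z where "Z = real_of_int ` {- int R..int R}"
  have "{m \<in> int_vecs n. \<forall>i. \<bar>m i\<bar> \<le> real R} \<subseteq>
      (\<lambda>f i. if i < n then f i else 0) ` (PiE {..<n} (\<lambda>_. Z))"
  proof
    fix m assume m: "m \<in> {m \<in> int_vecs n. \<forall>i. \<bar>m i\<bar> \<le> real R}"
    have "m i \<in> Z" for i
    proof -
      have "m i \<in> \<int>" using m by (simp add: int_vecs_def)
      then obtain z where z: "m i = of_int z" by (rule Ints_cases)
      have "\<bar>m i\<bar> \<le> real R" using m by blast
      then have "\<bar>z\<bar> \<le> int R" unfolding z by linarith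
      then have "z \<in> {- int R..int R}" by (simp add: abs_le_iff)
      then show ?thesis unfolding Z_def z by (rule imageI)
    qed
    then have "restrict m {..<n} \<in> PiE {..<n} (\<lambda>_. Z)" by auto
    moreover have "m = (\<lambda>i. if i < n then (restrict m {..<n}) i else 0)"
      using m by (auto simp: int_vecs_def vecs_def fun_eq_iff)
    ultimately show "m \<in> (\<lambda>f i. if i < n then f i else 0) ` (PiE {..<n} (\<lambda>_. Z))" by blast
  qed
  moreover have "finite (PiE {..<n} (\<lambda>_. Z))" by (intro finite_PiE) (auto simp: Z_def)
  ultimately show ?thesis using finite_surj by blast
qed

definition component_cosets :: "nat \<Rightarrow> (nat \<Rightarrow> circle) set \<Rightarrow> (nat \<Rightarrow> circle) set set"
  where "component_cosets n H = (\<lambda>h. (+) h ` (torus_proj ` tangent n H)) ` H"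

lemma finite_component_cosets:
  assumes "H \<in> closed_subgroups k n"
  shows "finite (component_cosets n H)"
proof -
  note H = closed_subgroupsD[OF assms]
  define T where "T = torus_proj ` tangent n H"
  obtain e where e: "e > 0" "\<And>h. h \<in> H \<Longrightarrow> h \<in> nbhd n e 0 \<Longrightarrow> h \<in> T"
    using annihilator_nbhd_0[OF chars_int, of n H] H(2) unfolding T_def tangent_def by metis
  have "H \<subseteq> (\<Union>h\<in>H. nbhd n e h)" using nbhd_self[OF e(1)] by blast
  then obtain F where F: "F \<subseteq> H" "finite F" "H \<subseteq> (\<Union>h\<in>F. nbhd n e h)"
    using compactE_image[OF H(4), of H "nbhd n e"] open_nbhd by metis
  have "component_cosets n H \<subseteq> (\<lambda>h. (+) h ` T) ` F"
  proof
    fix X assume "X \<in> component_cosets n H"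
    then obtain x where x: "x \<in> H" "X = (+) x ` T" by (auto simp: component_cosets_def T_def)
    then obtain h where h: "h \<in> F" "x \<in> nbhd n e h" using F by blast
    have "x - h \<in> H"
      using H(3) x(1) h(1) F(1) unfolding subgroup_torus_iff by (metis diff_conv_add_uminus subsetD)
    then have xh: "x - h \<in> T" using e(2) h(2) nbhd_shift by blast
    have "X = (+) h ` T"
    proof (intro equalityI subsetI)
      fix y assume "y \<in> X"
      then obtain t where t: "t \<in> T" "y = x + t" using x(2) by auto
      then have "(x - h) + t \<in> T"
        using xh torus_proj_subspace_closed(1)[OF subspace_tangent] unfolding T_def by blast
      then show "y \<in> (+) h ` T" using t(2) by (intro image_eqI[of _ _ "(x - h) + t"]) auto
    next
      fix y assume "y \<in> (+) h ` T"
      then obtain t where t: "t \<in> T" "y = h + t" by auto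
      then have "t - (x - h) \<in> T"
        using xh torus_proj_subspace_closed(2)[OF subspace_tangent] unfolding T_def by blast
      then show "y \<in> X" unfolding x(2) using t(2) by (intro image_eqI[of _ _ "t - (x - h)"]) auto
    qed
    then show "X \<in> (\<lambda>h. (+) h ` T) ` F" using h(1) by blast
  qed
  then show ?thesis using F(2) finite_surj by blast
qed

lemma Union_component_cosets:
  assumes "H \<in> closed_subgroups k n"
  shows "\<Union>(component_cosets n H) = H"
proof (intro equalityI subsetI)
  note H = closed_subgroupsD[OF assms]
  fix x assume "x \<in> \<Union>(component_cosets n H)"
  then obtain h t where "h \<in> H" "t \<in> torus_proj ` tangent n H" "x = h + t"
    by (auto simp: component_cosets_def)
  then show "x \<in> H" using H(3,5) unfolding subgroup_torus_iff by blast
next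
  fix x assume "x \<in> H"
  have "torus_proj 0 \<in> torus_proj ` tangent n H"
    by (rule imageI[OF rvec.subspace_0[OF subspace_tangent]])
  then have "x + torus_proj 0 \<in> (+) x ` (torus_proj ` tangent n H)" by (rule imageI)
  then have "x \<in> (+) x ` (torus_proj ` tangent n H)" by (simp only: torus_proj_0 add_0_right)
  then show "x \<in> \<Union>(component_cosets n H)"
    using \<open>x \<in> H\<close> unfolding component_cosets_def by (intro UnionI[OF imageI])
qed

lemma component_cosets_mono:
  "K \<subseteq> H \<Longrightarrow> tangent n K = tangent n H \<Longrightarrow> component_cosets n K \<subseteq> component_cosets n H"
  by (auto simp: component_cosets_def)

text \<open>Take \<open>H\<close> minimal, with respect to dimension and then number of components, among the closed
  subgroups containing infinitely many members of the family. A character nontrivial on \<open>H\<close> is then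
  trivial on only finitely many of these members, so they become dense in \<open>H\<close> by uniform density.
  If \<open>H\<close> had dimension \<open>k\<close>, its subgroups of dimension \<open>k\<close> would be unions of components, and there
  are only finitely many of these.\<close>

theorem closed_subgroups_accumulate:
  assumes "infinite \<K>" and \<K>: "\<K> \<subseteq> closed_subgroups k n"
  obtains d H where "k < d" "H \<in> closed_subgroups d n" "infinite {K\<in>\<K>. K \<subseteq> H}"
    "\<And>e. e > 0 \<Longrightarrow> finite {K\<in>\<K>. K \<subseteq> H \<and> \<not> (\<forall>x\<in>H. \<exists>h\<in>K. h \<in> nbhd n e x)}"
proof -
  define \<F> where "\<F> = {H. (\<exists>d. H \<in> closed_subgroups d n) \<and> infinite {K\<in>\<K>. K \<subseteq> H}}"
  define size where "size = (\<lambda>H. (rvec.dim (tangent n H), card (component_cosets n H)))"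
  note annihilator_empty
  moreover have "K \<subseteq> vecs n" if "K \<in> \<K>" for K using that \<K> closed_subgroupsD(6) by blast
  then have "{K\<in>\<K>. K \<subseteq> vecs n} = \<K>" by blast
  moreover have "annihilator n {} \<in> closed_subgroups (rvec.dim (orth n {})) n"
    by (rule closed_subgroupsI) auto
  ultimately have "vecs n \<in> \<F>" using \<open>infinite \<K>\<close> unfolding \<F>_def by auto
  then obtain H where H: "H \<in> \<F>" and min: "\<And>H'. (size H', size H) \<in> less_than <*lex*> less_than \<Longrightarrow> H' \<notin> \<F>"
    using wfE_min[OF wf_inv_image[OF wf_lex_prod[OF wf_less_than wf_less_than], of size], of "vecs n" \<F>]
    by (auto simp: inv_image_def)
  obtain d where d: "H \<in> closed_subgroups d n" using H by (auto simp: \<F>_def)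
  note HD = closed_subgroupsD[OF d]
  have inf: "infinite {K\<in>\<K>. K \<subseteq> H}" using H by (auto simp: \<F>_def)
  have smaller: "finite {K\<in>\<K>. K \<subseteq> H'}" if H': "H' \<in> closed_subgroups d' n" "H' \<subset> H" for H' d'
  proof -
    have le: "rvec.dim (tangent n H') \<le> rvec.dim (tangent n H)"
      using dim_mono_vecs(1)[OF tangent_mono tangent_subset_vecs] H'(2) by blast
    have "(size H', size H) \<in> less_than <*lex*> less_than"
    proof (cases "rvec.dim (tangent n H') = rvec.dim (tangent n H)")
      case True
      then have eq: "tangent n H' = tangent n H"
        using dim_mono_vecs(2)[OF tangent_mono tangent_subset_vecs subspace_tangent] H'(2) by blast
      then have "component_cosets n H' \<subseteq> component_cosets n H"
        using component_cosets_mono H'(2) by blast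
      moreover have "component_cosets n H' \<noteq> component_cosets n H"
        using Union_component_cosets[OF d] Union_component_cosets[OF H'(1)] H'(2) by auto
      ultimately have "card (component_cosets n H') < card (component_cosets n H)"
        by (intro psubset_card_mono finite_component_cosets[OF d]) auto
      then show ?thesis using True by (simp add: size_def)
    qed (use le in \<open>simp add: size_def\<close>)
    then have "H' \<notin> \<F>" by (rule min)
    then show ?thesis using H'(1) by (auto simp: \<F>_def)
  qed
  have "k \<le> d"
  proof -
    obtain K where "K \<in> \<K>" "K \<subseteq> H" using inf by (metis (mono_tags, lifting) Collect_empty_eq finite.emptyI)
    then show ?thesis
      using dim_mono_vecs(1)[OF tangent_mono[of K H n] tangent_subset_vecs] HD(1)
        closed_subgroupsD(1)[of K k n] \<K> by auto
  qed
  moreover have "k \<noteq> d"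
  proof
    assume "k = d"
    have "component_cosets n K \<subseteq> component_cosets n H \<and> \<Union>(component_cosets n K) = K"
      if K: "K \<in> \<K>" "K \<subseteq> H" for K
    proof -
      have Kk: "K \<in> closed_subgroups k n" using K \<K> by blast
      have "tangent n K = tangent n H"
        using dim_mono_vecs(2)[OF tangent_mono[OF K(2), of n] tangent_subset_vecs subspace_tangent]
          closed_subgroupsD(1)[OF Kk] HD(1) \<open>k = d\<close> by simp
      then show ?thesis using component_cosets_mono[OF K(2)] Union_component_cosets[OF Kk] by blast
    qed
    note cosets = this
    have "{K\<in>\<K>. K \<subseteq> H} \<subseteq> Union ` Pow (component_cosets n H)"
    proof
      fix K assume "K \<in> {K\<in>\<K>. K \<subseteq> H}"
      then have "component_cosets n K \<in> Pow (component_cosets n H)" "K = \<Union>(component_cosets n K)"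
        using cosets[of K] by simp_all
      then show "K \<in> Union ` Pow (component_cosets n H)" by (rule rev_image_eqI)
    qed
    moreover have "finite (Union ` Pow (component_cosets n H))"
      using finite_component_cosets[OF d] by simp
    ultimately have "finite {K\<in>\<K>. K \<subseteq> H}" by (rule finite_subset)
    then show False using inf by (rule notE[rotated])
  qed
  ultimately have "k < d" by simp
  moreover have "finite {K\<in>\<K>. K \<subseteq> H \<and> \<not> (\<forall>x\<in>H. \<exists>h\<in>K. h \<in> nbhd n e x)}" if "e > 0" for e
  proof -
    obtain R :: nat where R: "\<And>K x. subgroup K (torus n) \<Longrightarrow> x \<in> vecs n \<Longrightarrow>
      (\<And>m. m \<in> chars n K \<Longrightarrow> (\<And>i. \<bar>m i\<bar> \<le> real R) \<Longrightarrow> dot n m x \<in> \<int>) \<Longrightarrow>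
      \<exists>h\<in>K. h \<in> nbhd n e (torus_proj x)"
      by (rule uniform_density_torus[OF \<open>e > 0\<close>, of n]) (rule that, blast)
    \<comment> \<open>A member that is not dense to precision \<open>e\<close> has a trivial character in this finite set.\<close>
    define Q where "Q = {m \<in> int_vecs n. (\<forall>i. \<bar>m i\<bar> \<le> real R) \<and> m \<notin> chars n H}"
    have "finite Q"
    proof -
      have "Q \<subseteq> {m \<in> int_vecs n. \<forall>i. \<bar>m i\<bar> \<le> real R}" by (auto simp: Q_def)
      moreover have "finite {m \<in> int_vecs n. \<forall>i. \<bar>m i\<bar> \<le> real R}"
        by (rule finite_bounded_int_vecs)
      ultimately show ?thesis by (rule finite_subset)
    qed
    have fin: "finite {K\<in>\<K>. K \<subseteq> H \<and> m \<in> chars n K}" if m: "m \<in> Q" for m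
    proof -
      have mi: "{m} \<subseteq> int_vecs n" "m \<notin> chars n H" using m by (auto simp: Q_def)
      define H' where "H' = annihilator n (chars n H \<union> {m})"
      have H': "H' = H \<inter> annihilator n {m}"
        unfolding H'_def using annihilator_Un[OF chars_int mi(1)] HD(2) by metis
      have "H' \<in> closed_subgroups (rvec.dim (orth n (chars n H \<union> {m}))) n"
        unfolding H'_def using mi chars_int by (intro closed_subgroupsI) auto
      moreover have "\<not> H \<subseteq> annihilator n {m}"
        using mi torus_proj_in_annihilator_iff[OF mi(1)] by (auto simp: chars_def)
      ultimately have "finite {K\<in>\<K>. K \<subseteq> H'}" using H' by (intro smaller) auto
      moreover have "K \<subseteq> H'" if K: "K \<in> \<K>" "K \<subseteq> H" "m \<in> chars n K" for K
      proof
        fix h assume "h \<in> K"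
        then have "h \<in> vecs n" using K HD(6) by blast
        then obtain x where "x \<in> vecs n" "h = torus_proj x" by (rule torus_proj_cases)
        then have "h \<in> annihilator n {m}"
          using torus_proj_in_annihilator_iff[OF mi(1)] K(3) \<open>h \<in> K\<close> by (auto simp: chars_def)
        then show "h \<in> H'" using H' K(2) \<open>h \<in> K\<close> by blast
      qed
      then have "{K\<in>\<K>. K \<subseteq> H \<and> m \<in> chars n K} \<subseteq> {K\<in>\<K>. K \<subseteq> H'}" by blast
      ultimately show ?thesis by (rule finite_subset[rotated])
    qed
    have "{K\<in>\<K>. K \<subseteq> H \<and> \<not> (\<forall>x\<in>H. \<exists>h\<in>K. h \<in> nbhd n e x)} \<subseteq>
        (\<Union>m\<in>Q. {K\<in>\<K>. K \<subseteq> H \<and> m \<in> chars n K})"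
    proof
      fix K assume "K \<in> {K\<in>\<K>. K \<subseteq> H \<and> \<not> (\<forall>x\<in>H. \<exists>h\<in>K. h \<in> nbhd n e x)}"
      then obtain x where K: "K \<in> \<K>" "K \<subseteq> H" and x: "x \<in> H" "\<not> (\<exists>h\<in>K. h \<in> nbhd n e x)" by blast
      have "x \<in> vecs n" using x HD(6) by blast
      then obtain y where y: "y \<in> vecs n" "x = torus_proj y" by (rule torus_proj_cases)
      have "subgroup K (torus n)" using K \<K> closed_subgroupsD(3) by blast
      then obtain m where m: "m \<in> chars n K" "\<And>i. \<bar>m i\<bar> \<le> real R" "dot n m y \<notin> \<int>"
        using R[of K y] y x(2) by blast
      then have "m \<in> Q" using y x(1) by (auto simp: Q_def chars_def)
      then show "K \<in> (\<Union>m\<in>Q. {K\<in>\<K>. K \<subseteq> H \<and> m \<in> chars n K})" using K m(1) by blast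
    qed
    moreover have "finite (\<Union>m\<in>Q. {K\<in>\<K>. K \<subseteq> H \<and> m \<in> chars n K})"
      using \<open>finite Q\<close> fin by (intro finite_UN_I)
    ultimately show ?thesis by (rule finite_subset)
  qed
  ultimately show ?thesis using that[OF _ d inf] by simp
qed

text \<open>If the members are subtori, they lie in the identity component of \<open>H\<close>, which is then all of \<open>H\<close>
  by density.\<close>

lemma subtori_accumulate:
  assumes \<K>: "\<K> \<subseteq> subtori k n" and H: "H \<in> closed_subgroups d n" and inf: "infinite {K\<in>\<K>. K \<subseteq> H}"
    and dense: "\<And>e. e > 0 \<Longrightarrow> finite {K\<in>\<K>. K \<subseteq> H \<and> \<not> (\<forall>x\<in>H. \<exists>h\<in>K. h \<in> nbhd n e x)}"
  shows "H \<in> subtori d n"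
proof -
  note HD = closed_subgroupsD[OF H]
  define T where "T = torus_proj ` tangent n H"
  have T: "T \<in> subtori d n"
    unfolding T_def subtori_eq using rational_tangent HD(1) by blast
  have KT: "K \<subseteq> T" if K: "K \<in> \<K>" "K \<subseteq> H" for K
  proof -
    obtain W where W: "K = torus_proj ` W" "rational_subspace n W"
      using K \<K> by (auto simp: subtori_eq)
    have "connected K" unfolding W(1) by (intro connected_torus_proj_subspace rational_subspaceD[OF W(2)])
    moreover have "0 \<in> K"
      unfolding W(1) using rvec.subspace_0[OF rational_subspaceD(1)[OF W(2)]]
      by (intro image_eqI[of _ _ 0]) auto
    ultimately have "K \<subseteq> connected_component_set H 0" using K(2) by (intro connected_component_maximal)
    then show ?thesis by (simp only: HD(8) T_def)
  qed
  have "H \<subseteq> T"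
  proof
    fix x assume "x \<in> H"
    show "x \<in> T"
    proof (rule closed_subset_approx)
      show "closed T"
        unfolding T_def by (rule compact_imp_closed[OF compact_torus_proj_rational[OF rational_tangent]])
      show "T \<subseteq> vecs n" using HD(5,6) unfolding T_def by blast
      show "x \<in> vecs n" using \<open>x \<in> H\<close> HD(6) by blast
      fix e :: real assume "e > 0"
      have "infinite ({K\<in>\<K>. K \<subseteq> H} - {K\<in>\<K>. K \<subseteq> H \<and> \<not> (\<forall>x\<in>H. \<exists>h\<in>K. h \<in> nbhd n e x)})"
        using inf dense[OF \<open>e > 0\<close>] by (rule Diff_infinite_finite[rotated])
      then have "{K\<in>\<K>. K \<subseteq> H} - {K\<in>\<K>. K \<subseteq> H \<and> \<not> (\<forall>x\<in>H. \<exists>h\<in>K. h \<in> nbhd n e x)} \<noteq> {}"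
        by (rule infinite_imp_nonempty)
      then obtain K where "K \<in> \<K>" "K \<subseteq> H" "\<forall>x\<in>H. \<exists>h\<in>K. h \<in> nbhd n e x" by blast
      then show "\<exists>h\<in>T. h \<in> nbhd n e x" using KT \<open>x \<in> H\<close> by blast
    qed
  qed
  moreover have "T \<subseteq> H" using HD(5) by (simp add: T_def)
  ultimately show ?thesis using T by (metis subset_antisym)
qed

section \<open>Rational optimal points\<close>

lemma rational_near_on_side:
  fixes b a e :: real
  assumes "e > 0"
  shows "\<exists>q\<in>\<rat>. \<bar>q - b\<bar> < e \<and> a * (q - b) \<le> 0"
proof (cases "a \<le> 0")
  case True
  obtain q where "q \<in> \<rat>" "b < q" "q < b + e" using Rats_dense_in_real[of b "b + e"] assms by auto
  then show ?thesis using True by (intro bexI[of _ q]) (auto simp: mult_nonpos_nonneg)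
next
  case False
  obtain q where "q \<in> \<rat>" "b - e < q" "q < b" using Rats_dense_in_real[of "b - e" b] assms by auto
  then show ?thesis using False by (intro bexI[of _ q]) (auto simp: mult_nonneg_nonpos)
qed

text \<open>Moving the members of a rational basis of the reals to nearby rationals gives an additive map
  with rational values on \<open>S\<close> that is close to the identity on \<open>S\<close>; the sides can be chosen so that
  a prescribed element of \<open>S\<close> does not grow.\<close>

lemma rational_approximation:
  fixes S :: "real set" and e \<delta> :: real
  assumes "finite S" "e > 0" "\<delta> \<in> S"
  shows "\<exists>\<phi> :: real \<Rightarrow> real. (\<forall>x y. \<phi> (x + y) = \<phi> x + \<phi> y) \<and> \<phi> 1 = 1 \<and>
    (\<forall>s\<in>S. \<phi> s \<in> \<rat> \<and> \<bar>\<phi> s - s\<bar> < e) \<and> \<phi> \<delta> \<le> \<delta>"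
proof -
  obtain U :: "real set" and r :: "real \<Rightarrow> real \<Rightarrow> real" where U: "finite U" "1 \<in> U"
    and r_add: "\<And>x y b. r (x + y) b = r x b + r y b" and r_rat: "\<And>x b. r x b \<in> \<rat>"
    and r_1: "\<And>b. r 1 b = (if b = 1 then 1 else 0)" and expand: "\<forall>s\<in>S. s = (\<Sum>b\<in>U. r s b * b)"
    using rational_coordinates[OF assms(1)] by auto
  define C where "C = 1 + (\<Sum>s\<in>S. \<Sum>b\<in>U. \<bar>r s b\<bar>)"
  have "1 \<le> C" by (simp add: C_def sum_nonneg)
  then have "e / C > 0" using \<open>e > 0\<close> by simp
  have "\<exists>q\<in>\<rat>. \<bar>q - b\<bar> < e / C \<and> r \<delta> b * (q - b) \<le> 0 \<and> (b = 1 \<longrightarrow> q = 1)" for b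
  proof (cases "b = 1")
    case True
    then show ?thesis using \<open>e / C > 0\<close> by (intro bexI[of _ 1]) auto
  next
    case False
    then show ?thesis using rational_near_on_side[OF \<open>e / C > 0\<close>, of b "r \<delta> b"] by blast
  qed
  then obtain q where q: "\<And>b. q b \<in> \<rat>" "\<And>b. \<bar>q b - b\<bar> < e / C" "\<And>b. r \<delta> b * (q b - b) \<le> 0" "q 1 = 1"
    by metis
  define \<phi> where "\<phi> = (\<lambda>s. \<Sum>b\<in>U. r s b * q b)"
  have diff: "\<phi> s - s = (\<Sum>b\<in>U. r s b * (q b - b))" if "s \<in> S" for s
  proof -
    have "\<phi> s - s = (\<Sum>b\<in>U. r s b * q b) - (\<Sum>b\<in>U. r s b * b)"
      using expand that by (simp add: \<phi>_def)
    then show ?thesis by (simp add: sum_subtractf right_diff_distrib)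
  qed
  show ?thesis
  proof (intro exI[of _ \<phi>] conjI allI ballI)
    show "\<phi> (x + y) = \<phi> x + \<phi> y" for x y
      by (simp add: \<phi>_def r_add distrib_right sum.distrib)
    have "\<phi> 1 = (\<Sum>b\<in>U. if b = 1 then q b else 0)" unfolding \<phi>_def by (intro sum.cong) (auto simp: r_1)
    then show "\<phi> 1 = 1" using U q(4) by simp
    show "\<phi> s \<in> \<rat>" if "s \<in> S" for s
      unfolding \<phi>_def by (intro Rats_sum Rats_mult q(1) r_rat)
    show "\<bar>\<phi> s - s\<bar> < e" if s: "s \<in> S" for s
    proof -
      have "\<bar>\<phi> s - s\<bar> \<le> (\<Sum>b\<in>U. \<bar>r s b\<bar> * \<bar>q b - b\<bar>)"
        unfolding diff[OF s] by (rule order_trans[OF sum_abs]) (simp add: abs_mult)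
      also have "\<dots> \<le> (\<Sum>b\<in>U. \<bar>r s b\<bar> * (e / C))"
        using q(2) by (intro sum_mono mult_left_mono) (auto intro: less_imp_le)
      also have "\<dots> = (\<Sum>b\<in>U. \<bar>r s b\<bar>) * (e / C)" by (simp only: sum_distrib_right)
      also have "\<dots> < C * (e / C)"
      proof (rule mult_strict_right_mono)
        have "(\<Sum>b\<in>U. \<bar>r s b\<bar>) \<le> (\<Sum>s\<in>S. \<Sum>b\<in>U. \<bar>r s b\<bar>)"
          using s assms(1) by (intro member_le_sum) (auto simp: sum_nonneg)
        then show "(\<Sum>b\<in>U. \<bar>r s b\<bar>) < C" by (simp add: C_def)
      qed fact
      also have "\<dots> = e" using \<open>1 \<le> C\<close> by simp
      finally show ?thesis .
    qed
    have "\<phi> \<delta> - \<delta> \<le> 0" unfolding diff[OF assms(3)] using q(3) by (intro sum_nonpos)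
    then show "\<phi> \<delta> \<le> \<delta>" by simp
  qed
qed

lemma finite_positive_lower_bound:
  fixes f :: "'a \<Rightarrow> real"
  assumes "finite A" "\<And>a. a \<in> A \<Longrightarrow> 0 < f a"
  obtains e where "e > 0" "\<And>a. a \<in> A \<Longrightarrow> e \<le> f a"
proof (cases "A = {}")
  case True
  then show ?thesis using that[of 1] by simp
next
  case False
  then have "0 < Min (f ` A)" using assms by (subst Min_gr_iff) auto
  then show ?thesis using that[of "Min (f ` A)"] assms(1) by simp
qed

lemma half_gap_le_cell:
  assumes "c - 1/2 \<in> \<int>"
  shows "half_gap (to_circle y) \<le> \<bar>y - c\<bar>"
    and "\<bar>y - c\<bar> \<le> 1/2 \<Longrightarrow> half_gap (to_circle y) = \<bar>y - c\<bar>"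
proof -
  have eq: "half_gap (to_circle y) = infdist (y - c) \<int>"
    using infdist_Ints_diff[OF assms, of "y - 1/2"] by (simp add: to_circle_diff circle_norm_to_circle)
  show "half_gap (to_circle y) \<le> \<bar>y - c\<bar>"
    unfolding eq using infdist_Ints_le[of 0 "y - c"] by simp
  show "half_gap (to_circle y) = \<bar>y - c\<bar>" if "\<bar>y - c\<bar> \<le> 1/2"
    unfolding eq using that by (rule infdist_Ints_eq_abs)
qed

lemma half_gap_cell:
  "half_gap (to_circle y) = \<bar>y - (of_int \<lfloor>y\<rfloor> + 1/2)\<bar>"
  by (simp only: half_gap_frac) (simp add: frac_def)

lemma dist_half_le_half:
  assumes "H \<noteq> {}"
  shows "dist_half n H \<le> 1/2"
proof -
  obtain x where "x \<in> H" using assms by blast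
  then have "dist_half n H \<le> center_dist n x" by (rule dist_half_le)
  also have "\<dots> \<le> 1/2" by (simp only: center_dist_le_iff) (use half_gap_le in force)
  finally show ?thesis .
qed

text \<open>An additive map fixing \<open>1\<close> preserves the integral linear conditions defining an annihilator and
  all ties among the coordinates and the optimal value \<open>\<delta>\<close>. Applied to an optimal point it yields a
  rational point which is no worse, hence also optimal, with the same tight coordinates.\<close>

lemma rational_optimum:
  assumes M: "M \<subseteq> int_vecs n" and x: "x \<in> vecs n" "torus_proj x \<in> annihilator n M"
    and \<delta>: "center_dist n (torus_proj x) = dist_half n (annihilator n M)"
  obtains y where "y \<in> vecs n" "\<And>i. y i \<in> \<rat>" "torus_proj y \<in> annihilator n M"
    "center_dist n (torus_proj y) = dist_half n (annihilator n M)"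
    "\<And>i. i < n \<Longrightarrow> half_gap (torus_proj x i) = dist_half n (annihilator n M) \<Longrightarrow>
      half_gap (torus_proj y i) = dist_half n (annihilator n M)"
proof -
  define H where "H = annihilator n M"
  define \<delta> where "\<delta> = dist_half n H"
  define f where "f = (\<lambda>i. half_gap (torus_proj x i))"
  \<comment> \<open>The lift of \<open>1/2\<close> nearest to \<open>x i\<close>.\<close>
  define c where "c = (\<lambda>i. of_int \<lfloor>x i\<rfloor> + 1/2 :: real)"
  have "0 \<le> \<delta>" unfolding \<delta>_def H_def using x(2) by (intro dist_half_nonneg) auto
  have "\<delta> \<le> 1/2" unfolding \<delta>_def H_def using x(2) by (intro dist_half_le_half) auto
  have fc: "f i = \<bar>x i - c i\<bar>" for i
    by (simp only: f_def c_def torus_proj_def half_gap_cell)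
  have f_le: "f i \<le> \<delta>" if "i < n" for i
    using center_dist_coord[OF that, of "torus_proj x"] \<delta> by (simp add: f_def \<delta>_def H_def)
  obtain e0 where e0: "e0 > 0" "\<And>i. i \<in> {i. i < n \<and> f i < \<delta>} \<Longrightarrow> e0 \<le> \<delta> - f i"
    by (rule finite_positive_lower_bound[of "{i. i < n \<and> f i < \<delta>}" "\<lambda>i. \<delta> - f i"]) auto
  \<comment> \<open>Coordinates that are not tight stay below \<open>\<phi> \<delta>\<close> if every quantity moves by less than \<open>e\<close>.\<close>
  define e where "e = (if \<delta> = 0 then 1 else min (e0 / 2) \<delta>)"
  have "e > 0" using e0(1) \<open>0 \<le> \<delta>\<close> by (auto simp: e_def)
  define S where "S = insert \<delta> (x ` {..<n})"
  have S: "finite S" "\<delta> \<in> S" by (auto simp: S_def)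
  obtain \<phi> where add: "\<And>x y. \<phi> (x + y) = \<phi> x + \<phi> y" and \<phi>1: "\<phi> 1 = 1"
    and \<phi>S: "\<And>s. s \<in> S \<Longrightarrow> \<phi> s \<in> \<rat>" "\<And>s. s \<in> S \<Longrightarrow> \<bar>\<phi> s - s\<bar> < e" "\<phi> \<delta> \<le> \<delta>"
    using rational_approximation[OF S(1) \<open>e > 0\<close> S(2)] by metis
  have \<phi>0: "\<phi> 0 = 0" using add[of 0 0] by simp
  have \<phi>_minus: "\<phi> (- t) = - \<phi> t" for t using add[of t "- t"] \<phi>0 by simp
  have \<phi>_diff: "\<phi> (s - t) = \<phi> s - \<phi> t" for s t using add[of s "- t"] \<phi>_minus by simp
  have \<phi>_int: "\<phi> k = k" if "k \<in> \<int>" for k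
    using additive_Ints_mult[of \<phi> k 1] add that \<phi>1 by simp
  have "\<phi> (1/2) = 1/2" using add[of "1/2" "1/2"] \<phi>1 by simp
  then have \<phi>_c: "\<phi> (c i) = c i" for i unfolding c_def add using \<phi>_int by simp
  define y where "y = (\<lambda>i. \<phi> (x i))"
  have y: "y \<in> vecs n" using x(1) by (simp add: y_def vecs_def \<phi>0)
  have yH: "torus_proj y \<in> H"
  proof -
    have "dot n m y \<in> \<int>" if "m \<in> M" for m
    proof -
      have "dot n m x \<in> \<int>" using x that torus_proj_in_annihilator_iff[OF M] by blast
      moreover have "dot n m y = \<phi> (dot n m x)"
        unfolding y_def using M that by (intro dot_additive_image add) auto
      ultimately show ?thesis using \<phi>_int by simp
    qed
    then show ?thesis using torus_proj_in_annihilator_iff[OF M y] by (simp add: H_def)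
  qed
  have "0 \<le> \<phi> \<delta>"
  proof (cases "\<delta> = 0")
    case False
    then have "\<bar>\<phi> \<delta> - \<delta>\<bar> < \<delta>" using \<phi>S(2)[of \<delta>] by (simp add: S_def e_def)
    then show ?thesis by linarith
  qed (simp add: \<phi>0)
  have tight: "\<bar>y i - c i\<bar> = \<phi> \<delta>" if "i < n" "f i = \<delta>" for i
  proof -
    have "x i - c i = \<delta> \<or> x i - c i = - \<delta>" using that fc[of i] by linarith
    moreover have "y i - c i = \<phi> (x i - c i)" by (simp add: y_def \<phi>_diff \<phi>_c)
    ultimately show ?thesis using \<phi>_minus \<open>0 \<le> \<phi> \<delta>\<close> by (metis abs_minus_cancel abs_of_nonneg)
  qed
  have le: "\<bar>y i - c i\<bar> \<le> \<phi> \<delta>" if "i < n" for i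
  proof (cases "f i = \<delta>")
    case False
    then have "f i < \<delta>" using f_le[OF that] by simp
    then have "\<delta> > 0" using fc[of i] by linarith
    then have "e \<le> e0 / 2" by (simp add: e_def)
    moreover have "e0 \<le> \<delta> - f i" using e0(2) that \<open>f i < \<delta>\<close> by simp
    moreover have "\<bar>y i - x i\<bar> < e" unfolding y_def using that by (intro \<phi>S(2)) (simp add: S_def)
    moreover have "\<bar>\<phi> \<delta> - \<delta>\<bar> < e" by (intro \<phi>S(2)) (simp add: S_def)
    ultimately show ?thesis using fc[of i] by linarith
  qed (use tight that in simp)
  have c_int: "c i - 1/2 \<in> \<int>" for i by (simp add: c_def)
  have norm_y: "half_gap (torus_proj y i) = \<bar>y i - c i\<bar>" if "i < n" for i
    unfolding torus_proj_def using le[OF that] \<phi>S(3) \<open>\<delta> \<le> 1/2\<close>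
    by (intro half_gap_le_cell(2)[OF c_int]) simp
  have "center_dist n (torus_proj y) \<le> \<phi> \<delta>"
    unfolding center_dist_le_iff using \<open>0 \<le> \<phi> \<delta>\<close> norm_y le by simp
  moreover have "\<delta> \<le> center_dist n (torus_proj y)" unfolding \<delta>_def by (rule dist_half_le[OF yH])
  ultimately have eq: "\<phi> \<delta> = \<delta>" "center_dist n (torus_proj y) = \<delta>" using \<phi>S(3) by auto
  show ?thesis
  proof (rule that[of y])
    show "y i \<in> \<rat>" for i
    proof (cases "i < n")
      case True
      then show ?thesis unfolding y_def by (intro \<phi>S(1)) (simp add: S_def)
    next
      case False
      then show ?thesis using y by (simp add: vecs_def)
    qed
    show "half_gap (torus_proj y i) = dist_half n (annihilator n M)"
      if "i < n" "half_gap (torus_proj x i) = dist_half n (annihilator n M)" for i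
      using tight[OF that(1)] norm_y[OF that(1)] that(2) eq(1) by (simp add: f_def \<delta>_def H_def)
  qed (use y yH eq in \<open>simp_all add: \<delta>_def H_def\<close>)
qed

text \<open>At an optimal point of a positive-dimensional subgroup with a single tight coordinate, that
  coordinate is constant along the subgroup, or it could be improved. Moving along the subgroup keeps
  the point optimal until a second coordinate becomes tight.\<close>

lemma optimum_two_tight:
  assumes M: "M \<subseteq> int_vecs n" and u: "u \<in> orth n M" "u \<noteq> 0" and "2 \<le> n"
    and proper: "dist_half n (annihilator n M) < 1/2"
  obtains x i j where "x \<in> vecs n" "torus_proj x \<in> annihilator n M"
    "center_dist n (torus_proj x) = dist_half n (annihilator n M)" "i < n" "j < n" "i \<noteq> j"
    "half_gap (torus_proj x i) = dist_half n (annihilator n M)"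
    "half_gap (torus_proj x j) = dist_half n (annihilator n M)"
proof -
  define H where "H = annihilator n M"
  define \<delta> where "\<delta> = dist_half n H"
  define N where "N = (\<lambda>t. half_gap (to_circle t))"
  have "0 \<in> H" using subgroup_annihilator by (simp add: H_def subgroup_torus_iff)
  then have ne: "H \<noteq> {}" by blast
  obtain h where h: "h \<in> H" "center_dist n h = \<delta>"
    using dist_half_attained[OF compact_annihilator[OF M], of n] ne unfolding H_def \<delta>_def by blast
  then have "h \<in> vecs n" using annihilator_subset_vecs by (auto simp: H_def)
  then obtain x where x: "x \<in> vecs n" "h = torus_proj x" by (rule torus_proj_cases)
  have "0 \<le> \<delta>" using h(2) center_dist_nonneg[of n h] by simp
  have u_vec: "u \<in> vecs n" using u by (simp add: orth_def)
  have line: "x + rscale t u \<in> vecs n" "torus_proj (x + rscale t u) \<in> H" for t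
  proof -
    show v: "x + rscale t u \<in> vecs n" by (intro vecs_add vecs_rscale x u_vec)
    have "\<forall>m\<in>M. dot n m x \<in> \<int>"
      using h(1) x torus_proj_in_annihilator_iff[OF M] by (simp add: H_def)
    then show "torus_proj (x + rscale t u) \<in> H"
      using u(1) torus_proj_in_annihilator_iff[OF M v]
      by (simp add: H_def dot_add_right dot_rscale_right orth_def)
  qed
  have N_coord: "half_gap (torus_proj (x + rscale t u) i) = N (x i + t * u i)" for t i
    by (simp add: torus_proj_def N_def rscale_def)
  have opt: "\<exists>i<n. \<delta> \<le> N (x i + t * u i)" for t
  proof (rule ccontr)
    assume "\<not> (\<exists>i<n. \<delta> \<le> N (x i + t * u i))"
    then have less: "\<forall>i<n. N (x i + t * u i) < \<delta>" by (simp add: not_le)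
    then have "0 < \<delta>" using \<open>2 \<le> n\<close> circle_norm_nonneg by (metis N_def less_le_trans linorder_not_less pos2)
    then have "center_dist n (torus_proj (x + rscale t u)) < \<delta>"
      using less by (simp add: center_dist_less_iff N_coord)
    then show False using dist_half_le[OF line(2)[of t], of n] by (simp add: \<delta>_def)
  qed
  have at0: "N (x i) \<le> \<delta>" if "i < n" for i
    using center_dist_coord[OF that, of h] h(2) by (simp add: x(2) N_def torus_proj_def)
  note witness = that
  have finish: thesis if "\<And>k. k < n \<Longrightarrow> N (x k + t * u k) \<le> \<delta>" "i < n" "j < n" "i \<noteq> j"
    "N (x i + t * u i) = \<delta>" "N (x j + t * u j) = \<delta>" for t i j
  proof (rule witness[of "x + rscale t u" i j])
    have "center_dist n (torus_proj (x + rscale t u)) \<le> \<delta>"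
      unfolding center_dist_le_iff N_coord using that(1) \<open>0 \<le> \<delta>\<close> by blast
    then show "center_dist n (torus_proj (x + rscale t u)) = dist_half n (annihilator n M)"
      using dist_half_le[OF line(2)[of t], of n] by (simp add: \<delta>_def H_def)
  qed (use that line in \<open>simp_all add: N_coord \<delta>_def H_def\<close>)
  obtain i where i: "i < n" "N (x i) = \<delta>" using opt[of 0] at0 by (auto intro: antisym)
  show thesis
  proof (cases "\<exists>j<n. j \<noteq> i \<and> N (x j) = \<delta>")
    case True
    then show ?thesis using finish[of 0 i] i at0 by auto
  next
    case False
    then have others: "N (x j) < \<delta>" if "j < n" "j \<noteq> i" for j using at0 that by force
    obtain j0 where "j0 < n" "j0 \<noteq> i"
      using \<open>2 \<le> n\<close> by (metis One_nat_def Suc_1 Suc_le_lessD i(1) less_trans nat_neq_iff pos2 zero_less_one)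
    then have "0 < \<delta>" using others circle_norm_nonneg by (metis N_def le_less_trans)
    have "\<delta> < 1/2" using proper by (simp add: \<delta>_def H_def)
    have "u i = 0"
    proof (rule ccontr)
      assume ui: "u i \<noteq> 0"
      obtain e where e: "e > 0" "\<And>j. j \<in> {j. j < n \<and> j \<noteq> i} \<Longrightarrow> e \<le> \<delta> - N (x j)"
        by (rule finite_positive_lower_bound[of "{j. j < n \<and> j \<noteq> i}" "\<lambda>j. \<delta> - N (x j)"])
           (use others in auto)
      define C where "C = 1 + (\<Sum>j<n. \<bar>u j\<bar>)"
      have uC: "\<bar>u j\<bar> < C" if "j < n" for j
        using member_le_sum[of j "{..<n}" "\<lambda>j. \<bar>u j\<bar>"] that by (simp add: C_def)
      have "1 \<le> C" by (simp add: C_def sum_nonneg)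
      \<comment> \<open>Steps of length \<open>\<tau>\<close> keep the other coordinates below \<open>\<delta>\<close>, and one of the two directions moves
        \<open>x i\<close> towards \<open>c\<close>.\<close>
      define \<tau> where "\<tau> = min e \<delta> / C"
      have \<tau>: "0 < \<tau>" "\<tau> * C \<le> e" "\<tau> * C \<le> \<delta>" using \<open>1 \<le> C\<close> e(1) \<open>0 < \<delta>\<close> by (auto simp: \<tau>_def)
      define c where "c = of_int \<lfloor>x i\<rfloor> + (1/2 :: real)"
      have c: "\<bar>x i - c\<bar> = \<delta>" "c - 1/2 \<in> \<int>"
        using i(2) by (simp_all only: N_def half_gap_cell c_def) simp
      have "\<bar>\<tau> * u i\<bar> < \<tau> * C" using \<tau>(1) uC[OF i(1)] by (simp add: abs_mult)
      moreover have "\<tau> * u i \<noteq> 0" using \<tau>(1) ui by simp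
      ultimately have "\<bar>x i + \<tau> * u i - c\<bar> < \<delta> \<or> \<bar>x i + (- \<tau>) * u i - c\<bar> < \<delta>"
        using c(1) \<tau>(3) by linarith
      then obtain t where t: "\<bar>t\<bar> = \<tau>" "\<bar>x i + t * u i - c\<bar> < \<delta>"
        using \<tau>(1) by (metis abs_minus_cancel abs_of_pos)
      then have less_i: "N (x i + t * u i) < \<delta>"
        unfolding N_def using half_gap_le_cell(1)[OF c(2), of "x i + t * u i"] by linarith
      have less_j: "N (x j + t * u j) < \<delta>" if "j < n" "j \<noteq> i" for j
      proof -
        have "to_circle (x j + t * u j) - to_circle (1/2) =
            to_circle (t * u j) + (to_circle (x j) - to_circle (1/2))"
          by (simp add: to_circle_diff to_circle_add algebra_simps)
        then have "N (x j + t * u j) \<le> \<bar>t * u j\<bar> + N (x j)"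
          unfolding N_def using circle_norm_triangle circle_norm_le_abs by (metis add_mono_thms_linordered_semiring(3) order_trans)
        moreover have "\<bar>t * u j\<bar> < \<tau> * C" using \<tau>(1) uC[OF that(1)] t(1) by (simp add: abs_mult)
        ultimately show ?thesis using e(2)[of j] that \<tau>(2) by simp
      qed
      show False using opt[of t] less_i less_j by (metis linorder_not_less)
    qed
    have "\<exists>a. u a \<noteq> 0" using u(2) by (auto simp: fun_eq_iff)
    then obtain a where a: "u a \<noteq> 0" by blast
    have "a < n" using a u_vec by (metis (mono_tags, lifting) linorder_not_less mem_Collect_eq vecs_def)
    have "a \<noteq> i" using a \<open>u i = 0\<close> by blast
    \<comment> \<open>At time \<open>t1\<close> the coordinate \<open>a\<close> is at the worst place \<open>0\<close>. The path \<open>z\<close> masks the tight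
      coordinate \<open>i\<close>, so that the distance along \<open>z\<close> reaches \<open>\<delta>\<close> when another coordinate is tight.\<close>
    define t1 where "t1 = - x a / u a"
    define z where "z = (\<lambda>s. (torus_proj (x + rscale (s * t1) u))(i := to_circle (1/2)))"
    have z_coord: "half_gap (z s k) = (if k = i then 0 else N (x k + s * t1 * u k))" for s k
      by (simp add: z_def N_coord)
    have "continuous_on {0..1} z"
    proof (rule continuous_on_coordinatewise_then_product)
      fix k
      have "continuous_on {0..1} (\<lambda>s. to_circle (x k + s * t1 * u k))"
        by (rule continuous_on_compose2[of UNIV to_circle])
           (auto simp: continuous_on_eq_continuous_at isCont_to_circle intro!: continuous_intros)
      then show "continuous_on {0..1} (\<lambda>s. z s k)"
        by (cases "k = i") (simp_all add: z_def torus_proj_def rscale_def)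
    qed
    then have cont: "continuous_on {0..1} (\<lambda>s. center_dist n (z s))"
      by (rule continuous_on_compose2[OF continuous_on_center_dist[of UNIV n]]) simp
    have lo: "center_dist n (z 0) \<le> \<delta>"
      unfolding center_dist_le_iff using others \<open>0 < \<delta>\<close> by (auto simp: z_coord intro: less_imp_le)
    have "N (x a + t1 * u a) = 1/2"
      using a half_gap_eq_iff[of 0] by (simp add: t1_def N_def to_circle_0)
    then have "1/2 \<le> center_dist n (z 1)"
      using center_dist_coord[OF \<open>a < n\<close>, of "z 1"] \<open>a \<noteq> i\<close> by (simp add: z_coord)
    then have hi: "\<delta> \<le> center_dist n (z 1)" using \<open>\<delta> < 1/2\<close> by simp
    obtain s where s: "center_dist n (z s) = \<delta>"
      using IVT'[OF lo hi _ cont] by auto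
    have "0 < n" using i(1) by simp
    then obtain j where j: "j < n" "half_gap (z s j) = \<delta>"
      using center_dist_attained[of n "z s"] s by metis
    then have "j \<noteq> i" using \<open>0 < \<delta>\<close> by (auto simp: z_coord)
    have "N (x k + s * t1 * u k) \<le> \<delta>" if "k < n" for k
      using center_dist_coord[OF that, of "z s"] s \<open>u i = 0\<close> i(2)
      by (cases "k = i") (simp_all add: z_coord)
    moreover have "N (x j + s * t1 * u j) = \<delta>" using j(2) \<open>j \<noteq> i\<close> by (simp add: z_coord)
    moreover have "N (x i + s * t1 * u i) = \<delta>" using i(2) \<open>u i = 0\<close> by simp
    ultimately show ?thesis using finish[of "s * t1" i j] i(1) j(1) \<open>j \<noteq> i\<close> by blast
  qed
qed

section \<open>Limits of values\<close>

text \<open>A diagonal choice of distinct elements along which \<open>g\<close> tends to \<open>0\<close>.\<close>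

lemma infinite_null_family:
  fixes g :: "'a \<Rightarrow> real"
  assumes inf: "\<And>e. e > 0 \<Longrightarrow> infinite {K\<in>P. g K < e}"
  shows "\<exists>S\<subseteq>P. infinite S \<and> (\<forall>e>0. finite {K\<in>S. e \<le> g K})"
proof -
  define Q where "Q = (\<lambda>(f :: nat \<Rightarrow> 'a) j a. a \<in> P \<and> g a < inverse (real (Suc j)) \<and> a \<notin> f ` {..<j})"
  have "\<exists>f. \<forall>j. Q f j (f j)"
  proof (rule dependent_wf_choice[OF wf_less_than])
    fix f h :: "nat \<Rightarrow> 'a" and j r
    assume "\<And>i. (i, j) \<in> less_than \<Longrightarrow> f i = h i"
    then have "f ` {..<j} = h ` {..<j}" by (intro image_cong) auto
    then show "Q f j r = Q h j r" by (simp add: Q_def)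
  next
    fix j :: nat and f :: "nat \<Rightarrow> 'a"
    have "infinite ({K\<in>P. g K < inverse (real (Suc j))} - f ` {..<j})"
      by (intro Diff_infinite_finite inf) auto
    then show "\<exists>r. Q f j r" unfolding Q_def using infinite_imp_nonempty by blast
  qed
  then obtain f where f: "\<And>j. f j \<in> P" "\<And>j. g (f j) < inverse (real (Suc j))" "\<And>j. f j \<notin> f ` {..<j}"
    unfolding Q_def by blast
  have "inj f"
  proof (rule injI)
    fix i j assume "f i = f j"
    then show "i = j" using f(3)[of i] f(3)[of j] by (metis imageI lessThan_iff linorder_neqE_nat)
  qed
  have "finite {K\<in>range f. e \<le> g K}" if "e > 0" for e
  proof -
    obtain j where j: "inverse (real (Suc j)) < e" using reals_Archimedean[OF \<open>e > 0\<close>] by blast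
    have "{K\<in>range f. e \<le> g K} \<subseteq> f ` {..<j}"
    proof
      fix K assume "K \<in> {K\<in>range f. e \<le> g K}"
      then obtain i where i: "K = f i" "e \<le> g (f i)" by blast
      have "i < j"
      proof (rule ccontr)
        assume "\<not> i < j"
        then have "inverse (real (Suc i)) \<le> inverse (real (Suc j))" by (simp add: le_imp_inverse_le)
        then show False using j i(2) f(2)[of i] by linarith
      qed
      then show "K \<in> f ` {..<j}" using i(1) by blast
    qed
    then show ?thesis using finite_subset by blast
  qed
  then show ?thesis using range_inj_infinite[OF \<open>inj f\<close>] f(1) by blast
qed

text \<open>Values inside \<open>H\<close> are at least that of \<open>H\<close>, and almost equal to it for nearly dense subgroups.\<close>

lemma closed_subgroups_limit:
  assumes "infinite \<K>" "\<K> \<subseteq> closed_subgroups k n"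
  shows "\<exists>d>k. \<exists>H\<in>closed_subgroups d n. infinite {K\<in>\<K>. K \<subseteq> H} \<and>
    (\<forall>K\<in>\<K>. K \<subseteq> H \<longrightarrow> dist_half n H \<le> dist_half n K) \<and>
    (\<forall>e>0. finite {K\<in>\<K>. K \<subseteq> H \<and> dist_half n H + e < dist_half n K}) \<and>
    (\<K> \<subseteq> subtori k n \<longrightarrow> H \<in> subtori d n)"
proof -
  obtain d H where H: "k < d" "H \<in> closed_subgroups d n" "infinite {K\<in>\<K>. K \<subseteq> H}"
    and dense: "\<And>e. e > 0 \<Longrightarrow> finite {K\<in>\<K>. K \<subseteq> H \<and> \<not> (\<forall>x\<in>H. \<exists>h\<in>K. h \<in> nbhd n e x)}"
    by (rule closed_subgroups_accumulate[OF assms]) (rule that, assumption, assumption, assumption, blast)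
  note HD = closed_subgroupsD[OF H(2)]
  have "finite {K\<in>\<K>. K \<subseteq> H \<and> dist_half n H + e < dist_half n K}" if "e > 0" for e
  proof (rule finite_subset[OF _ dense[OF \<open>e > 0\<close>]], rule subsetI)
    fix K assume K: "K \<in> {K\<in>\<K>. K \<subseteq> H \<and> dist_half n H + e < dist_half n K}"
    obtain x where x: "x \<in> H" "center_dist n x = dist_half n H"
      using dist_half_attained[OF HD(4)] HD(7) by blast
    have "\<not> (\<exists>h\<in>K. h \<in> nbhd n e x)"
    proof
      assume "\<exists>h\<in>K. h \<in> nbhd n e x"
      then obtain h where h: "h \<in> K" "h \<in> nbhd n e x" by blast
      have "dist_half n K \<le> center_dist n h" by (rule dist_half_le[OF h(1)])
      also have "\<dots> \<le> dist_half n H + e" using center_dist_nbhd[OF h(2) \<open>e > 0\<close>] x(2) by simp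
      finally show False using K by simp
    qed
    then show "K \<in> {K\<in>\<K>. K \<subseteq> H \<and> \<not> (\<forall>x\<in>H. \<exists>h\<in>K. h \<in> nbhd n e x)}" using K x(1) by blast
  qed
  moreover have "dist_half n H \<le> dist_half n K" if "K \<in> \<K>" "K \<subseteq> H" for K
  proof -
    have "0 \<in> K" using that(1) assms(2) closed_subgroupsD(7) by blast
    then show ?thesis using that(2) by (intro dist_half_antimono) auto
  qed
  moreover have "H \<in> subtori d n" if "\<K> \<subseteq> subtori k n"
    by (rule subtori_accumulate[OF that H(2,3) dense])
  ultimately show ?thesis using H by blast
qed

text \<open>The approximating values lie above the limit value because the approximating groups lie inside
  the limit group.\<close>

lemma no_lower_acc_point:
  assumes P: "P \<subseteq> closed_subgroups k n"
  shows "\<not> lower_acc_point (dist_half n ` P) x"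
proof
  assume lower: "lower_acc_point (dist_half n ` P) x"
  define P' where "P' = {K\<in>P. dist_half n K < x}"
  have "infinite {K\<in>P'. x - dist_half n K < e}" if "e > 0" for e
  proof
    assume "finite {K\<in>P'. x - dist_half n K < e}"
    then obtain e0 where e0: "e0 > 0" "\<And>K. K \<in> {K\<in>P'. x - dist_half n K < e} \<Longrightarrow> e0 \<le> x - dist_half n K"
      by (rule finite_positive_lower_bound[of _ "\<lambda>K. x - dist_half n K"]) (auto simp: P'_def)
    define e' where "e' = min e0 e"
    have "e' > 0" using e0(1) \<open>e > 0\<close> by (simp add: e'_def)
    then obtain K where "K \<in> P" "x - e' < dist_half n K" "dist_half n K < x"
      using lower unfolding lower_acc_point_def by fastforce
    moreover from this have "K \<in> {K\<in>P'. x - dist_half n K < e}" by (simp add: P'_def e'_def)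
    ultimately show False using e0(2)[of K] by (simp add: e'_def)
  qed
  then obtain S where S: "infinite S" "S \<subseteq> P'" "\<And>e. e > 0 \<Longrightarrow> finite {K\<in>S. e \<le> x - dist_half n K}"
    using infinite_null_family[of P' "\<lambda>K. x - dist_half n K"] by blast
  have "S \<subseteq> closed_subgroups k n" using S(2) P by (auto simp: P'_def)
  then obtain H where H: "infinite {K\<in>S. K \<subseteq> H}"
    "\<And>K. K \<in> S \<Longrightarrow> K \<subseteq> H \<Longrightarrow> dist_half n H \<le> dist_half n K"
    "\<And>e. e > 0 \<Longrightarrow> finite {K\<in>S. K \<subseteq> H \<and> dist_half n H + e < dist_half n K}"
    using closed_subgroups_limit[OF S(1), of k n] by blast
  obtain K where "K \<in> S" "K \<subseteq> H" using infinite_imp_nonempty[OF H(1)] by blast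
  then have "dist_half n H < x" using H(2) S(2) by (fastforce simp: P'_def)
  define e where "e = (x - dist_half n H) / 2"
  have "e > 0" using \<open>dist_half n H < x\<close> by (simp add: e_def)
  have "{K\<in>S. K \<subseteq> H} \<subseteq> {K\<in>S. e \<le> x - dist_half n K} \<union> {K\<in>S. K \<subseteq> H \<and> dist_half n H + e < dist_half n K}"
    by (auto simp: e_def field_simps)
  then have "finite {K\<in>S. K \<subseteq> H}" using S(3) H(3) \<open>e > 0\<close> by (meson finite_UnI finite_subset)
  then show False using H(1) by blast
qed

lemma limit_value:
  assumes P: "P \<subseteq> closed_subgroups k n" and inf: "\<And>e. e > 0 \<Longrightarrow> infinite {K\<in>P. \<bar>dist_half n K - x\<bar> < e}"
  shows "\<exists>d>k. \<exists>H\<in>closed_subgroups d n. dist_half n H = x \<and> (\<exists>K\<in>P. K \<subseteq> H) \<and>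
    (P \<subseteq> subtori k n \<longrightarrow> H \<in> subtori d n)"
proof -
  obtain S where S: "infinite S" "S \<subseteq> P" "\<And>e. e > 0 \<Longrightarrow> finite {K\<in>S. e \<le> \<bar>dist_half n K - x\<bar>}"
    using infinite_null_family[OF inf] by blast
  then have "S \<subseteq> closed_subgroups k n" using P by blast
  then obtain d H where H: "k < d" "H \<in> closed_subgroups d n" "infinite {K\<in>S. K \<subseteq> H}"
    "\<And>K. K \<in> S \<Longrightarrow> K \<subseteq> H \<Longrightarrow> dist_half n H \<le> dist_half n K"
    "\<And>e. e > 0 \<Longrightarrow> finite {K\<in>S. K \<subseteq> H \<and> dist_half n H + e < dist_half n K}"
    and tori: "S \<subseteq> subtori k n \<Longrightarrow> H \<in> subtori d n"
    using closed_subgroups_limit[OF S(1), of k n] by blast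
  have close: "\<bar>dist_half n H - x\<bar> \<le> 2 * e" if "e > 0" for e
  proof -
    have "infinite ({K\<in>S. K \<subseteq> H} -
        ({K\<in>S. e \<le> \<bar>dist_half n K - x\<bar>} \<union> {K\<in>S. K \<subseteq> H \<and> dist_half n H + e < dist_half n K}))"
      using S(3)[OF \<open>e > 0\<close>] H(5)[OF \<open>e > 0\<close>] H(3) by (intro Diff_infinite_finite) auto
    from infinite_imp_nonempty[OF this] obtain K where K: "K \<in> S" "K \<subseteq> H"
      "\<not> e \<le> \<bar>dist_half n K - x\<bar>" "\<not> dist_half n H + e < dist_half n K" by blast
    then show ?thesis using H(4)[OF K(1,2)] by linarith
  qed
  have "dist_half n H = x"
  proof (rule ccontr)
    assume "dist_half n H \<noteq> x"
    then show False using close[of "\<bar>dist_half n H - x\<bar> / 4"] by simp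
  qed
  moreover obtain K where "K \<in> S" "K \<subseteq> H" using infinite_imp_nonempty[OF H(3)] by blast
  moreover have "H \<in> subtori d n" if "P \<subseteq> subtori k n" by (rule tori[OF subset_trans[OF S(2) that]])
  ultimately show ?thesis using H(1,2) S(2) by blast
qed

lemma infinite_near_acc_point:
  assumes "x \<in> acc_points (f ` P)" "e > 0"
  shows "infinite {K\<in>P. \<bar>f K - x\<bar> < e}"
proof
  assume fin: "finite {K\<in>P. \<bar>f K - x\<bar> < e}"
  have "infinite (f ` P \<inter> ball x e)"
    using assms islimpt_eq_infinite_ball by (auto simp: acc_points_def)
  moreover have "f ` P \<inter> ball x e \<subseteq> f ` {K\<in>P. \<bar>f K - x\<bar> < e}"
    by (auto simp: dist_real_def abs_minus_commute)
  ultimately show False using fin finite_surj by blast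
qed

lemma ecard_eq_0_iff: "ecard A = 0 \<longleftrightarrow> A = {}"
  by (auto simp: ecard_def zero_enat_def)

lemma ecard_eq_infinity_iff: "ecard A = \<infinity> \<longleftrightarrow> infinite A"
  by (simp add: ecard_def)

lemma density_points_ecard:
  "density_points (\<lambda>x. ecard {K\<in>P. f K = x}) = acc_points (f ` P) \<union> {x. infinite {K\<in>P. f K = x}}"
proof -
  have "{x. ecard {K\<in>P. f K = x} \<noteq> 0} = f ` P" by (auto simp: ecard_eq_0_iff)
  then show ?thesis by (simp add: density_points_def ecard_eq_infinity_iff)
qed

lemma infinite_near_density_point:
  assumes "x \<in> density_points (\<lambda>x. ecard {K\<in>P. f K = x})" "e > 0"
  shows "infinite {K\<in>P. \<bar>f K - x\<bar> < e}"
proof (cases "x \<in> acc_points (f ` P)")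
  case True
  then show ?thesis using infinite_near_acc_point assms(2) by blast
next
  case False
  then have "infinite {K\<in>P. f K = x}" using assms(1) density_points_ecard[of P f] by blast
  moreover have "{K\<in>P. f K = x} \<subseteq> {K\<in>P. \<bar>f K - x\<bar> < e}" using assms(2) by auto
  ultimately show ?thesis using finite_subset by blast
qed

section \<open>Values of infinite multiplicity\<close>

lemma proper_subgroups_iff:
  "H \<in> proper_subgroups k n \<longleftrightarrow> H \<in> closed_subgroups k n \<and> dist_half n H < 1/2"
  unfolding proper_subgroups_def
  using proper_iff_dist_half[of H n] closed_subgroupsD(4,7)[of H k n] by auto

lemma proper_subtori_iff:
  "H \<in> proper_subtori k n \<longleftrightarrow> H \<in> subtori k n \<and> dist_half n H < 1/2"
  using proper_subgroups_iff[of H k n] subtori_subset_closed_subgroups[of k n]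
  unfolding proper_subgroups_def proper_subtori_def by blast

lemma proper_subtori_subset: "proper_subtori k n \<subseteq> proper_subgroups k n"
  using subtori_subset_closed_subgroups[of k n] unfolding proper_subgroups_def proper_subtori_def by blast

definition torsion :: "nat \<Rightarrow> nat \<Rightarrow> (nat \<Rightarrow> circle) set \<Rightarrow> (nat \<Rightarrow> circle) set"
  where "torsion n N H = H \<inter> torus_proj ` {q \<in> vecs n. rscale (real N) q \<in> int_vecs n}"

lemma finite_torsion:
  assumes "N > 0"
  shows "finite (torsion n N H)"
proof -
  have "torsion n N H \<subseteq> (\<lambda>m. torus_proj (rscale (1 / real N) m)) ` {m \<in> int_vecs n. \<forall>i. \<bar>m i\<bar> \<le> real N}"
  proof
    fix h assume "h \<in> torsion n N H"
    then obtain q where q: "q \<in> vecs n" "rscale (real N) q \<in> int_vecs n" "h = torus_proj q"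
      by (auto simp: torsion_def)
    define m where "m = (\<lambda>i. real N * frac (q i))"
    have m_eq: "m i = (rscale (real N) q) i - real N * of_int \<lfloor>q i\<rfloor>" for i
      by (simp add: m_def rscale_def frac_def right_diff_distrib)
    have "m \<in> int_vecs n"
      using q(1,2) by (auto simp: int_vecs_def m_eq vecs_def rscale_def)
    moreover have "\<bar>m i\<bar> \<le> real N" for i
      using frac_ge_0[of "q i"] frac_lt_1[of "q i"] by (simp add: m_def mult_left_le abs_mult)
    moreover have "h = torus_proj (rscale (1 / real N) m)"
      using assms by (simp add: q(3) torus_proj_def rscale_def m_def to_circle_eq_iff fun_eq_iff frac_def)
    ultimately show "h \<in> (\<lambda>m. torus_proj (rscale (1 / real N) m)) ` {m \<in> int_vecs n. \<forall>i. \<bar>m i\<bar> \<le> real N}"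
      by blast
  qed
  then show ?thesis using finite_bounded_int_vecs finite_surj by blast
qed

lemma torsion_group:
  assumes "subgroup H (torus n)"
  shows "0 \<in> torsion n N H" "f \<in> torsion n N H \<Longrightarrow> g \<in> torsion n N H \<Longrightarrow> f + g \<in> torsion n N H"
    "f \<in> torsion n N H \<Longrightarrow> - f \<in> torsion n N H"
proof -
  have H: "0 \<in> H" "\<And>x y. x \<in> H \<Longrightarrow> y \<in> H \<Longrightarrow> x + y \<in> H" "\<And>x. x \<in> H \<Longrightarrow> - x \<in> H"
    using assms unfolding subgroup_torus_iff by blast+
  have "torus_proj 0 \<in> torus_proj ` {q \<in> vecs n. rscale (real N) q \<in> int_vecs n}"
    by (intro imageI) (simp add: int_vecs_def rscale_def vecs_def)
  then show "0 \<in> torsion n N H" using H(1) by (simp add: torsion_def)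
  show "f + g \<in> torsion n N H" if fg: "f \<in> torsion n N H" "g \<in> torsion n N H"
  proof -
    obtain p q where p: "p \<in> vecs n" "rscale (real N) p \<in> int_vecs n" "f = torus_proj p"
      and q: "q \<in> vecs n" "rscale (real N) q \<in> int_vecs n" "g = torus_proj q"
      using fg by (auto simp: torsion_def)
    have "rscale (real N) (p + q) \<in> int_vecs n"
      using int_vecs_add[OF p(2) q(2)] by (simp only: rvec.scale_right_distrib)
    then have "torus_proj (p + q) \<in> torus_proj ` {q \<in> vecs n. rscale (real N) q \<in> int_vecs n}"
      using p(1) q(1) by (intro imageI CollectI conjI vecs_add)
    then show ?thesis using fg H(2) by (simp add: torsion_def torus_proj_add p(3) q(3))
  qed
  show "- f \<in> torsion n N H" if f: "f \<in> torsion n N H"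
  proof -
    obtain p where p: "p \<in> vecs n" "rscale (real N) p \<in> int_vecs n" "f = torus_proj p"
      using f by (auto simp: torsion_def)
    have "rscale (real N) (- p) \<in> int_vecs n"
      using int_vecs_rscale[OF p(2), of "-1"] by (simp add: rscale_def fun_Compl_def)
    then have "torus_proj (- p) \<in> torus_proj ` {q \<in> vecs n. rscale (real N) q \<in> int_vecs n}"
      using p(1) by (intro imageI CollectI conjI vecs_minus)
    then show ?thesis using f H(3) by (simp add: torsion_def torus_proj_minus p(3))
  qed
qed

lemma subtorus_plus_torsion:
  assumes H: "H \<in> closed_subgroups d n" and W: "rational_subspace n W" "W \<subseteq> tangent n H" and "N > 0"
  defines "K \<equiv> {t + f | t f. t \<in> torus_proj ` W \<and> f \<in> torsion n N H}"
  shows "K \<in> closed_subgroups (rvec.dim W) n" "tangent n K = W" "K \<subseteq> H" "torsion n N H \<subseteq> K"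
proof -
  note HD = closed_subgroupsD[OF H]
  have "torsion n N H \<subseteq> vecs n" using HD(6) by (auto simp: torsion_def)
  then show "K \<in> closed_subgroups (rvec.dim W) n" "tangent n K = W"
    unfolding K_def tangent_def
    using subtorus_plus_finite[OF W(1) finite_torsion[OF \<open>N > 0\<close>] _ torsion_group[OF HD(3)]] by blast+
  show "K \<subseteq> H"
  proof
    fix x assume "x \<in> K"
    then obtain t f where "x = t + f" "t \<in> torus_proj ` W" "f \<in> torsion n N H" by (auto simp: K_def)
    moreover from this have "t \<in> H" "f \<in> H" using W(2) HD(5) by (auto simp: torsion_def)
    ultimately show "x \<in> H" using HD(3) unfolding subgroup_torus_iff by blast
  qed
  show "torsion n N H \<subseteq> K"
  proof
    fix f assume "f \<in> torsion n N H"
    moreover have "torus_proj 0 \<in> torus_proj ` W"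
      by (rule imageI[OF rvec.subspace_0[OF rational_subspaceD(1)[OF W(1)]]])
    ultimately have "torus_proj 0 + f \<in> K" unfolding K_def by blast
    then show "f \<in> K" by simp
  qed
qed

lemma rational_torsion_point:
  assumes "y \<in> vecs n" "\<And>i. y i \<in> \<rat>"
  obtains N :: nat where "N > 0" "rscale (real N) y \<in> int_vecs n"
proof -
  obtain N :: nat where N: "N > 0" "\<And>i. i < n \<Longrightarrow> real N * y i \<in> \<int>"
    by (rule common_denominator[of n y]) (use assms in auto)
  have "real N * y i \<in> \<int>" for i using N(2)[of i] assms(1) by (cases "i < n") (auto simp: vecs_def)
  then have "rscale (real N) y \<in> int_vecs n"
    using vecs_rscale[OF assms(1)] unfolding int_vecs_def by (simp add: rscale_def)
  then show ?thesis using that N(1) by blast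
qed

lemma rational_optimum_exists:
  assumes "H \<in> closed_subgroups k n"
  shows "\<exists>y\<in>vecs n. (\<forall>i. y i \<in> \<rat>) \<and> torus_proj y \<in> H \<and> center_dist n (torus_proj y) = dist_half n H"
proof -
  note HD = closed_subgroupsD[OF assms]
  obtain h where h: "h \<in> H" "center_dist n h = dist_half n H"
    using dist_half_attained[OF HD(4)] HD(7) by blast
  have "h \<in> vecs n" using h(1) HD(6) by blast
  then obtain x where x: "x \<in> vecs n" "h = torus_proj x" by (rule torus_proj_cases)
  have "torus_proj x \<in> annihilator n (chars n H)" using h(1) x(2) HD(2) by simp
  moreover have "center_dist n (torus_proj x) = dist_half n (annihilator n (chars n H))"
    using h(2) x(2) HD(2) by simp
  ultimately obtain y where "y \<in> vecs n" "\<And>i. y i \<in> \<rat>" "torus_proj y \<in> annihilator n (chars n H)"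
    "center_dist n (torus_proj y) = dist_half n (annihilator n (chars n H))"
    by (rule rational_optimum[OF chars_int[of n H] x(1)]) (rule that, assumption, blast, assumption, assumption)
  then show ?thesis using HD(2) by auto
qed

lemma dist_half_eqI:
  assumes "K \<subseteq> H" "x \<in> K" "center_dist n x = dist_half n H"
  shows "dist_half n K = dist_half n H"
proof (rule antisym)
  show "dist_half n K \<le> dist_half n H" using dist_half_le[OF assms(2), of n] assms(3) by simp
  show "dist_half n H \<le> dist_half n K" using assms(1,2) by (intro dist_half_antimono) auto
qed

text \<open>Below a group of dimension \<open>k + 1\<close> with a torsion optimal point there are infinitely many groups
  of dimension \<open>k\<close> through that point: a fixed subtorus with ever larger torsion groups added.\<close>

lemma subgroup_spectrum_infinite_multiplicity:
  assumes "x \<in> subgroup_spectrum (Suc k) n"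
  shows "infinite {K \<in> proper_subgroups k n. dist_half n K = x}"
proof
  assume fin: "finite {K \<in> proper_subgroups k n. dist_half n K = x}"
  obtain H where H: "H \<in> closed_subgroups (Suc k) n" "dist_half n H < 1/2" "dist_half n H = x"
    using assms by (auto simp: subgroup_spectrum_def proper_subgroups_iff)
  note HD = closed_subgroupsD[OF H(1)]
  obtain y where y: "y \<in> vecs n" "\<And>i. y i \<in> \<rat>" "torus_proj y \<in> H"
    "center_dist n (torus_proj y) = dist_half n H"
    using rational_optimum_exists[OF H(1)] by blast
  obtain N :: nat where N: "N > 0" "rscale (real N) y \<in> int_vecs n"
    using rational_torsion_point[OF y(1,2)] by blast
  obtain B where B: "B \<subseteq> int_vecs n" "rvec.independent B" "tangent n H = rvec.span B" "finite B" "card B = Suc k"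
    using rational_subspace_basis[OF rational_tangent] HD(1) by metis
  obtain u where u: "u \<in> B" using B(5) by fastforce
  define W where "W = rvec.span (B - {u})"
  have W: "rational_subspace n W" "W \<subseteq> tangent n H" "rvec.dim W = k"
  proof -
    show "rational_subspace n W" unfolding rational_subspace_def W_def using B(1) by blast
    show "W \<subseteq> tangent n H" unfolding W_def B(3) by (rule rvec.span_mono) blast
    have "rvec.independent (B - {u})" using B(2) rvec.independent_mono by blast
    then have "rvec.dim W = card (B - {u})" unfolding W_def by (rule rvec.dim_span_eq_card_independent)
    then show "rvec.dim W = k" using B(4,5) u by simp
  qed
  have "u \<notin> W" using B(2) u unfolding W_def rvec.dependent_def by blast
  have u_tan: "u \<in> tangent n H" unfolding B(3) using u by (rule rvec.span_base)
  have u_vec: "u \<in> int_vecs n" "u \<in> vecs n" using u B(1) int_vecs_subset_vecs by auto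
  define K where "K = (\<lambda>j. {t + f | t f. t \<in> torus_proj ` W \<and> f \<in> torsion n (N * Suc j) H})"
  have K: "K j \<in> closed_subgroups k n" "tangent n (K j) = W" "K j \<subseteq> H" "torsion n (N * Suc j) H \<subseteq> K j" for j
    using subtorus_plus_torsion[OF H(1) W(1,2), of "N * Suc j"] N(1) W(3) unfolding K_def by auto
  have yK: "torus_proj y \<in> K j" for j
  proof -
    have "rscale (real (N * Suc j)) y = rscale (real (Suc j)) (rscale (real N) y)"
      by (simp add: rscale_def fun_eq_iff algebra_simps)
    also have "\<dots> \<in> int_vecs n" by (rule int_vecs_rscale[OF N(2)]) simp
    finally have "torus_proj y \<in> torsion n (N * Suc j) H" using y(1,3) by (auto simp: torsion_def)
    then show ?thesis using K(4) by blast
  qed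
  define v where "v = (\<lambda>j. rscale (1 / real (N * Suc j)) u)"
  have v: "v j \<in> vecs n" for j unfolding v_def by (rule vecs_rscale[OF u_vec(2)])
  have vu: "rscale (real (N * Suc j)) (v j) = u" for j
    using N(1) by (simp add: v_def rscale_def del: of_nat_Suc of_nat_mult)
  have uK: "torus_proj (v j) \<in> K j" for j
  proof -
    have "v j \<in> tangent n H"
      unfolding v_def by (rule rvec.subspace_scale[OF subspace_tangent u_tan])
    then have "torus_proj (v j) \<in> H" using HD(5) by blast
    moreover have "v j \<in> {q \<in> vecs n. rscale (real (N * Suc j)) q \<in> int_vecs n}"
      using v[of j] u_vec(1) unfolding mem_Collect_eq vu by blast
    ultimately have "torus_proj (v j) \<in> torsion n (N * Suc j) H"
      unfolding torsion_def by blast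
    then show ?thesis using K(4) by blast
  qed
  have "dist_half n (K j) = x" for j
    using dist_half_eqI[OF K(3) yK y(4)] H(3) by simp
  then have "range K \<subseteq> {K \<in> proper_subgroups k n. dist_half n K = x}"
    using K(1) H(2,3) by (auto simp: proper_subgroups_iff)
  then have "finite (range K)" using fin finite_subset by blast
  then obtain j0 where inf: "infinite {j. K j = K j0}"
    using pigeonhole_infinite[of UNIV K] by auto
  \<comment> \<open>If infinitely many \<open>K j\<close> agree, this group contains the images of arbitrarily small multiples of
    \<open>u\<close>, so \<open>u\<close> is tangent to it.\<close>
  obtain e where e0: "e > 0" "\<And>v. v \<in> vecs n \<Longrightarrow> torus_proj v \<in> annihilator n (chars n (K j0)) \<Longrightarrow>
    (\<And>i. i < n \<Longrightarrow> \<bar>v i\<bar> < e) \<Longrightarrow> v \<in> orth n (chars n (K j0))"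
    by (rule annihilator_near_0[OF chars_int[of n "K j0"]]) (rule that, assumption, blast)
  have e: "e > 0" "\<And>v. v \<in> vecs n \<Longrightarrow> torus_proj v \<in> K j0 \<Longrightarrow>
    (\<And>i. i < n \<Longrightarrow> \<bar>v i\<bar> < e) \<Longrightarrow> v \<in> tangent n (K j0)"
    using e0 closed_subgroupsD(2)[OF K(1)[of j0]] unfolding tangent_def by simp_all
  define C where "C = 1 + (\<Sum>i<n. \<bar>u i\<bar>)"
  have "1 \<le> C" by (simp add: C_def sum_nonneg)
  obtain J :: nat where J: "C / e < real J" using reals_Archimedean2 by blast
  obtain j where j: "J < j" "K j = K j0" using inf unfolding infinite_nat_iff_unbounded by blast
  have "v j \<in> tangent n (K j0)"
  proof (rule e(2))
    show "v j \<in> vecs n" by (rule v)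
    show "torus_proj (v j) \<in> K j0" using uK[of j] by (simp only: j(2))
    fix i assume "i < n"
    have "\<bar>u i\<bar> \<le> (\<Sum>i<n. \<bar>u i\<bar>)" using \<open>i < n\<close> by (intro member_le_sum) auto
    then have "\<bar>u i\<bar> < C" by (simp add: C_def)
    also have "C < e * real J" using J e(1) by (simp add: field_simps)
    also have "\<dots> \<le> e * real (N * Suc j)"
    proof -
      have "J \<le> 1 * Suc j" using j(1) by simp
      also have "\<dots> \<le> N * Suc j" using N(1) by (intro mult_right_mono) auto
      finally show ?thesis using e(1) by (simp only: mult_le_cancel_left_pos of_nat_le_iff)
    qed
    finally have "\<bar>u i\<bar> < e * real (N * Suc j)" .
    moreover have "0 < real (N * Suc j)" unfolding of_nat_0_less_iff using N(1) by simp
    moreover obtain D where D: "D = real (N * Suc j)" by blast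
    ultimately have "\<bar>u i\<bar> < e * D" "0 < D" by (simp_all only: D)
    then show "\<bar>v j i\<bar> < e"
      unfolding v_def D[symmetric] by (simp add: rscale_def abs_mult field_simps)
  qed
  then have "rscale (real (N * Suc j)) (v j) \<in> W"
    using K(2)[of j0] rvec.subspace_scale[OF subspace_tangent] by metis
  then show False using \<open>u \<notin> W\<close> by (simp only: vu)
qed

text \<open>For subtori, the infinitely many subtori through a rational point \<open>y\<close> of \<open>W\<close> are obtained by
  changing \<open>y\<close> by integer vectors \<open>j u\<close>, which does not move its image in the torus.\<close>

lemma subtorus_spectrum_infinite_multiplicity:
  assumes "x \<in> subtorus_spectrum (Suc k) n" "1 \<le> k"
  shows "infinite {K \<in> proper_subtori k n. dist_half n K = x}"
proof -
  obtain T where T: "T \<in> subtori (Suc k) n" "dist_half n T < 1/2" "dist_half n T = x"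
    using assms by (auto simp: subtorus_spectrum_def proper_subtori_iff)
  obtain W where W: "T = torus_proj ` W" "rational_subspace n W" "rvec.dim W = Suc k"
    using T(1) by (auto simp: subtori_eq)
  note subW = rational_subspaceD[OF W(2)]
  have Tc: "T \<in> closed_subgroups (Suc k) n" using T(1) subtori_subset_closed_subgroups by blast
  obtain y0 where y0: "y0 \<in> vecs n" "\<And>i. y0 i \<in> \<rat>" "torus_proj y0 \<in> T"
    "center_dist n (torus_proj y0) = dist_half n T"
    using rational_optimum_exists[OF Tc] by blast
  obtain y where y: "y \<in> W" "torus_proj y = torus_proj y0" using y0(3) W(1) by auto
  have y_vec: "y \<in> vecs n" using y(1) subW(2) by blast
  then have "y - y0 \<in> int_vecs n" using torus_proj_eq_iff y0(1) y(2) by blast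
  then have "y i - y0 i \<in> \<int>" for i by (simp add: int_vecs_def)
  then have "y i - y0 i \<in> \<rat>" for i by (meson Ints_subset_Rats subsetD)
  then have y_rat: "y i \<in> \<rat>" for i using Rats_add[OF _ y0(2)] by (metis diff_add_cancel)
  have y_opt: "center_dist n (torus_proj y) = dist_half n T" using y0(4) y(2) by simp
  obtain w where "w \<in> W" "w \<noteq> 0" by (rule dim_pos_nonzero[OF W(3)])
  then have "n > 0" using subW(2) by (cases n) (auto simp: vecs_def fun_eq_iff)
  have "y \<noteq> 0"
  proof
    assume "y = 0"
    then have "half_gap (torus_proj y 0) = 1/2"
      using half_gap_eq_iff[of 0] by simp
    then show False using center_dist_coord[OF \<open>n > 0\<close>, of "torus_proj y"] y_opt T(2) by simp
  qed
  obtain N :: nat where N: "N > 0" "rscale (real N) y \<in> int_vecs n"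
    using rational_torsion_point[OF y_vec y_rat] by blast
  define b where "b = rscale (real N) y"
  have "b \<noteq> 0" using \<open>y \<noteq> 0\<close> N(1) by (simp add: b_def)
  have bW: "b \<in> int_vecs n \<inter> W" unfolding b_def using N(2) y(1) rvec.subspace_scale[OF subW(1)] by blast
  obtain C where C: "{b} \<subseteq> C" "C \<subseteq> int_vecs n \<inter> W" "rvec.independent C" "int_vecs n \<inter> W \<subseteq> rvec.span C"
    using rvec.maximal_independent_subset_extend[of "{b}" "int_vecs n \<inter> W"] bW \<open>b \<noteq> 0\<close> by auto
  have "W \<subseteq> rvec.span C"
  proof -
    obtain B where B: "B \<subseteq> int_vecs n" "W = rvec.span B" using W(2) by (auto simp: rational_subspace_def)
    then have "B \<subseteq> rvec.span C" using C(4) rvec.span_superset[of B] by blast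
    then show ?thesis unfolding B(2) by (rule rvec.span_minimal[OF _ rvec.subspace_span])
  qed
  then have "card C = Suc k" using rvec.basis_card_eq_dim[of C W] C W(3) by auto
  then have "finite C" by (metis card.infinite nat.distinct(1))
  have "card (C - {b}) = k" using C(1) \<open>card C = Suc k\<close> \<open>finite C\<close> by simp
  then obtain u where u: "u \<in> C" "u \<noteq> b" using assms(2) by (metis Diff_iff all_not_in_conv card.empty insertI1 not_one_le_zero)
  have u_vec: "u \<in> int_vecs n" "u \<in> W" using u(1) C(2) by auto
  define R where "R = C - {b, u}"
  have "card R = k - 1"
  proof -
    have "R = C - {b} - {u}" by (auto simp: R_def)
    then show ?thesis using \<open>card (C - {b}) = k\<close> u by (simp add: card_Diff_singleton)
  qed
  have "finite R" using \<open>finite C\<close> by (simp add: R_def)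
  have RW: "R \<subseteq> int_vecs n \<inter> W" using C(2) by (auto simp: R_def)
  \<comment> \<open>\<open>v j\<close> is a multiple of \<open>y + j u\<close>.\<close>
  define v where "v = (\<lambda>j :: nat. b + rscale (real (N * j)) u)"
  define V where "V = (\<lambda>j. rvec.span (insert (v j) R))"
  have v_vec: "v j \<in> int_vecs n \<inter> W" for j
  proof -
    have "rscale (real (N * j)) u \<in> int_vecs n" by (rule int_vecs_rscale[OF u_vec(1)]) simp
    moreover have "rscale (real (N * j)) u \<in> W" by (rule rvec.subspace_scale[OF subW(1) u_vec(2)])
    ultimately show ?thesis
      unfolding v_def using bW int_vecs_add rvec.subspace_add[OF subW(1)] by blast
  qed
  have V_rat: "rational_subspace n (V j)" for j
    unfolding rational_subspace_def
  proof (intro exI conjI)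
    show "insert (v j) R \<subseteq> int_vecs n" using v_vec[of j] RW by blast
  qed (simp add: V_def)
  have V_W: "V j \<subseteq> W" for j
    unfolding V_def using v_vec RW by (intro rvec.span_minimal subW) auto
  have "v j \<notin> rvec.span R" for j
  proof
    assume v: "v j \<in> rvec.span R"
    have "rvec.span R \<subseteq> rvec.span (C - {b})" by (rule rvec.span_mono) (auto simp: R_def)
    then have "v j \<in> rvec.span (C - {b})" using v by blast
    moreover have "rscale (real (N * j)) u \<in> rvec.span (C - {b})"
      using u by (intro rvec.span_scale rvec.span_base) auto
    ultimately have "v j - rscale (real (N * j)) u \<in> rvec.span (C - {b})" by (rule rvec.span_diff)
    then have "b \<in> rvec.span (C - {b})" by (simp add: v_def)
    then show False using C(1,3) unfolding rvec.dependent_def by blast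
  qed
  note v_span = this
  have V_dim: "rvec.dim (V j) = k" for j
  proof -
    have "rvec.independent R" using C(3) rvec.independent_mono[of C R] by (auto simp: R_def)
    then have "rvec.independent (insert (v j) R)" using v_span by (intro rvec.independent_insertI)
    then have "rvec.dim (V j) = card (insert (v j) R)" unfolding V_def by (rule rvec.dim_span_eq_card_independent)
    also have "\<dots> = k"
      using v_span[of j] rvec.span_superset[of R] \<open>finite R\<close> \<open>card R = k - 1\<close> assms(2)
      by (subst card_insert_disjoint) auto
    finally show ?thesis .
  qed
  have inj: "inj (\<lambda>j. torus_proj ` V j)"
  proof (rule injI, rule ccontr)
    fix i j assume eq: "torus_proj ` V i = torus_proj ` V j" and "i \<noteq> j"
    have "V i = V j"
      using torus_proj_subspace_inj[OF rational_subspaceD[OF V_rat] rational_subspaceD[OF V_rat]] eq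
      by (metis order_refl subset_antisym)
    have subV: "rvec.subspace (V i)" by (rule rational_subspaceD[OF V_rat])
    have vi: "v i \<in> V i" "v j \<in> V i"
      using \<open>V i = V j\<close> unfolding V_def by (metis insertI1 rvec.span_base)+
    define c where "c = real (N * i) - real (N * j)"
    have "c \<noteq> 0" using N(1) \<open>i \<noteq> j\<close> by (simp add: c_def)
    have "v i - v j = rscale c u" by (simp add: v_def c_def rvec.scale_left_diff_distrib)
    then have "rscale c u \<in> V i" using rvec.subspace_diff[OF subV vi] by simp
    then have "rscale (1 / c) (rscale c u) \<in> V i" by (rule rvec.subspace_scale[OF subV])
    then have uV: "u \<in> V i" using \<open>c \<noteq> 0\<close> by (simp add: rscale_def)
    have "b = v i - rscale (real (N * i)) u" by (simp add: v_def)
    then have "b \<in> V i" using vi(1) uV rvec.subspace_diff[OF subV] rvec.subspace_scale[OF subV] by simp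
    moreover have "R \<subseteq> V i" unfolding V_def using rvec.span_superset by blast
    ultimately have "C \<subseteq> V i" using uV by (auto simp: R_def)
    then have "rvec.span C \<subseteq> V i" by (intro rvec.span_minimal subV)
    then have "W \<subseteq> V i" using \<open>W \<subseteq> rvec.span C\<close> by blast
    then have "rvec.dim W \<le> rvec.dim (V i)"
      by (rule dim_mono_vecs(1)[OF _ rational_subspaceD(2)[OF V_rat]])
    then show False using W(3) V_dim by simp
  qed
  have "torus_proj ` V j \<in> {K \<in> proper_subtori k n. dist_half n K = x}" for j
  proof -
    have "rscale (1 / real N) (v j) \<in> V j"
      unfolding V_def by (intro rvec.span_scale rvec.span_base) simp
    moreover have "rscale (1 / real N) (v j) = y + rscale (real j) u"
      using N(1) by (simp add: v_def b_def rscale_def fun_eq_iff field_simps)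
    ultimately have "torus_proj (y + rscale (real j) u) \<in> torus_proj ` V j" by (metis imageI)
    moreover have "rscale (real j) u \<in> int_vecs n" using u_vec by (intro int_vecs_rscale) auto
    ultimately have "torus_proj y \<in> torus_proj ` V j"
      by (simp add: torus_proj_add torus_proj_int_vecs)
    moreover have "torus_proj ` V j \<subseteq> T" unfolding W(1) using V_W by blast
    ultimately have "dist_half n (torus_proj ` V j) = x" using dist_half_eqI y_opt T(3) by blast
    moreover have "torus_proj ` V j \<in> subtori k n" unfolding subtori_eq using V_rat V_dim by blast
    ultimately show ?thesis using T(2,3) by (simp add: proper_subtori_iff)
  qed
  then have "range (\<lambda>j. torus_proj ` V j) \<subseteq> {K \<in> proper_subtori k n. dist_half n K = x}" by blast
  then show ?thesis using range_inj_infinite[OF inj] finite_subset by blast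
qed

lemma spectra_antimono:
  shows "k \<le> d \<Longrightarrow> subgroup_spectrum d n \<subseteq> subgroup_spectrum k n"
    and "1 \<le> k \<Longrightarrow> k \<le> d \<Longrightarrow> subtorus_spectrum d n \<subseteq> subtorus_spectrum k n"
proof -
  have step: "subgroup_spectrum (Suc i) n \<subseteq> subgroup_spectrum i n" for i
  proof
    fix x assume "x \<in> subgroup_spectrum (Suc i) n"
    from infinite_imp_nonempty[OF subgroup_spectrum_infinite_multiplicity[OF this]]
    show "x \<in> subgroup_spectrum i n" by (auto simp: subgroup_spectrum_def)
  qed
  show "subgroup_spectrum d n \<subseteq> subgroup_spectrum k n" if "k \<le> d"
    by (rule lift_Suc_antimono_le[of "\<lambda>i. subgroup_spectrum i n", OF step that])
  have step': "subtorus_spectrum (Suc (Suc i)) n \<subseteq> subtorus_spectrum (Suc i) n" for i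
  proof
    fix x assume "x \<in> subtorus_spectrum (Suc (Suc i)) n"
    from infinite_imp_nonempty[OF subtorus_spectrum_infinite_multiplicity[OF this]]
    show "x \<in> subtorus_spectrum (Suc i) n" by (auto simp: subtorus_spectrum_def)
  qed
  show "subtorus_spectrum d n \<subseteq> subtorus_spectrum k n" if "1 \<le> k" "k \<le> d"
  proof -
    have "k - 1 \<le> d - 1" using that by simp
    from lift_Suc_antimono_le[of "\<lambda>i. subtorus_spectrum (Suc i) n", OF step' this]
    show ?thesis using that by simp
  qed
qed

lemma proper_in_torus_mono: "proper_in_torus n K \<Longrightarrow> K \<subseteq> H \<Longrightarrow> proper_in_torus n H"
  unfolding proper_in_torus_def by blast

lemma limit_of_subgroup_values:
  assumes "\<And>e. e > 0 \<Longrightarrow> infinite {K \<in> proper_subgroups k n. \<bar>dist_half n K - x\<bar> < e}"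
  shows "x \<in> subgroup_spectrum (Suc k) n"
proof -
  have "proper_subgroups k n \<subseteq> closed_subgroups k n" by (auto simp: proper_subgroups_def)
  from limit_value[OF this assms] obtain d H K
    where H: "k < d" "H \<in> closed_subgroups d n" "dist_half n H = x"
    "K \<in> proper_subgroups k n" "K \<subseteq> H" by blast
  have "H \<in> proper_subgroups d n"
    using H(2,4,5) proper_in_torus_mono by (auto simp: proper_subgroups_def)
  then have "x \<in> subgroup_spectrum d n" using H(3) by (auto simp: subgroup_spectrum_def)
  then show ?thesis using spectra_antimono(1)[of "Suc k" d n] H(1) by auto
qed

lemma limit_of_subtorus_values:
  assumes "\<And>e. e > 0 \<Longrightarrow> infinite {K \<in> proper_subtori k n. \<bar>dist_half n K - x\<bar> < e}"
  shows "x \<in> subtorus_spectrum (Suc k) n"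
proof -
  have P: "proper_subtori k n \<subseteq> subtori k n" by (auto simp: proper_subtori_def)
  then have "proper_subtori k n \<subseteq> closed_subgroups k n" using subtori_subset_closed_subgroups by blast
  from limit_value[OF this assms] P obtain d H K where H: "k < d" "dist_half n H = x"
    "K \<in> proper_subtori k n" "K \<subseteq> H" "H \<in> subtori d n" by blast
  have "H \<in> proper_subtori d n"
    using H(3,4,5) proper_in_torus_mono by (auto simp: proper_subtori_def)
  then have "x \<in> subtorus_spectrum d n" using H(2) by (auto simp: subtorus_spectrum_def)
  then show ?thesis using spectra_antimono(2)[of "Suc k" d n] H(1) by auto
qed

section \<open>Adding and removing a coordinate\<close>

lemma vecs_mono: "vecs n \<subseteq> vecs (Suc n)"
  by (auto simp: vecs_def)

lemma dot_Suc_restrict: "m \<in> vecs n \<Longrightarrow> dot (Suc n) m x = dot n m x"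
  by (simp add: dot_def vecs_def)

lemma dot_cong: "(\<And>i. i < n \<Longrightarrow> x i = y i) \<Longrightarrow> dot n m x = dot n m y"
  by (simp add: dot_def)

lemma dim_orth_Suc:
  assumes "M \<subseteq> int_vecs n"
  shows "rvec.dim (orth (Suc n) M) = Suc (rvec.dim (orth n M))"
proof -
  have Mv: "m \<in> vecs n" if "m \<in> M" for m using that assms int_vecs_subset_vecs by blast
  obtain B where B: "B \<subseteq> orth n M" "rvec.independent B" "orth n M \<subseteq> rvec.span B" "card B = rvec.dim (orth n M)"
    using rvec.basis_exists .
  have Bv: "B \<subseteq> vecs n" using B(1) orth_subset_vecs by blast
  have "finite B" by (rule finite_independent_vecs[OF B(2) Bv])
  have "unit_vec n \<notin> vecs n" by (simp add: vecs_def unit_vec_def)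
  then have "unit_vec n \<notin> rvec.span B" using span_subset_vecs[OF Bv] by blast
  then have "unit_vec n \<notin> B" using rvec.span_superset by blast
  have indep: "rvec.independent (insert (unit_vec n) B)"
    by (rule rvec.independent_insertI) fact+
  have "unit_vec n \<in> orth (Suc n) M"
    using unit_vec_int[of n "Suc n"] Mv
    by (auto simp: orth_def int_vecs_def dot_def unit_vec_def vecs_def)
  moreover have "B \<subseteq> orth (Suc n) M"
  proof
    fix b assume "b \<in> B"
    then have "b \<in> vecs n" "\<forall>m\<in>M. dot n m b = 0" using B(1) by (auto simp: orth_def)
    then show "b \<in> orth (Suc n) M" using Mv vecs_mono by (auto simp: orth_def dot_Suc_restrict)
  qed
  ultimately have "insert (unit_vec n) B \<subseteq> orth (Suc n) M" by blast
  moreover have "orth (Suc n) M \<subseteq> rvec.span (insert (unit_vec n) B)"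
  proof
    fix w assume w: "w \<in> orth (Suc n) M"
    define v where "v = w - rscale (w n) (unit_vec n)"
    have "v i = 0" if "n \<le> i" for i
      using w that by (cases "i = n") (auto simp: v_def rscale_def unit_vec_def orth_def vecs_def)
    then have "v \<in> vecs n" by (simp add: vecs_def)
    moreover have "dot n m v = 0" if "m \<in> M" for m
    proof -
      have "dot n m v = dot n m w" by (rule dot_cong) (simp add: v_def rscale_def unit_vec_def)
      then show ?thesis using w that Mv by (simp add: orth_def dot_Suc_restrict)
    qed
    ultimately have "v \<in> orth n M" by (simp add: orth_def)
    then have "w - rscale (w n) (unit_vec n) \<in> rvec.span B" using B(3) unfolding v_def by blast
    then show "w \<in> rvec.span (insert (unit_vec n) B)" unfolding rvec.span_insert by blast
  qed
  ultimately have "card (insert (unit_vec n) B) = rvec.dim (orth (Suc n) M)"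
    using indep by (intro rvec.basis_card_eq_dim)
  then show ?thesis using \<open>finite B\<close> \<open>unit_vec n \<notin> B\<close> B(4) by simp
qed

text \<open>The product of a closed subgroup with a circle is cut out by the same characters.\<close>

lemma dist_half_annihilator_Suc:
  assumes "M \<subseteq> int_vecs n"
  shows "dist_half (Suc n) (annihilator (Suc n) M) = dist_half n (annihilator n M)"
proof (rule antisym)
  have Mv: "m \<in> vecs n" if "m \<in> M" for m using that assms int_vecs_subset_vecs by blast
  have ne: "annihilator k M \<noteq> {}" for k
    using subgroup_annihilator[of k M] unfolding subgroup_torus_iff by blast
  show "dist_half (Suc n) (annihilator (Suc n) M) \<le> dist_half n (annihilator n M)"
  proof (rule dist_half_greatest[OF ne])
    fix h assume "h \<in> annihilator n M"
    then obtain x where x: "x \<in> vecs n" "\<forall>m\<in>M. dot n m x \<in> \<int>" "h = torus_proj x"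
      by (auto simp: annihilator_def)
    define y where "y = x(n := 1/2)"
    have "y \<in> vecs (Suc n)" using x(1) by (auto simp: y_def vecs_def)
    moreover have "dot (Suc n) m y \<in> \<int>" if "m \<in> M" for m
    proof -
      have "dot n m y = dot n m x" by (rule dot_cong) (simp add: y_def)
      then show ?thesis using x(2) that Mv by (simp add: dot_Suc_restrict)
    qed
    ultimately have "torus_proj y \<in> annihilator (Suc n) M" by (auto simp: annihilator_def)
    then have "dist_half (Suc n) (annihilator (Suc n) M) \<le> center_dist (Suc n) (torus_proj y)"
      by (rule dist_half_le)
    also have "\<dots> = max (center_dist n (torus_proj y)) 0"
      by (simp add: center_dist_Suc torus_proj_def y_def)
    also have "center_dist n (torus_proj y) = center_dist n h"
      by (rule center_dist_cong) (simp add: x(3) y_def torus_proj_def)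
    finally show "dist_half (Suc n) (annihilator (Suc n) M) \<le> center_dist n h" by simp
  qed
  show "dist_half n (annihilator n M) \<le> dist_half (Suc n) (annihilator (Suc n) M)"
  proof (rule dist_half_greatest[OF ne])
    fix h assume "h \<in> annihilator (Suc n) M"
    then obtain x where x: "x \<in> vecs (Suc n)" "\<forall>m\<in>M. dot (Suc n) m x \<in> \<int>" "h = torus_proj x"
      by (auto simp: annihilator_def)
    define y where "y = x(n := 0)"
    have "y i = 0" if "n \<le> i" for i using x(1) that by (cases "i = n") (auto simp: y_def vecs_def)
    then have "y \<in> vecs n" by (simp add: vecs_def)
    moreover have "dot n m y \<in> \<int>" if "m \<in> M" for m
    proof -
      have "dot n m y = dot n m x" by (rule dot_cong) (simp add: y_def)
      then show ?thesis using x(2) that Mv dot_Suc_restrict by metis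
    qed
    ultimately have "torus_proj y \<in> annihilator n M" by (auto simp: annihilator_def)
    then have "dist_half n (annihilator n M) \<le> center_dist n (torus_proj y)" by (rule dist_half_le)
    also have "center_dist n (torus_proj y) = center_dist n h"
      by (rule center_dist_cong) (simp add: x(3) y_def torus_proj_def)
    also have "\<dots> \<le> center_dist (Suc n) h" by (simp add: center_dist_Suc)
    finally show "dist_half n (annihilator n M) \<le> center_dist (Suc n) h" .
  qed
qed

lemma subgroup_spectrum_add_coordinate: "subgroup_spectrum k n \<subseteq> subgroup_spectrum (Suc k) (Suc n)"
proof
  fix x assume "x \<in> subgroup_spectrum k n"
  then obtain H where H: "H \<in> closed_subgroups k n" "dist_half n H < 1/2" "x = dist_half n H"
    by (auto simp: subgroup_spectrum_def proper_subgroups_iff)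
  obtain M where M: "M \<subseteq> int_vecs n" "H = annihilator n M" "rvec.dim (orth n M) = k"
    using H(1) closed_subgroups_iff by blast
  have "M \<subseteq> int_vecs (Suc n)" using M(1) vecs_mono[of n, where 'a = real] by (auto simp: int_vecs_def)
  then have "annihilator (Suc n) M \<in> closed_subgroups (Suc k) (Suc n)"
    using dim_orth_Suc[OF M(1)] M(3) by (intro closed_subgroupsI) auto
  moreover have "dist_half (Suc n) (annihilator (Suc n) M) = x"
    using dist_half_annihilator_Suc[OF M(1)] H(3) M(2) by simp
  ultimately have "annihilator (Suc n) M \<in> proper_subgroups (Suc k) (Suc n)"
    "x = dist_half (Suc n) (annihilator (Suc n) M)"
    using H(2,3) by (simp_all add: proper_subgroups_iff)
  then show "x \<in> subgroup_spectrum (Suc k) (Suc n)" unfolding subgroup_spectrum_def by blast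
qed

definition drop_coord :: "nat \<Rightarrow> (nat \<Rightarrow> 'a) \<Rightarrow> nat \<Rightarrow> 'a"
  where "drop_coord j x = (\<lambda>a. x (if a < j then a else Suc a))"

lemma drop_coord_add: "drop_coord j (x + y) = drop_coord j x + drop_coord j y"
  by (simp add: drop_coord_def fun_eq_iff)

lemma drop_coord_minus: "drop_coord j (- x) = - drop_coord j x"
  by (simp add: drop_coord_def fun_eq_iff)

lemma drop_coord_rscale: "drop_coord j (rscale c x) = rscale c (drop_coord j x)"
  by (simp add: drop_coord_def rscale_def)

lemma drop_coord_torus_proj: "drop_coord j (torus_proj x) = torus_proj (drop_coord j x)"
  by (simp add: drop_coord_def torus_proj_def)

lemma drop_coord_0: "drop_coord j 0 = 0"
  by (simp add: drop_coord_def fun_eq_iff)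

lemma drop_coord_vecs: "j \<le> n \<Longrightarrow> x \<in> vecs (Suc n) \<Longrightarrow> drop_coord j x \<in> vecs n"
  by (auto simp: drop_coord_def vecs_def)

lemma drop_coord_int_vecs: "j \<le> n \<Longrightarrow> x \<in> int_vecs (Suc n) \<Longrightarrow> drop_coord j x \<in> int_vecs n"
  using drop_coord_vecs[of j n x] by (simp add: int_vecs_def) (simp add: drop_coord_def)

lemma drop_coord_surj:
  assumes "i \<le> n" "i \<noteq> j" "j \<le> n"
  shows "\<exists>a<n. \<forall>x :: nat \<Rightarrow> 'a. drop_coord j x a = x i"
proof (cases "i < j")
  case True
  then show ?thesis using assms by (intro exI[of _ i]) (simp add: drop_coord_def)
next
  case False
  then have "j < i" using assms(2) by simp
  then have "i - 1 < n" "\<not> i - 1 < j" "Suc (i - 1) = i" using assms(1) by auto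
  then show ?thesis by (intro exI[of _ "i - 1"]) (simp add: drop_coord_def)
qed

lemma center_dist_drop_coord:
  assumes "j \<le> n" "i \<le> n" "i \<noteq> j" "half_gap (x j) = half_gap (x i)"
  shows "center_dist n (drop_coord j x) = center_dist (Suc n) x"
proof (rule antisym)
  have "half_gap (drop_coord j x a) \<le> center_dist (Suc n) x" if "a < n" for a
    unfolding drop_coord_def using that by (intro center_dist_coord) auto
  then show "center_dist n (drop_coord j x) \<le> center_dist (Suc n) x" by (simp only: center_dist_le_iff) simp
  have le: "half_gap (x b) \<le> center_dist n (drop_coord j x)" if b: "b \<le> n" "b \<noteq> j" for b
  proof -
    obtain a where "a < n" "drop_coord j x a = x b"
      using drop_coord_surj[OF b assms(1)] by blast
    then show ?thesis using center_dist_coord[of a n "drop_coord j x"] by simp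
  qed
  have "half_gap (x b) \<le> center_dist n (drop_coord j x)" if "b < Suc n" for b
    using le[of b] le[OF assms(2,3)] assms(4) that by (cases "b = j") auto
  then show "center_dist (Suc n) x \<le> center_dist n (drop_coord j x)" by (simp only: center_dist_le_iff) simp
qed

lemma linear_drop_coord: "Vector_Spaces.linear rscale rscale (drop_coord j)"
  unfolding Vector_Spaces.linear_iff
  using rvec.vector_space_axioms by (simp add: drop_coord_add drop_coord_rscale)

lemma drop_coord_span: "drop_coord j ` rvec.span B = rvec.span (drop_coord j ` B)"
proof -
  interpret Vector_Spaces.linear rscale rscale "drop_coord j :: (nat \<Rightarrow> real) \<Rightarrow> _"
    by (rule linear_drop_coord)
  show ?thesis by (rule span_image[symmetric])
qed

lemma dim_drop_coord:
  assumes "rational_subspace n W" "inj_on (drop_coord j) W"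
  shows "rvec.dim (drop_coord j ` W) = rvec.dim W"
proof -
  interpret L: Vector_Spaces.linear rscale rscale "drop_coord j :: (nat \<Rightarrow> real) \<Rightarrow> _"
    by (rule linear_drop_coord)
  obtain B where B: "rvec.independent B" "W = rvec.span B" "card B = rvec.dim W"
    using rational_subspace_basis[OF assms(1)] by blast
  have "rvec.independent (drop_coord j ` B)"
    using B assms(2) by (intro L.independent_injective_image) auto
  then have "rvec.dim (drop_coord j ` W) = card (drop_coord j ` B)"
    unfolding B(2) drop_coord_span by (rule rvec.dim_span_eq_card_independent)
  also have "\<dots> = card B"
    using assms(2) unfolding B(2) by (rule card_image[OF inj_on_subset[OF _ rvec.span_superset]])
  finally show ?thesis using B(3) by simp
qed

lemma dim_orth_insert:
  assumes "m \<in> vecs n"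
  shows "rvec.dim (orth n M) \<le> Suc (rvec.dim (orth n (insert m M)))"
proof (cases "orth n M \<subseteq> orth n (insert m M)")
  case True
  then show ?thesis using dim_mono_vecs(1)[OF True orth_subset_vecs] by simp
next
  case False
  then obtain w0 where w0: "w0 \<in> orth n M" "dot n m w0 \<noteq> 0" by (auto simp: orth_def)
  obtain B where B: "B \<subseteq> orth n (insert m M)" "rvec.independent B" "orth n (insert m M) \<subseteq> rvec.span B"
    "card B = rvec.dim (orth n (insert m M))" using rvec.basis_exists .
  have "finite B" using finite_independent_vecs[OF B(2)] B(1) orth_subset_vecs by blast
  have "orth n M \<subseteq> rvec.span (insert w0 B)"
  proof
    fix w assume w: "w \<in> orth n M"
    define c where "c = dot n m w / dot n m w0"
    have "w - rscale c w0 \<in> orth n M"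
      by (rule rvec.subspace_diff[OF subspace_orth w rvec.subspace_scale[OF subspace_orth w0(1)]])
    moreover have "dot n m (w - rscale c w0) = 0"
      using w0(2) by (simp add: dot_diff_right dot_rscale_right c_def)
    ultimately have "w - rscale c w0 \<in> orth n (insert m M)" by (simp add: orth_def)
    then have "w - rscale c w0 \<in> rvec.span B" using B(3) by blast
    then show "w \<in> rvec.span (insert w0 B)" unfolding rvec.span_insert by blast
  qed
  then have "rvec.dim (orth n M) \<le> card (insert w0 B)" using \<open>finite B\<close> by (intro rvec.dim_le_card) auto
  also have "\<dots> \<le> Suc (card B)" by (rule card_insert_le_m1) simp_all
  finally show ?thesis using B(4) by simp
qed

lemma rational_subspace_of_dim:
  assumes "rational_subspace n W" "k \<le> rvec.dim W"
  obtains V where "rational_subspace n V" "V \<subseteq> W" "rvec.dim V = k"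
proof -
  obtain B where B: "B \<subseteq> int_vecs n" "rvec.independent B" "W = rvec.span B" "finite B" "card B = rvec.dim W"
    using rational_subspace_basis[OF assms(1)] .
  then obtain C where C: "C \<subseteq> B" "card C = k" using assms(2) by (metis obtain_subset_with_card_n)
  show ?thesis
  proof (rule that[of "rvec.span C"])
    show "rational_subspace n (rvec.span C)" unfolding rational_subspace_def using B(1) C(1) by blast
    show "rvec.span C \<subseteq> W" unfolding B(3) by (rule rvec.span_mono[OF C(1)])
    have "rvec.independent C" using B(2) C(1) rvec.independent_mono by blast
    then have "rvec.dim (rvec.span C) = card C" by (rule rvec.dim_span_eq_card_independent)
    then show "rvec.dim (rvec.span C) = k" using C(2) by simp
  qed
qed

text \<open>At a rational optimal point with two tight coordinates these coordinates agree up to sign. On the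
  subgroup given by this relation one of the two coordinates is redundant and can be dropped.\<close>

lemma subgroup_spectrum_drop_coordinate:
  assumes "0 < n" "x \<in> subgroup_spectrum (Suc k) (Suc n)"
  shows "x \<in> subgroup_spectrum k n"
proof -
  obtain H where H: "H \<in> closed_subgroups (Suc k) (Suc n)" "dist_half (Suc n) H < 1/2" "dist_half (Suc n) H = x"
    using assms(2) by (auto simp: subgroup_spectrum_def proper_subgroups_iff)
  note HD = closed_subgroupsD[OF H(1)]
  define M where "M = chars (Suc n) H"
  have M: "M \<subseteq> int_vecs (Suc n)" "annihilator (Suc n) M = H" "orth (Suc n) M = tangent (Suc n) H"
    using HD(2) by (simp_all add: M_def chars_int tangent_def)
  obtain u where u: "u \<in> orth (Suc n) M" "u \<noteq> 0"
    unfolding M(3) by (rule dim_pos_nonzero[OF HD(1)])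
  obtain x0 i j where x0: "x0 \<in> vecs (Suc n)" "torus_proj x0 \<in> annihilator (Suc n) M"
    "center_dist (Suc n) (torus_proj x0) = dist_half (Suc n) (annihilator (Suc n) M)"
    and ij: "i < Suc n" "j < Suc n" "i \<noteq> j"
    and tight0: "half_gap (torus_proj x0 i) = dist_half (Suc n) (annihilator (Suc n) M)"
    "half_gap (torus_proj x0 j) = dist_half (Suc n) (annihilator (Suc n) M)"
    by (rule optimum_two_tight[OF M(1) u]) (use assms(1) H(2) M(2) in auto)
  obtain y where y: "y \<in> vecs (Suc n)" "\<And>i. y i \<in> \<rat>" "torus_proj y \<in> H"
    "center_dist (Suc n) (torus_proj y) = x"
    and tight: "half_gap (torus_proj y i) = x"
    "half_gap (torus_proj y j) = x"
  proof (rule rational_optimum[OF M(1) x0])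
    fix y :: "nat \<Rightarrow> real" assume *: "y \<in> vecs (Suc n)" "\<And>i. y i \<in> \<rat>" "torus_proj y \<in> annihilator (Suc n) M"
      "center_dist (Suc n) (torus_proj y) = dist_half (Suc n) (annihilator (Suc n) M)"
      "\<And>i. i < Suc n \<Longrightarrow> half_gap (torus_proj x0 i) = dist_half (Suc n) (annihilator (Suc n) M) \<Longrightarrow>
        half_gap (torus_proj y i) = dist_half (Suc n) (annihilator (Suc n) M)"
    show thesis
    proof (rule that[of y])
      show "torus_proj y \<in> H" using *(3) M(2) by simp
      show "center_dist (Suc n) (torus_proj y) = x" using *(4) M(2) H(3) by simp
      show "half_gap (torus_proj y i) = x"
        using *(5)[OF ij(1) tight0(1)] M(2) H(3) by simp
      show "half_gap (torus_proj y j) = x"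
        using *(5)[OF ij(2) tight0(2)] M(2) H(3) by simp
    qed (rule *(1), rule *(2))
  qed
  have "y i - y j \<in> \<int> \<or> y i + y j \<in> \<int>"
    by (rule half_gap_tie) (use tight in \<open>simp add: torus_proj_def\<close>)
  then obtain s :: real where s: "s = 1 \<or> s = - 1" "y i - s * y j \<in> \<int>" by force
  \<comment> \<open>The character expressing the tie.\<close>
  define m where "m = unit_vec i - rscale s (unit_vec j)"
  have "s \<in> \<int>" using s(1) by auto
  then have m_int: "m \<in> int_vecs (Suc n)"
    unfolding m_def using ij by (intro int_vecs_diff int_vecs_rscale unit_vec_int)
  have dot_m: "dot (Suc n) m v = v i - s * v j" for v
  proof -
    have "dot (Suc n) m v = dot (Suc n) v (unit_vec i) - s * dot (Suc n) v (unit_vec j)"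
      by (simp only: m_def dot_commute[of "Suc n" _ v] dot_diff_right dot_rscale_right)
    moreover have "dot (Suc n) v (unit_vec a) = v a" if "a < Suc n" for a
      using that by (simp add: dot_def unit_vec_def if_distrib cong: if_cong)
    ultimately show ?thesis using ij by simp
  qed
  define G where "G = annihilator (Suc n) (insert m M)"
  have mM: "insert m M \<subseteq> int_vecs (Suc n)" using m_int M(1) by blast
  have G: "G \<in> closed_subgroups (rvec.dim (orth (Suc n) (insert m M))) (Suc n)"
    unfolding G_def by (rule closed_subgroupsI[OF mM refl])
  have tanG: "tangent (Suc n) G = orth (Suc n) (insert m M)" unfolding G_def by (rule tangent_annihilator[OF mM])
  have GH: "G \<subseteq> H"
    unfolding G_def M(2)[symmetric] annihilator_def by blast
  have yG: "torus_proj y \<in> G"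
    using y(1,3) s(2) torus_proj_in_annihilator_iff[OF M(1) y(1)] torus_proj_in_annihilator_iff[OF mM y(1)] M(2)
    by (simp add: G_def dot_m)
  have "Suc k \<le> Suc (rvec.dim (orth (Suc n) (insert m M)))"
    using dim_orth_insert[of m "Suc n" M] m_int int_vecs_subset_vecs M(3) HD(1) by auto
  then have "k \<le> rvec.dim (tangent (Suc n) G)" using tanG by simp
  then obtain W where W: "rational_subspace (Suc n) W" "W \<subseteq> tangent (Suc n) G" "rvec.dim W = k"
    using rational_subspace_of_dim[OF rational_tangent] by blast
  obtain N :: nat where N: "N > 0" "rscale (real N) y \<in> int_vecs (Suc n)"
    using rational_torsion_point[OF y(1,2)] by blast
  define F where "F = torsion (Suc n) N G"
  define K where "K = {t + f | t f. t \<in> torus_proj ` W \<and> f \<in> F}"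
  have K: "K \<subseteq> G" "F \<subseteq> K" 
    using subtorus_plus_torsion(3,4)[OF G W(1,2) N(1)] unfolding K_def F_def by blast+
  have yF: "torus_proj y \<in> F" unfolding F_def torsion_def using yG y(1) N(2) by blast
  have jn: "j \<le> n" "i \<le> n" using ij by simp_all
  have coord: "half_gap (h j) = half_gap (h i)" if h: "h \<in> G" for h
  proof -
    obtain z where z: "z \<in> vecs (Suc n)" "\<forall>m\<in>insert m M. dot (Suc n) m z \<in> \<int>" "h = torus_proj z"
      using h by (auto simp: G_def annihilator_def)
    then have zi: "z i - s * z j \<in> \<int>" using dot_m[of z] by auto
    have "h i = to_circle (s * z j)" using zi by (simp add: z(3) torus_proj_def to_circle_eq_iff)
    then have "h i = h j \<or> h i = - h j"
      using s(1) by (auto simp: z(3) torus_proj_def to_circle_minus)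
    then show ?thesis using half_gap_opposite[of "h j"] by auto
  qed
  have cd: "center_dist n (drop_coord j h) = center_dist (Suc n) h" if "h \<in> G" for h
    by (rule center_dist_drop_coord[OF jn(1,2) ij(3) coord[OF that]])
  have inj: "inj_on (drop_coord j) W"
  proof (rule inj_onI)
    fix v w assume vw: "v \<in> W" "w \<in> W" "drop_coord j v = drop_coord j w"
    have ne: "v b = w b" if b: "b \<noteq> j" for b
    proof (cases "b \<le> n")
      case True
      then obtain a where "\<And>x :: nat \<Rightarrow> real. drop_coord j x a = x b"
        using drop_coord_surj[OF True b jn(1), where 'a = real] by blast
      then show ?thesis using vw(3) by metis
    next
      case False
      moreover have "v \<in> vecs (Suc n)" "w \<in> vecs (Suc n)"
        using vw(1,2) rational_subspaceD(2)[OF W(1)] by blast+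
      ultimately show ?thesis by (simp add: vecs_def)
    qed
    have "dot (Suc n) m v = 0" "dot (Suc n) m w = 0"
      using vw(1,2) W(2) tanG unfolding orth_def by blast+
    then have "v i - s * v j = 0" "w i - s * w j = 0" by (simp_all only: dot_m)
    then have "s * v j = s * w j" using ne[OF ij(3)] by simp
    then have "v j = w j" using s(1) by auto
    then have "v b = w b" for b using ne[of b] by (cases "b = j") simp_all
    then show "v = w" by (rule ext)
  qed
  define W' where "W' = drop_coord j ` W"
  define F' where "F' = drop_coord j ` F"
  define K' where "K' = {t + f | t f. t \<in> torus_proj ` W' \<and> f \<in> F'}"
  have W'_rat: "rational_subspace n W'"
  proof -
    obtain B where B: "B \<subseteq> int_vecs (Suc n)" "W = rvec.span B" using W(1) by (auto simp: rational_subspace_def)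
    have "drop_coord j ` B \<subseteq> int_vecs n" using B(1) drop_coord_int_vecs[OF jn(1)] by blast
    then show ?thesis unfolding rational_subspace_def W'_def B(2) drop_coord_span by blast
  qed
  have W'_dim: "rvec.dim W' = k" unfolding W'_def using dim_drop_coord[OF W(1) inj] W(3) by simp
  have subG: "subgroup G (torus (Suc n))" unfolding G_def by (rule subgroup_annihilator)
  have "K' \<in> closed_subgroups (rvec.dim W') n"
    unfolding K'_def
  proof (rule subtorus_plus_finite(1)[OF W'_rat])
    show "finite F'" unfolding F'_def F_def using finite_torsion[OF N(1)] by blast
    have "F \<subseteq> vecs (Suc n)" using K GH HD(6) by blast
    then show "F' \<subseteq> vecs n" unfolding F'_def using drop_coord_vecs[OF jn(1)] by blast
    show "0 \<in> F'"
      unfolding F'_def F_def using torsion_group(1)[OF subG, of N] drop_coord_0 by (metis imageI)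
    show "f + g \<in> F'" if fg: "f \<in> F'" "g \<in> F'" for f g
    proof -
      obtain a b where ab: "a \<in> F" "b \<in> F" "f = drop_coord j a" "g = drop_coord j b" using fg by (auto simp: F'_def)
      have "drop_coord j (a + b) \<in> F'"
        unfolding F'_def using torsion_group(2)[OF subG] ab(1,2) unfolding F_def by blast
      then show ?thesis by (simp only: drop_coord_add ab)
    qed
    show "- f \<in> F'" if f: "f \<in> F'" for f
    proof -
      obtain a where a: "a \<in> F" "f = drop_coord j a" using f by (auto simp: F'_def)
      have "drop_coord j (- a) \<in> F'"
        unfolding F'_def using torsion_group(3)[OF subG] a(1) unfolding F_def by blast
      then show ?thesis by (simp only: drop_coord_minus a)
    qed
  qed
  then have K'_cl: "K' \<in> closed_subgroups k n" using W'_dim by simp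
  have K'_lift: "\<exists>h\<in>K. g = drop_coord j h" if g: "g \<in> K'" for g
  proof -
    obtain w f where wf: "w \<in> W" "f \<in> F" "g = torus_proj (drop_coord j w) + drop_coord j f"
      using g by (auto simp: K'_def W'_def F'_def)
    have "torus_proj w + f \<in> K" unfolding K_def using wf by blast
    moreover have "g = drop_coord j (torus_proj w + f)"
      by (simp add: wf(3) drop_coord_add drop_coord_torus_proj)
    ultimately show ?thesis by blast
  qed
  have "x \<le> dist_half n K'"
  proof (rule dist_half_greatest)
    show "K' \<noteq> {}" using closed_subgroupsD(7)[OF K'_cl] by blast
    fix g assume "g \<in> K'"
    then obtain h where h: "h \<in> K" "g = drop_coord j h" using K'_lift by blast
    then have "h \<in> G" using K(1) by blast
    then have "center_dist n g = center_dist (Suc n) h" using cd h(2) by simp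
    also have "\<dots> \<ge> x" using dist_half_le[of h H "Suc n"] \<open>h \<in> G\<close> GH H(3) by blast
    finally show "x \<le> center_dist n g" .
  qed
  moreover have "dist_half n K' \<le> x"
  proof -
    have "torus_proj 0 \<in> torus_proj ` W'"
      by (rule imageI[OF rvec.subspace_0[OF rational_subspaceD(1)[OF W'_rat]]])
    moreover have "drop_coord j (torus_proj y) \<in> F'" unfolding F'_def using yF by (rule imageI)
    ultimately have "torus_proj 0 + drop_coord j (torus_proj y) \<in> K'" unfolding K'_def by blast
    then have "drop_coord j (torus_proj y) \<in> K'" by simp
    then have "dist_half n K' \<le> center_dist n (drop_coord j (torus_proj y))" by (rule dist_half_le)
    then show ?thesis using cd[OF yG] y(4) by simp
  qed
  ultimately have "dist_half n K' = x" by simp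
  then have "K' \<in> proper_subgroups k n" using K'_cl H(2,3) by (simp add: proper_subgroups_iff)
  then show ?thesis unfolding subgroup_spectrum_def using \<open>dist_half n K' = x\<close> by blast
qed

lemma subgroup_spectrum_1_1: "subgroup_spectrum 1 1 \<subseteq> {0}"
proof
  fix x assume "x \<in> subgroup_spectrum 1 1"
  then obtain H where H: "H \<in> proper_subgroups 1 1" "x = dist_half 1 H"
    unfolding subgroup_spectrum_def by blast
  then have "H \<in> closed_subgroups 1 1" by (simp only: proper_subgroups_iff)
  note HD = closed_subgroupsD[OF this]
  obtain u where u: "u \<in> tangent 1 H" "u \<noteq> 0"
    by (rule dim_pos_nonzero[OF HD(1)[unfolded One_nat_def]]) simp
  then have u_vec: "u \<in> vecs 1" using tangent_subset_vecs by blast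
  have "u 0 \<noteq> 0"
  proof
    assume "u 0 = 0"
    then have "u i = 0" for i using u_vec by (cases "i = 0") (simp_all add: vecs_def)
    then show False using u(2) by (simp add: fun_eq_iff)
  qed
  define h where "h = torus_proj (rscale (1 / (2 * u 0)) u)"
  have "rscale (1 / (2 * u 0)) u \<in> tangent 1 H" using u(1) by (rule rvec.subspace_scale[OF subspace_tangent])
  then have "h \<in> H" using HD(5) unfolding h_def by blast
  then have "dist_half 1 H \<le> center_dist 1 h" by (rule dist_half_le)
  also have "\<dots> \<le> 0"
  proof -
    have "h 0 = to_circle (1/2)" using \<open>u 0 \<noteq> 0\<close> by (simp add: h_def torus_proj_def rscale_def)
    then show ?thesis unfolding center_dist_le_iff by simp
  qed
  finally have "dist_half 1 H \<le> 0" .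
  moreover have "0 \<le> dist_half 1 H" using HD(7) by (intro dist_half_nonneg) auto
  ultimately show "x \<in> {0}" using H(2) by simp
qed

text \<open>For \<open>n = 0\<close> there is no pair of coordinates to compare; the group is the whole circle.\<close>

lemma subgroup_spectrum_Suc_Suc:
  assumes "k \<le> n"
  shows "subgroup_spectrum (Suc k) (Suc n) = subgroup_spectrum k n"
proof
  show "subgroup_spectrum k n \<subseteq> subgroup_spectrum (Suc k) (Suc n)" by (rule subgroup_spectrum_add_coordinate)
  show "subgroup_spectrum (Suc k) (Suc n) \<subseteq> subgroup_spectrum k n"
  proof (cases "n = 0")
    case True
    then show ?thesis using assms subgroup_spectrum_1_1 subgroup_spectrum_0_0 by simp
  next
    case False
    then show ?thesis using subgroup_spectrum_drop_coordinate[of n _ k] by blast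
  qed
qed

lemma subgroup_spectrum_reduce:
  "d \<le> n \<Longrightarrow> subgroup_spectrum d n = subgroup_spectrum 0 (n - d)"
proof (induction d arbitrary: n)
  case (Suc d)
  then obtain n' where "n = Suc n'" by (cases n) auto
  then show ?case using Suc.IH[of n'] Suc.prems subgroup_spectrum_Suc_Suc[of d n'] by simp
qed simp

section \<open>One-dimensional subtori\<close>

text \<open>Optimal times for the line spanned by \<open>u\<close> are rational with a common denominator. Giving a new
  coordinate a speed divisible by this denominator puts it at the worst place at these times, so the
  value strictly increases; as the speed grows the value returns to the old one.\<close>

lemma subtorus_spectrum_subset_acc_points:
  assumes "0 < m"
  shows "subtorus_spectrum 1 m \<subseteq> acc_points (subtorus_spectrum 1 (Suc m))"
proof
  fix x assume "x \<in> subtorus_spectrum 1 m"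
  then obtain T where "T \<in> proper_subtori 1 m" "x = dist_half m T"
    unfolding subtorus_spectrum_def by blast
  then have T: "T \<in> subtori 1 m" "dist_half m T < 1/2" "dist_half m T = x"
    by (simp_all only: proper_subtori_iff)
  obtain W where W: "T = torus_proj ` W" "rational_subspace m W" "rvec.dim W = 1"
    using T(1) unfolding subtori_eq by blast
  obtain B where B: "B \<subseteq> int_vecs m" "rvec.independent B" "W = rvec.span B" "finite B" "card B = rvec.dim W"
    using rational_subspace_basis[OF W(2)] .
  then have "card B = 1" using W(3) by simp
  then obtain u where "B = {u}" by (rule card_1_singletonE)
  then have u: "u \<in> int_vecs m" "W = rvec.span {u}" using B(1,3) by simp_all
  have u_vec: "u \<in> vecs m" using u(1) int_vecs_subset_vecs by blast
  have u_int: "u i \<in> \<int>" for i using u(1) by (simp add: int_vecs_def)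
  have Tc: "T \<in> closed_subgroups 1 m" using T(1) subtori_subset_closed_subgroups by blast
  have line: "torus_proj (rscale t u) \<in> T" for t
    unfolding W(1) u(2) by (intro imageI rvec.span_scale rvec.span_base) simp
  have tight_time: "\<exists>i<m. half_gap (to_circle (t * u i)) = x"
    if "center_dist m (torus_proj (rscale t u)) \<le> x" for t
  proof -
    have "center_dist m (torus_proj (rscale t u)) = x"
      using that dist_half_le[OF line[of t], of m] T(3) by simp
    moreover obtain i where "i < m"
      "half_gap (torus_proj (rscale t u) i) = center_dist m (torus_proj (rscale t u))"
      using center_dist_attained[OF assms] .
    ultimately show ?thesis by (intro exI[of _ i]) (simp add: torus_proj_def rscale_def)
  qed
  have "x \<in> \<rat>"
  proof -
    obtain y where y: "\<And>i. y i \<in> \<rat>" "center_dist m (torus_proj y) = x"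
      using rational_optimum_exists[OF Tc] T(3) by blast
    obtain i where "half_gap (torus_proj y i) = center_dist m (torus_proj y)"
      using center_dist_attained[OF assms] .
    then have "half_gap (torus_proj y i) = x" by (simp only: y(2))
    then have "x = \<bar>y i - (of_int \<lfloor>y i\<rfloor> + 1/2)\<bar>" by (simp only: torus_proj_def half_gap_cell)
    then show ?thesis using y(1)[of i] by (auto intro!: Rats_abs_iff[THEN iffD2] Rats_diff Rats_add)
  qed
  then obtain p q :: int where pq: "q > 0" "x = of_int p / of_int q" by (rule Rats_cases')
  \<comment> \<open>At an optimal time \<open>t\<close> some \<open>t u\<^sub>i\<close> is \<open>\<plusminus> x\<close> modulo \<open>1/2\<close>, so \<open>2 q P t\<close> is an integer.\<close>
  define P where "P = (\<Prod>i<m. if u i = 0 then 1 else \<bar>u i\<bar>)"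
  have P1: "1 \<le> P"
    unfolding P_def using u_int Ints_nonzero_abs_ge1 by (intro prod_ge_1) auto
  have P_div: "P / u i \<in> \<int>" if "i < m" "u i \<noteq> 0" for i
  proof -
    have "P = \<bar>u i\<bar> * (\<Prod>k\<in>{..<m} - {i}. if u k = 0 then 1 else \<bar>u k\<bar>)"
      unfolding P_def using that by (subst prod.remove[of _ i]) auto
    then have "P / u i = sgn (u i) * (\<Prod>k\<in>{..<m} - {i}. if u k = 0 then 1 else \<bar>u k\<bar>)"
      using that(2) by (simp add: sgn_real_def)
    also have "\<dots> \<in> \<int>" using u_int by (intro Ints_mult Ints_prod) (auto simp: sgn_real_def)
    finally show ?thesis .
  qed
  define N where "N = (\<lambda>j :: nat. 2 * of_int q * P * real (Suc j))"
  have P_int: "P \<in> \<int>" unfolding P_def using u_int by (intro Ints_prod) auto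
  have N_int: "N j \<in> \<int>" for j unfolding N_def by (intro Ints_mult P_int) auto
  have N_ge: "real (Suc j) \<le> N j" for j
  proof -
    have "1 * 1 \<le> 2 * of_int q * P" using pq(1) P1 by (intro mult_mono) auto
    then show ?thesis unfolding N_def using mult_right_mono[of 1 "2 * of_int q * P" "real (Suc j)"] by simp
  qed
  have N_pos: "0 < N j" for j using N_ge[of j] by simp
  have N_opt: "t * N j \<in> \<int>" if t: "center_dist m (torus_proj (rscale t u)) \<le> x" for t j
  proof -
    obtain i where i: "i < m" "half_gap (to_circle (t * u i)) = x"
      using tight_time[OF t] by blast
    define c where "c = of_int \<lfloor>t * u i\<rfloor> + (1/2 :: real)"
    have "\<bar>t * u i - c\<bar> = x" using i(2) by (simp only: half_gap_cell c_def)
    then have "t * u i = c + x \<or> t * u i = c - x" by linarith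
    then have "2 * of_int q * (t * u i) = of_int (q * (2 * \<lfloor>t * u i\<rfloor> + 1) + 2 * p) \<or>
        2 * of_int q * (t * u i) = of_int (q * (2 * \<lfloor>t * u i\<rfloor> + 1) - 2 * p)"
      using pq by (auto simp: c_def field_simps)
    then have int: "2 * of_int q * (t * u i) \<in> \<int>" by (metis Ints_of_int)
    have "u i \<noteq> 0"
    proof
      assume "u i = 0"
      then have "half_gap (to_circle (t * u i)) = 1/2"
        using half_gap_eq_iff[of 0] by (simp add: to_circle_0)
      then show False using i(2) T(2,3) by simp
    qed
    then have "t * N j = (P / u i) * real (Suc j) * (2 * of_int q * (t * u i))"
      by (simp add: N_def field_simps)
    also have "\<dots> \<in> \<int>" 
      by (rule Ints_mult[OF Ints_mult[OF P_div[OF i(1) \<open>u i \<noteq> 0\<close>] Ints_of_nat] int])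
    finally show ?thesis .
  qed
  define v where "v = (\<lambda>j. u(m := N j))"
  define L where "L = (\<lambda>j. torus_proj ` rvec.span {v j})"
  have L: "L j \<in> subtori 1 (Suc m)" for j
  proof -
    have "v j \<in> int_vecs (Suc m)" using u_vec u_int N_int by (auto simp: v_def int_vecs_def vecs_def)
    then have "rational_subspace (Suc m) (rvec.span {v j})" unfolding rational_subspace_def by blast
    moreover have "v j \<noteq> 0" using N_pos[of j] by (auto simp: v_def fun_eq_iff)
    then have "rvec.dim (rvec.span {v j}) = card {v j}"
      by (intro rvec.dim_span_eq_card_independent) simp
    ultimately show ?thesis unfolding subtori_eq L_def by auto
  qed
  have L_line: "torus_proj (rscale t (v j)) \<in> L j" for t j
    unfolding L_def by (intro imageI rvec.span_scale rvec.span_base) simp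
  have cd: "center_dist (Suc m) (torus_proj (rscale t (v j))) =
      max (center_dist m (torus_proj (rscale t u))) (half_gap (to_circle (t * N j)))" for t j
  proof -
    have "center_dist m (torus_proj (rscale t (v j))) = center_dist m (torus_proj (rscale t u))"
      by (rule center_dist_cong) (simp add: torus_proj_def rscale_def v_def)
    then show ?thesis by (simp add: center_dist_Suc) (simp add: torus_proj_def rscale_def v_def)
  qed
  have greater: "x < dist_half (Suc m) (L j)" for j
  proof -
    have Lc: "L j \<in> closed_subgroups 1 (Suc m)" using L subtori_subset_closed_subgroups by blast
    obtain h where h: "h \<in> L j" "center_dist (Suc m) h = dist_half (Suc m) (L j)"
      using dist_half_attained[OF closed_subgroupsD(4)[OF Lc]] closed_subgroupsD(7)[OF Lc] by blast
    then obtain t where t: "h = torus_proj (rscale t (v j))" unfolding L_def rvec.span_singleton by blast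
    show ?thesis
    proof (rule ccontr)
      assume "\<not> x < dist_half (Suc m) (L j)"
      then have le: "center_dist m (torus_proj (rscale t u)) \<le> x"
        "half_gap (to_circle (t * N j)) \<le> x"
        using h(2) cd[of t j] by (simp_all add: t)
      have "to_circle (t * N j) = 0" using N_opt[OF le(1)] by (simp add: to_circle_0[symmetric] to_circle_eq_iff)
      then have "half_gap (to_circle (t * N j)) = 1/2"
        by (simp only: half_gap_eq_iff)
      then show False using le(2) T(2,3) by simp
    qed
  qed
  define C where "C = 1 + (\<Sum>i<m. \<bar>u i\<bar>)"
  have "1 \<le> C" by (simp add: C_def sum_nonneg)
  have upper: "dist_half (Suc m) (L j) \<le> x + C / N j" for j
  proof -
    obtain h where h: "h \<in> T" "center_dist m h = x"
      using dist_half_attained[OF closed_subgroupsD(4)[OF Tc], of m] closed_subgroupsD(7)[OF Tc] T(3) by blast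
    then obtain t0 where t0: "h = torus_proj (rscale t0 u)" unfolding W(1) u(2) rvec.span_singleton by blast
    \<comment> \<open>A time within one period of the new coordinate from \<open>t0\<close> at which this coordinate is \<open>1/2\<close>.\<close>
    define t where "t = (of_int \<lfloor>t0 * N j\<rfloor> + 1/2) / N j"
    have tN: "t * N j = of_int \<lfloor>t0 * N j\<rfloor> + 1/2" using N_pos[of j] by (simp add: t_def)
    have "\<bar>(t - t0) * N j\<bar> \<le> 1" unfolding left_diff_distrib tN by linarith
    then have "\<bar>t - t0\<bar> * N j \<le> 1" using N_pos[of j] by (simp only: abs_mult abs_of_pos)
    then have diff: "\<bar>t - t0\<bar> \<le> 1 / N j" using N_pos[of j] by (simp add: pos_le_divide_eq)
    have "\<bar>rscale t u i - rscale t0 u i\<bar> < C / N j" if "i < m" for i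
    proof -
      have "\<bar>rscale t u i - rscale t0 u i\<bar> = \<bar>t - t0\<bar> * \<bar>u i\<bar>"
        by (simp add: rscale_def left_diff_distrib[symmetric] abs_mult)
      also have "\<dots> \<le> 1 / N j * \<bar>u i\<bar>" using diff by (rule mult_right_mono) simp
      also have "\<bar>u i\<bar> \<le> (\<Sum>i<m. \<bar>u i\<bar>)" using that by (intro member_le_sum) auto
      then have "1 / N j * \<bar>u i\<bar> < 1 / N j * C" using N_pos[of j] by (intro mult_strict_left_mono) (auto simp: C_def)
      finally show ?thesis by simp
    qed
    then have "torus_proj (rscale t u) \<in> nbhd m (C / N j) h" unfolding t0 by (rule nbhd_proj)
    then have "center_dist m (torus_proj (rscale t u)) \<le> x + C / N j"
      using center_dist_nbhd[of _ m "C / N j" h] h(2) N_pos[of j] \<open>1 \<le> C\<close> by simp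
    moreover have "to_circle (t * N j) = to_circle (1/2)" unfolding to_circle_eq_iff tN by simp
    moreover have "0 \<le> x + C / N j"
      using center_dist_nonneg[of m h] h(2) N_pos[of j] \<open>1 \<le> C\<close> by (simp add: add_nonneg_nonneg)
    ultimately have "center_dist (Suc m) (torus_proj (rscale t (v j))) \<le> x + C / N j" by (simp add: cd)
    then show ?thesis using dist_half_le[OF L_line[of t j], of "Suc m"] by simp
  qed
  show "x \<in> acc_points (subtorus_spectrum 1 (Suc m))"
    unfolding acc_points_def mem_Collect_eq islimpt_approachable
  proof (intro allI impI)
    fix e :: real assume "e > 0"
    define e' where "e' = min e (1/2 - x)"
    have "e' > 0" using \<open>e > 0\<close> T(2,3) by (simp add: e'_def)
    then have "0 < e' / C" using \<open>1 \<le> C\<close> by simp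
    then obtain j where j: "inverse (real (Suc j)) < e' / C" using reals_Archimedean by blast
    have "C / N j \<le> C / real (Suc j)" using N_ge[of j] \<open>1 \<le> C\<close> by (intro divide_left_mono) auto
    also have "\<dots> < e'" using j \<open>1 \<le> C\<close> by (simp add: field_simps)
    finally have less: "dist_half (Suc m) (L j) < x + e'" using upper[of j] by simp
    then have "L j \<in> proper_subtori 1 (Suc m)" using L by (simp add: proper_subtori_iff e'_def)
    then have "dist_half (Suc m) (L j) \<in> subtorus_spectrum 1 (Suc m)" unfolding subtorus_spectrum_def by blast
    moreover have "dist (dist_half (Suc m) (L j)) x < e" using less greater[of j] by (simp add: dist_real_def e'_def)
    ultimately show "\<exists>y\<in>subtorus_spectrum 1 (Suc m). y \<noteq> x \<and> dist y x < e" using greater[of j] by force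
  qed
qed

section \<open>Spectra and their density points\<close>

lemma density_points_subtorus_spectrum:
  assumes "1 \<le> k"
  shows "density_points (subtorus_spectrum_mult k n) = subtorus_spectrum (Suc k) n"
proof -
  have eq: "subtorus_spectrum_mult k n = (\<lambda>x. ecard {K \<in> proper_subtori k n. dist_half n K = x})"
    by (simp add: subtorus_spectrum_mult_def fun_eq_iff)
  show ?thesis
  proof (intro equalityI subsetI)
    fix x assume "x \<in> density_points (subtorus_spectrum_mult k n)"
    then show "x \<in> subtorus_spectrum (Suc k) n"
      unfolding eq by (intro limit_of_subtorus_values infinite_near_density_point)
  next
    fix x assume "x \<in> subtorus_spectrum (Suc k) n"
    then have "infinite {K \<in> proper_subtori k n. dist_half n K = x}"
      by (rule subtorus_spectrum_infinite_multiplicity[OF _ assms])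
    then show "x \<in> density_points (subtorus_spectrum_mult k n)"
      unfolding eq density_points_ecard by blast
  qed
qed

lemma density_points_subgroup_spectrum:
  "density_points (subgroup_spectrum_mult k n) = subgroup_spectrum (Suc k) n"
proof -
  have eq: "subgroup_spectrum_mult k n = (\<lambda>x. ecard {K \<in> proper_subgroups k n. dist_half n K = x})"
    by (simp add: subgroup_spectrum_mult_def fun_eq_iff)
  show ?thesis
  proof (intro equalityI subsetI)
    fix x assume "x \<in> density_points (subgroup_spectrum_mult k n)"
    then show "x \<in> subgroup_spectrum (Suc k) n"
      unfolding eq by (intro limit_of_subgroup_values infinite_near_density_point)
  next
    fix x assume "x \<in> subgroup_spectrum (Suc k) n"
    then have "infinite {K \<in> proper_subgroups k n. dist_half n K = x}"
      by (rule subgroup_spectrum_infinite_multiplicity)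
    then show "x \<in> density_points (subgroup_spectrum_mult k n)"
      unfolding eq density_points_ecard by blast
  qed
qed

lemma acc_points_subtorus_spectrum: "acc_points (subtorus_spectrum k n) \<subseteq> subtorus_spectrum (Suc k) n"
  unfolding subtorus_spectrum_def[of k]
  by (intro subsetI limit_of_subtorus_values infinite_near_acc_point)

lemma subtorus_spectrum_subset: "subtorus_spectrum k n \<subseteq> subgroup_spectrum k n"
  unfolding subtorus_spectrum_def subgroup_spectrum_def by (intro image_mono proper_subtori_subset)

theorem theorem1p4:
  fixes n k k' :: nat
  assumes "n \<ge> 2" and "1 \<le> k" and "k < n" and "k' < n"
  shows "(\<nexists>x. lower_acc_point (subtorus_spectrum k n) x)
    \<and> (\<nexists>x. lower_acc_point (subgroup_spectrum k' n) x)
    \<and> acc_points (subtorus_spectrum k n) \<subseteq> subtorus_spectrum (k + 1) n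
    \<and> subtorus_spectrum (k + 1) n \<subseteq> subgroup_spectrum (k + 1) n
    \<and> subgroup_spectrum (k + 1) n = subgroup_spectrum 0 (n - k - 1)
    \<and> density_points (subtorus_spectrum_mult k n) = subtorus_spectrum (k + 1) n
    \<and> density_points (subgroup_spectrum_mult k' n) = subgroup_spectrum (k' + 1) n
    \<and> subgroup_spectrum (k' + 1) n = subgroup_spectrum k' (n - 1)
    \<and> (k = 1 \<longrightarrow>
          subtorus_spectrum 1 (n - 1) \<subseteq> acc_points (subtorus_spectrum 1 n)
        \<and> acc_points (subtorus_spectrum 1 n) \<subseteq> subtorus_spectrum 2 n
        \<and> subtorus_spectrum 2 n \<subseteq> subgroup_spectrum 2 n
        \<and> subgroup_spectrum 2 n = subgroup_spectrum 1 (n - 1))"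
proof -
  obtain m where m: "n = Suc m" "0 < m" using \<open>n \<ge> 2\<close> by (cases n) auto
  have drop: "subgroup_spectrum (d + 1) n = subgroup_spectrum d (n - 1)" if "d < n" for d
    using subgroup_spectrum_Suc_Suc[of d m] that by (simp add: m(1))
  have "\<not> lower_acc_point (subtorus_spectrum k n) x" for x
    unfolding subtorus_spectrum_def
    by (rule no_lower_acc_point[of _ k])
       (use subtori_subset_closed_subgroups in \<open>auto simp: proper_subtori_def\<close>)
  moreover have "\<not> lower_acc_point (subgroup_spectrum k' n) x" for x
    unfolding subgroup_spectrum_def
    by (rule no_lower_acc_point[of _ k']) (auto simp: proper_subgroups_def)
  moreover have "subgroup_spectrum (k + 1) n = subgroup_spectrum 0 (n - k - 1)"
    using subgroup_spectrum_reduce[of "k + 1" n] \<open>k < n\<close> by simp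
  moreover have "subgroup_spectrum 2 n = subgroup_spectrum 1 (n - 1)"
    using drop[of 1] \<open>n \<ge> 2\<close> by (simp add: numeral_2_eq_2)
  moreover have "subtorus_spectrum 1 (n - 1) \<subseteq> acc_points (subtorus_spectrum 1 n)"
    using subtorus_spectrum_subset_acc_points[OF m(2)] by (simp add: m(1))
  moreover have "acc_points (subtorus_spectrum 1 n) \<subseteq> subtorus_spectrum 2 n"
    using acc_points_subtorus_spectrum[of 1 n] by (simp add: numeral_2_eq_2)
  ultimately show ?thesis
    using acc_points_subtorus_spectrum[of k n] subtorus_spectrum_subset[of "k + 1" n]
      subtorus_spectrum_subset[of 2 n]
      density_points_subtorus_spectrum[OF \<open>1 \<le> k\<close>, of n] density_points_subgroup_spectrum[of k' n]
      drop[OF \<open>k' < n\<close>]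
    by simp
qed

end
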